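(* Let $J$ be a non-negative integer or half-integer and let $f:[0,1]\to\mathbb{R}$ be a concave function. Then for any density matrix $\rho$ on $\mathcal{H}_J=\mathbb{C}^{2J+1}$ we have $$\frac{2J+1}{4\pi}\int_{\mathbb{S}^2} f\big({}_J\langle\omega|\rho|\omega\rangle_J\big)\,d\omega\;\geq\;\frac{2J+1}{4\pi}\int_{\mathbb{S}^2} f\big(|{}_J\langle\omega|\uparrow\rangle_J|^2\big)\,d\omega .$$ By $SU(2)$ invariance, $\uparrow$ may be replaced by any other point of $\mathbb{S}^2$.
   Context: For each integer or half-integer $J\ge 0$, $\mathcal{H}_J=\mathbb{C}^{2J+1}$ denotes the irreducible spin-$J$ representation space of $SU(2)$, and $\mathbf{S}_J=(S_x,S_y,S_z)$ is the vector of spin operators on $\mathcal{H}_J$ (the representation of the standard generators, self-adjoint, with $[S_x,S_y]=iS_z$ and cyclic permutations). For $\omega\in\mathbb{S}^2$ (the unit sphere in $\mathbb{R}^3$), the Bloch coherent state $|\omega\rangle_J\in\mathcal{H}_J$ is a unit vector, unique up to phase, spanning the one-dimensional eigenspace of $\omega\cdot\mathbf{S}_J$ with eigenvalue $J$; only the projection $|\omega\rangle_J\,{}_J\langle\omega|$ matters. $\uparrow\in\mathbb{S}^2$ is the north pole. $d\omega$ is the standard surface measure on $\mathbb{S}^2$ (total mass $4\pi$). A density matrix is a positive semi-definite operator of trace $1$. *)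

theory Defs
  imports "HOL-Analysis.Analysis" "Jordan_Normal_Form.Schur_Decomposition"
begin

text \<open>
  Throughout, \<open>n = 2J\<close>, so the spin-\<open>J\<close> space is \<open>carrier_vec (n + 1)\<close> over the complex numbers.
  The standard basis vector number \<open>k\<close> is the \<open>S\<^sub>z\<close>-eigenvector with eigenvalue \<open>m = J - k\<close>.
  The inner product \<open>\<langle>u|v\<rangle>\<close>, antilinear in \<open>u\<close>, is \<open>v \<bullet>c u\<close>.
\<close>

subsection \<open>Spin operators\<close>

text \<open>
  The raising operator is \<open>S\<^sub>+ |m\<rangle> = sqrt ((J - m) * (J + m + 1)) |m + 1\<rangle>\<close>; for the basis vector
  number \<open>j\<close> one has \<open>J - m = j\<close> and \<open>J + m + 1 = n + 1 - j\<close>.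
\<close>

definition spin_plus :: "nat \<Rightarrow> complex mat" where
  "spin_plus n = Matrix.mat (n + 1) (n + 1)
     (\<lambda>(i, j). if j = i + 1 then complex_of_real (sqrt (real j * (real n + 1 - real j))) else 0)"

definition spin_minus :: "nat \<Rightarrow> complex mat" where
  "spin_minus n = mat_adjoint (spin_plus n)"

definition spin_x :: "nat \<Rightarrow> complex mat" where
  "spin_x n = (1 / 2) \<cdot>\<^sub>m (spin_plus n + spin_minus n)"

definition spin_y :: "nat \<Rightarrow> complex mat" where
  "spin_y n = (1 / (2 * \<i>)) \<cdot>\<^sub>m (spin_plus n - spin_minus n)"

definition spin_z :: "nat \<Rightarrow> complex mat" where
  "spin_z n = Matrix.mat (n + 1) (n + 1)
     (\<lambda>(i, j). if i = j then complex_of_real (real n / 2 - real i) else 0)"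

definition spin_dot :: "nat \<Rightarrow> real ^ 3 \<Rightarrow> complex mat" where
  "spin_dot n \<omega> = complex_of_real (\<omega> $ 1) \<cdot>\<^sub>m spin_x n
     + complex_of_real (\<omega> $ 2) \<cdot>\<^sub>m spin_y n + complex_of_real (\<omega> $ 3) \<cdot>\<^sub>m spin_z n"

text \<open>
  Self-adjointness, the commutation relations, and the Casimir identity
  \<open>S\<^sub>x\<^sup>2 + S\<^sub>y\<^sup>2 + S\<^sub>z\<^sup>2 = J (J + 1)\<close>, which in dimension \<open>2J + 1\<close> identifies the
  representation as the irreducible one of spin \<open>J\<close>.
\<close>

lemma spin_plus_carrier [simp]: "spin_plus n \<in> carrier_mat (n + 1) (n + 1)"
  and spin_z_carrier [simp]: "spin_z n \<in> carrier_mat (n + 1) (n + 1)"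
  by (simp_all add: spin_plus_def spin_z_def)

lemma mat_adjoint_index:
  assumes "A \<in> carrier_mat d d" "i < d" "j < d"
  shows "mat_adjoint A $$ (i, j) = conjugate (A $$ (j, i))"
  using assms by (auto simp: mat_adjoint_def mat_of_rows_def)

lemma mat_adjoint_carrier:
  assumes "A \<in> carrier_mat d d"
  shows "mat_adjoint A \<in> carrier_mat d d"
  using assms by (auto simp: mat_adjoint_def mat_of_rows_def)

lemma spin_minus_eq:
  "spin_minus n = Matrix.mat (n + 1) (n + 1)
     (\<lambda>(i, j). if i = j + 1 then complex_of_real (sqrt (real i * (real n + 1 - real i))) else 0)"
  unfolding spin_minus_def
proof (rule eq_matI, goal_cases)
  case (1 i j)
  then show ?case
    by (simp add: mat_adjoint_index[OF spin_plus_carrier]) (auto simp: spin_plus_def)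
qed (use mat_adjoint_carrier[OF spin_plus_carrier[of n]] in auto)

lemma spin_minus_carrier [simp]: "spin_minus n \<in> carrier_mat (n + 1) (n + 1)"
  by (simp add: spin_minus_eq)

lemma spin_x_carrier [simp]: "spin_x n \<in> carrier_mat (n + 1) (n + 1)"
  and spin_y_carrier [simp]: "spin_y n \<in> carrier_mat (n + 1) (n + 1)"
  using spin_plus_carrier[of n] spin_minus_carrier[of n] unfolding spin_x_def spin_y_def
  by (auto simp del: spin_plus_carrier spin_minus_carrier)

lemma spin_x_eq:
  "spin_x n = Matrix.mat (n + 1) (n + 1) (\<lambda>(i, j).
     if j = i + 1 then complex_of_real (sqrt (real j * (real n + 1 - real j))) / 2
     else if i = j + 1 then complex_of_real (sqrt (real i * (real n + 1 - real i))) / 2 else 0)"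
  by (rule eq_matI) (auto simp: spin_x_def spin_minus_eq spin_plus_def)

lemma spin_y_eq:
  "spin_y n = Matrix.mat (n + 1) (n + 1) (\<lambda>(i, j).
     if j = i + 1 then - \<i> * complex_of_real (sqrt (real j * (real n + 1 - real j))) / 2
     else if i = j + 1 then \<i> * complex_of_real (sqrt (real i * (real n + 1 - real i))) / 2 else 0)"
  by (rule eq_matI) (auto simp: spin_y_def spin_minus_eq spin_plus_def field_simps)

lemma spin_self_adjoint:
  "mat_adjoint (spin_x n) = spin_x n"
  "mat_adjoint (spin_y n) = spin_y n"
  "mat_adjoint (spin_z n) = spin_z n"
proof -
  have *: "mat_adjoint A = A" if "A \<in> carrier_mat (n + 1) (n + 1)"
    "\<And>i j. i < n + 1 \<Longrightarrow> j < n + 1 \<Longrightarrow> conjugate (A $$ (j, i)) = A $$ (i, j)" for A :: "complex mat"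
    using that mat_adjoint_carrier[OF that(1)]
    by (intro eq_matI) (auto simp: mat_adjoint_index[OF that(1)])
  show "mat_adjoint (spin_x n) = spin_x n" by (rule *) (auto simp: spin_x_eq)
  show "mat_adjoint (spin_y n) = spin_y n" by (rule *) (auto simp: spin_y_eq)
  show "mat_adjoint (spin_z n) = spin_z n" by (rule *) (auto simp: spin_z_def)
qed

lemma tridiagonal_mult_index:
  assumes A: "A \<in> carrier_mat (n + 1) (n + 1)" and B: "B \<in> carrier_mat (n + 1) (n + 1)"
    and tri: "\<And>k. k \<le> n \<Longrightarrow> k \<noteq> i \<Longrightarrow> k \<noteq> i + 1 \<Longrightarrow> i \<noteq> k + 1 \<Longrightarrow> A $$ (i, k) = (0 :: complex)"
    and ij: "i \<le> n" "j \<le> n"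
  shows "(A * B) $$ (i, j) = A $$ (i, i) * B $$ (i, j)
     + (if i + 1 \<le> n then A $$ (i, i + 1) * B $$ (i + 1, j) else 0)
     + (if 1 \<le> i then A $$ (i, i - 1) * B $$ (i - 1, j) else 0)"
proof -
  let ?g = "\<lambda>k. A $$ (i, k) * B $$ (k, j)"
  have "(A * B) $$ (i, j) = (\<Sum>k<n + 1. ?g k)"
    using A B ij by (auto simp: scalar_prod_def atLeast0LessThan intro!: sum.cong)
  also have "\<dots> = (\<Sum>k<n + 1. (if k = i then ?g k else 0) + (if k = i + 1 then ?g k else 0)
      + (if k = i - 1 \<and> 1 \<le> i then ?g k else 0))"
    using tri ij by (intro sum.cong) auto
  also have "\<dots> = ?g i + (if i + 1 \<le> n then ?g (i + 1) else 0) + (if 1 \<le> i then ?g (i - 1) else 0)"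
    using ij by (cases "i = n"; cases i) (auto simp: sum.distrib)
  finally show ?thesis .
qed

lemma spin_coeff_square:
  assumes "k \<le> n + 1"
  shows "complex_of_real (sqrt (real k * (real n + 1 - real k)))
       * complex_of_real (sqrt (real k * (real n + 1 - real k)))
     = of_nat k * (of_nat n + 1 - of_nat k)"
proof -
  have "sqrt (real k * (real n + 1 - real k)) * sqrt (real k * (real n + 1 - real k))
      = real k * (real n + 1 - real k)"
    using assms by (intro real_sqrt_mult_self[THEN trans] abs_of_nonneg mult_nonneg_nonneg) auto
  then have "complex_of_real (sqrt (real k * (real n + 1 - real k)) * sqrt (real k * (real n + 1 - real k)))
      = complex_of_real (real k * (real n + 1 - real k))"
    by (rule arg_cong)
  then show ?thesis by (simp only: of_real_mult of_real_diff of_real_add of_real_of_nat_eq of_real_1)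
qed

lemma spin_xy_products:
  assumes ij: "i \<le> n" "j \<le> n"
  defines "a \<equiv> \<lambda>k. complex_of_real (sqrt (real k * (real n + 1 - real k)))"
  shows "(spin_x n * spin_y n) $$ (i, j) =
      (if j = i then \<i> * (of_nat n / 2 - of_nat i) / 2
       else if j = i + 2 then - \<i> * a j * a (i + 1) / 4
       else if i = j + 2 then \<i> * a i * a (j + 1) / 4 else 0)"
    and "(spin_y n * spin_x n) $$ (i, j) =
      (if j = i then - \<i> * (of_nat n / 2 - of_nat i) / 2
       else if j = i + 2 then - \<i> * a j * a (i + 1) / 4
       else if i = j + 2 then \<i> * a i * a (j + 1) / 4 else 0)"
    and "(spin_x n * spin_x n) $$ (i, j) =
      (if j = i then (of_nat (i + 1) * (of_nat n - of_nat i) + of_nat i * (of_nat n + 1 - of_nat i)) / 4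
       else if j = i + 2 then a j * a (i + 1) / 4
       else if i = j + 2 then a i * a (j + 1) / 4 else 0)"
    and "(spin_y n * spin_y n) $$ (i, j) =
      (if j = i then (of_nat (i + 1) * (of_nat n - of_nat i) + of_nat i * (of_nat n + 1 - of_nat i)) / 4
       else if j = i + 2 then - a j * a (i + 1) / 4
       else if i = j + 2 then - a i * a (j + 1) / 4 else 0)"
proof -
  have aa: "a k * a k = of_nat k * (of_nat n + 1 - of_nat k)" if "k \<le> n + 1" for k
    using spin_coeff_square[OF that] by (simp add: a_def)
  have up: "a (Suc i) * a (Suc i) = of_nat (i + 1) * (of_nat n - of_nat i)"
    using aa[of "Suc i"] ij by simp
  have down: "a i * a i = of_nat i * (of_nat n + 1 - of_nat i)"
    using aa[of i] ij by simp
  have x: "spin_x n $$ (i, j) = (if j = i + 1 then a j / 2 else if i = j + 1 then a i / 2 else 0)"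
    and y: "spin_y n $$ (i, j) = (if j = i + 1 then - \<i> * a j / 2 else if i = j + 1 then \<i> * a i / 2 else 0)"
    if "i \<le> n" "j \<le> n" for i j
    using that by (auto simp: spin_x_eq spin_y_eq a_def)
  have tx: "(spin_x n * B) $$ (i, j) = (if i + 1 \<le> n then a (i + 1) / 2 * B $$ (i + 1, j) else 0)
       + (if 1 \<le> i then a i / 2 * B $$ (i - 1, j) else 0)"
    if "B \<in> carrier_mat (n + 1) (n + 1)" for B
    using ij by (subst tridiagonal_mult_index[OF spin_x_carrier that]) (auto simp: x)
  have ty: "(spin_y n * B) $$ (i, j) = (if i + 1 \<le> n then - \<i> * a (i + 1) / 2 * B $$ (i + 1, j) else 0)
       + (if 1 \<le> i then \<i> * a i / 2 * B $$ (i - 1, j) else 0)"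
    if "B \<in> carrier_mat (n + 1) (n + 1)" for B
    using ij by (subst tridiagonal_mult_index[OF spin_y_carrier that]) (auto simp: y)
  note t = tx[OF spin_x_carrier] tx[OF spin_y_carrier] ty[OF spin_x_carrier] ty[OF spin_y_carrier]
  have top: "i = n \<Longrightarrow> a (Suc i) = 0" and bot: "i = 0 \<Longrightarrow> a i = 0"
    by (simp_all add: a_def)
  have dxy: "(spin_x n * spin_y n) $$ (i, i) = \<i> * (a (Suc i) * a (Suc i) - a i * a i) / 4"
    and dyx: "(spin_y n * spin_x n) $$ (i, i) = - \<i> * (a (Suc i) * a (Suc i) - a i * a i) / 4"
    and dxx: "(spin_x n * spin_x n) $$ (i, i) = (a (Suc i) * a (Suc i) + a i * a i) / 4"
    and dyy: "(spin_y n * spin_y n) $$ (i, i) = (a (Suc i) * a (Suc i) + a i * a i) / 4" if "i = j"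
  proof -
    note t' = t[folded that]
    show "(spin_x n * spin_y n) $$ (i, i) = \<i> * (a (Suc i) * a (Suc i) - a i * a i) / 4"
      using ij top bot by (subst t'(2), cases "i = n"; cases "i = 0")
        (auto simp: x y diff_divide_distrib right_diff_distrib add_divide_distrib mult_ac)
    show "(spin_y n * spin_x n) $$ (i, i) = - \<i> * (a (Suc i) * a (Suc i) - a i * a i) / 4"
      using ij top bot by (subst t'(3), cases "i = n"; cases "i = 0")
        (auto simp: x y diff_divide_distrib right_diff_distrib add_divide_distrib mult_ac)
    show "(spin_x n * spin_x n) $$ (i, i) = (a (Suc i) * a (Suc i) + a i * a i) / 4"
      using ij top bot by (subst t'(1), cases "i = n"; cases "i = 0")
        (auto simp: x y diff_divide_distrib right_diff_distrib add_divide_distrib mult_ac)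
    show "(spin_y n * spin_y n) $$ (i, i) = (a (Suc i) * a (Suc i) + a i * a i) / 4"
      using ij top bot by (subst t'(4), cases "i = n"; cases "i = 0")
        (auto simp: x y diff_divide_distrib right_diff_distrib add_divide_distrib mult_ac)
  qed
  have e: "\<i> * (of_nat (i + 1) * (of_nat n - of_nat i) - of_nat i * (of_nat n + 1 - of_nat i)) / 4
      = \<i> * (of_nat n / 2 - of_nat i) / 2"
    by (simp add: field_simps)
  show "(spin_x n * spin_y n) $$ (i, j) =
      (if j = i then \<i> * (of_nat n / 2 - of_nat i) / 2
       else if j = i + 2 then - \<i> * a j * a (i + 1) / 4
       else if i = j + 2 then \<i> * a i * a (j + 1) / 4 else 0)"
  proof (cases "j = i")
    case True
    then show ?thesis using dxy[unfolded up down] e by (simp del: of_nat_add add: field_simps)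
  next
    case False
    then show ?thesis using ij by (subst t(2)) (auto simp: x y mult_ac)
  qed
  show "(spin_y n * spin_x n) $$ (i, j) =
      (if j = i then - \<i> * (of_nat n / 2 - of_nat i) / 2
       else if j = i + 2 then - \<i> * a j * a (i + 1) / 4
       else if i = j + 2 then \<i> * a i * a (j + 1) / 4 else 0)"
  proof (cases "j = i")
    case True
    then show ?thesis using dyx[unfolded up down] e by (simp del: of_nat_add add: field_simps)
  next
    case False
    then show ?thesis using ij by (subst t(3)) (auto simp: x y mult_ac)
  qed
  show "(spin_x n * spin_x n) $$ (i, j) =
      (if j = i then (of_nat (i + 1) * (of_nat n - of_nat i) + of_nat i * (of_nat n + 1 - of_nat i)) / 4
       else if j = i + 2 then a j * a (i + 1) / 4
       else if i = j + 2 then a i * a (j + 1) / 4 else 0)"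
  proof (cases "j = i")
    case True
    then show ?thesis using dxx[unfolded up down] by simp
  next
    case False
    then show ?thesis using ij by (subst t(1)) (auto simp: x y mult_ac)
  qed
  show "(spin_y n * spin_y n) $$ (i, j) =
      (if j = i then (of_nat (i + 1) * (of_nat n - of_nat i) + of_nat i * (of_nat n + 1 - of_nat i)) / 4
       else if j = i + 2 then - a j * a (i + 1) / 4
       else if i = j + 2 then - a i * a (j + 1) / 4 else 0)"
  proof (cases "j = i")
    case True
    then show ?thesis using dyy[unfolded up down] by simp
  next
    case False
    then show ?thesis using ij by (subst t(4)) (auto simp: x y mult_ac)
  qed
qed

lemma spin_z_products:
  assumes "A \<in> carrier_mat (n + 1) (n + 1)" "i \<le> n" "j \<le> n"
  shows "(spin_z n * A) $$ (i, j) = (of_nat n / 2 - of_nat i) * A $$ (i, j)"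
    and "(A * spin_z n) $$ (i, j) = (of_nat n / 2 - of_nat j) * A $$ (i, j)"
proof -
  have sum_index: "(B * C) $$ (i, j) = (\<Sum>k<n + 1. B $$ (i, k) * C $$ (k, j))"
    if "B \<in> carrier_mat (n + 1) (n + 1)" "C \<in> carrier_mat (n + 1) (n + 1)" for B C :: "complex mat"
    using that assms(2,3) by (auto simp: scalar_prod_def atLeast0LessThan intro!: sum.cong)
  have z: "spin_z n $$ (k, l) = (if k = l then of_nat n / 2 - of_nat k else 0)"
    if "k < n + 1" "l < n + 1" for k l
    using that by (simp add: spin_z_def)
  have "(spin_z n * A) $$ (i, j)
      = (\<Sum>k<n + 1. if k = i then (of_nat n / 2 - of_nat i) * A $$ (i, j) else 0)"
    unfolding sum_index[OF spin_z_carrier assms(1)] using assms(2,3) by (intro sum.cong) (simp_all add: z)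
  then show "(spin_z n * A) $$ (i, j) = (of_nat n / 2 - of_nat i) * A $$ (i, j)"
    using assms(2) by (simp del: sum.lessThan_Suc)
  have "(A * spin_z n) $$ (i, j)
      = (\<Sum>k<n + 1. if k = j then (of_nat n / 2 - of_nat j) * A $$ (i, j) else 0)"
    unfolding sum_index[OF assms(1) spin_z_carrier] using assms(2,3) by (intro sum.cong) (simp_all add: z)
  then show "(A * spin_z n) $$ (i, j) = (of_nat n / 2 - of_nat j) * A $$ (i, j)"
    using assms(3) by (simp del: sum.lessThan_Suc)
qed

lemma spin_dims:
  "dim_row (spin_x n) = n + 1" "dim_col (spin_x n) = n + 1" "dim_row (spin_y n) = n + 1"
  "dim_col (spin_y n) = n + 1" "dim_row (spin_z n) = n + 1" "dim_col (spin_z n) = n + 1"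
  by (simp_all add: spin_x_eq spin_y_eq spin_z_def)

lemma spin_commutators:
  "spin_x n * spin_y n - spin_y n * spin_x n = \<i> \<cdot>\<^sub>m spin_z n"
  "spin_y n * spin_z n - spin_z n * spin_y n = \<i> \<cdot>\<^sub>m spin_x n"
  "spin_z n * spin_x n - spin_x n * spin_z n = \<i> \<cdot>\<^sub>m spin_y n"
proof -
  show "spin_x n * spin_y n - spin_y n * spin_x n = \<i> \<cdot>\<^sub>m spin_z n"
  proof (rule eq_matI, goal_cases)
    case (1 i j)
    then have ij: "i \<le> n" "j \<le> n" by (auto simp: spin_dims)
    have "(spin_x n * spin_y n) $$ (i, j) - (spin_y n * spin_x n) $$ (i, j) = \<i> * spin_z n $$ (i, j)"
      unfolding spin_xy_products[OF ij] using ij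
      by (auto simp: spin_z_def right_diff_distrib diff_divide_distrib)
    then show ?case using ij by (simp del: index_mult_mat(1) add: spin_dims)
  qed (auto simp: spin_dims)
  show "spin_y n * spin_z n - spin_z n * spin_y n = \<i> \<cdot>\<^sub>m spin_x n"
  proof (rule eq_matI, goal_cases)
    case (1 i j)
    then have ij: "i \<le> n" "j \<le> n" by (auto simp: spin_dims)
    have "(spin_y n * spin_z n) $$ (i, j) - (spin_z n * spin_y n) $$ (i, j) = \<i> * spin_x n $$ (i, j)"
      unfolding spin_z_products[OF spin_y_carrier ij] using ij by (auto simp: spin_x_eq spin_y_eq algebra_simps)
    then show ?case using ij by (simp del: index_mult_mat(1) add: spin_dims)
  qed (auto simp: spin_dims)
  show "spin_z n * spin_x n - spin_x n * spin_z n = \<i> \<cdot>\<^sub>m spin_y n"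
  proof (rule eq_matI, goal_cases)
    case (1 i j)
    then have ij: "i \<le> n" "j \<le> n" by (auto simp: spin_dims)
    have "(spin_z n * spin_x n) $$ (i, j) - (spin_x n * spin_z n) $$ (i, j) = \<i> * spin_y n $$ (i, j)"
      unfolding spin_z_products[OF spin_x_carrier ij] using ij by (auto simp: spin_x_eq spin_y_eq algebra_simps)
    then show ?case using ij by (simp del: index_mult_mat(1) add: spin_dims)
  qed (auto simp: spin_dims)
qed

lemma spin_casimir:
  "spin_x n * spin_x n + spin_y n * spin_y n + spin_z n * spin_z n
     = complex_of_real (real n / 2 * (real n / 2 + 1)) \<cdot>\<^sub>m 1\<^sub>m (n + 1)"
proof (rule eq_matI, goal_cases)
  case (1 i j)
  then have ij: "i \<le> n" "j \<le> n" by auto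
  have "(spin_x n * spin_x n) $$ (i, j) + (spin_y n * spin_y n) $$ (i, j) + (spin_z n * spin_z n) $$ (i, j)
      = (if i = j then of_nat n / 2 * (of_nat n / 2 + 1) else 0)"
  proof (cases "j = i")
    case True
    let ?X = "(of_nat (i + 1) * (of_nat n - of_nat i) + of_nat i * (of_nat n + 1 - of_nat i)) / 4"
    have "?X + ?X + (of_nat n / 2 - of_nat i) * (of_nat n / 2 - of_nat i)
        = (of_nat n / 2 * (of_nat n / 2 + 1) :: complex)"
      by (simp add: field_simps)
    moreover have "spin_z n $$ (i, i) = of_nat n / 2 - of_nat i"
      using ij by (simp add: spin_z_def)
    ultimately show ?thesis
      unfolding spin_xy_products[OF ij] spin_z_products[OF spin_z_carrier ij]
      by (simp only: True if_True refl)
  next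
    case False
    then show ?thesis
      unfolding spin_xy_products[OF ij] spin_z_products[OF spin_z_carrier ij]
      using ij by (simp add: spin_z_def)
  qed
  then show ?case
    using ij by (simp del: index_mult_mat(1) add: spin_dims)
qed (auto simp: spin_dims)

subsection \<open>Coherent states and density matrices\<close>

text \<open>
  A Bloch coherent state is only determined up to a phase, so it is described by a predicate.
\<close>

definition bloch_coherent_state :: "nat \<Rightarrow> real ^ 3 \<Rightarrow> complex Matrix.vec \<Rightarrow> bool" where
  "bloch_coherent_state n \<omega> v \<longleftrightarrow> v \<in> carrier_vec (n + 1) \<and> v \<bullet>c v = 1 \<and>
     spin_dot n \<omega> *\<^sub>v v = complex_of_real (real n / 2) \<cdot>\<^sub>v v"

text \<open>
  The order on the complex numbers is the one of \<^theory>\<open>HOL-Library.Complex_Order\<close>: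
  \<open>0 \<le> z\<close> means that \<open>z\<close> is real and nonnegative.
\<close>

definition density_matrix :: "nat \<Rightarrow> complex mat \<Rightarrow> bool" where
  "density_matrix d \<rho> \<longleftrightarrow> \<rho> \<in> carrier_mat d d \<and> mat_adjoint \<rho> = \<rho> \<and>
     (\<forall>v \<in> carrier_vec d. 0 \<le> (\<rho> *\<^sub>v v) \<bullet>c v) \<and> (\<Sum>i<d. \<rho> $$ (i, i)) = 1"

subsection \<open>The sphere\<close>

definition north_pole :: "real ^ 3" where
  "north_pole = vector [0, 0, 1]"

definition spherical_coords :: "real \<times> real \<Rightarrow> real ^ 3" where
  "spherical_coords = (\<lambda>(\<theta>, \<phi>). vector [sin \<theta> * cos \<phi>, sin \<theta> * sin \<phi>, cos \<theta>])"

text \<open>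
  Surface measure \<open>sin \<theta> d\<theta> d\<phi>\<close>. Its underlying space is the sphere itself, not all of \<open>real ^ 3\<close>.
\<close>

definition sphere_measure :: "(real ^ 3) measure" where
  "sphere_measure = distr
     (density lborel (\<lambda>(\<theta>, \<phi>). ennreal (sin \<theta> * indicator ({0..pi} \<times> {0..2 * pi}) (\<theta>, \<phi>))))
     (restrict_space borel (sphere 0 1)) spherical_coords"

lemma space_sphere_measure [simp]: "space sphere_measure = sphere 0 1"
  by (simp add: sphere_measure_def space_restrict_space)

lemma norm_spherical_coords: "norm (spherical_coords x) = 1"
proof -
  obtain \<theta> \<phi> where x: "x = (\<theta>, \<phi>)" by (cases x)
  have "(sin \<theta> * cos \<phi>)\<^sup>2 + (sin \<theta> * sin \<phi>)\<^sup>2 + (cos \<theta>)\<^sup>2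
      = (sin \<theta>)\<^sup>2 * ((cos \<phi>)\<^sup>2 + (sin \<phi>)\<^sup>2) + (cos \<theta>)\<^sup>2"
    by (simp only: power_mult_distrib distrib_left)
  then show ?thesis
    by (simp add: x spherical_coords_def norm_vec_def L2_set_def sum_3 vector_3)
qed

lemma measurable_spherical_coords:
  "spherical_coords \<in> borel \<rightarrow>\<^sub>M restrict_space borel (sphere 0 1)"
proof (rule measurable_restrict_space2)
  have "continuous_on UNIV (\<lambda>x. spherical_coords x $ i)" for i
    unfolding spherical_coords_def split_def
    using exhaust_3[of i] by (elim disjE; simp add: vector_3) (intro continuous_intros)+
  then have "continuous_on UNIV (\<lambda>x. \<chi> i. spherical_coords x $ i)"
    by (rule continuous_on_vec_lambda)
  then show "spherical_coords \<in> borel \<rightarrow>\<^sub>M borel"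
    by (intro borel_measurable_continuous_onI) (simp add: vec_nth_inverse)
qed (simp add: norm_spherical_coords)

lemma emeasure_sphere_measure: "emeasure sphere_measure (sphere 0 1) = ennreal (4 * pi)"
proof -
  let ?D = "\<lambda>(\<theta>, \<phi>). ennreal (sin \<theta> * indicator ({0..pi} \<times> {0..2 * pi}) (\<theta>, \<phi>))"
  have sin: "(\<integral>\<^sup>+\<theta>. ennreal (sin \<theta>) * indicator {0..pi} \<theta> \<partial>lborel) = ennreal (- cos pi - (- cos 0))"
    by (rule nn_integral_FTC_Icc) (auto intro!: derivative_eq_intros sin_ge_zero)
  have D: "?D \<in> borel_measurable (lborel \<Otimes>\<^sub>M lborel)"
    by measurable
  have "emeasure sphere_measure (sphere 0 1)
      = emeasure (density lborel ?D) (spherical_coords -` sphere 0 1 \<inter> UNIV)"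
    unfolding sphere_measure_def
    by (subst emeasure_distr) (use measurable_spherical_coords in \<open>auto simp: sets_restrict_space\<close>)
  also have "\<dots> = emeasure (density lborel ?D) UNIV"
    by (rule arg_cong[where f = "emeasure _"]) (auto simp: norm_spherical_coords)
  also have "\<dots> = (\<integral>\<^sup>+x. ?D x \<partial>(lborel \<Otimes>\<^sub>M lborel))"
    using D by (subst emeasure_density) (auto simp: lborel_prod)
  also have "\<dots> = (\<integral>\<^sup>+\<theta>. (\<integral>\<^sup>+\<phi>. ?D (\<theta>, \<phi>) \<partial>lborel) \<partial>lborel)"
    by (rule lborel.nn_integral_fst[OF D, symmetric])
  also have "\<dots> = (\<integral>\<^sup>+\<theta>. (\<integral>\<^sup>+\<phi>. (ennreal (sin \<theta>) * indicator {0..pi} \<theta>) * indicator {0..2 * pi} \<phi> \<partial>lborel) \<partial>lborel)"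
    by (intro nn_integral_cong) (auto simp: indicator_def)
  also have "\<dots> = (\<integral>\<^sup>+\<theta>. (ennreal (sin \<theta>) * indicator {0..pi} \<theta>) * ennreal (2 * pi) \<partial>lborel)"
    by (subst nn_integral_cmult) auto
  also have "\<dots> = (\<integral>\<^sup>+\<theta>. ennreal (sin \<theta>) * indicator {0..pi} \<theta> \<partial>lborel) * ennreal (2 * pi)"
    by (rule nn_integral_multc) auto
  also have "\<dots> = ennreal (4 * pi)"
    unfolding sin using ennreal_mult[of 2 "2 * pi"] by simp
  finally show ?thesis .
qed

end

theory Submission
  imports Defs
begin

text \<open>
  The spin-\<open>J\<close> space is realized as the homogeneous polynomials of degree \<open>n = 2J\<close> in two variables
  with the Bombieri inner product; coherent states are the powers of linear forms. Following
  Lieb and Solovej, \<open>\<rho>\<close> is lifted to degree \<open>n + k\<close> by \<open>\<Phi>(v v\<^sup>*) = \<Sum> |e v\<rangle>\<langle>e v|\<close>, with \<open>e\<close> running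
  through an orthonormal basis of degree \<open>k\<close>. The spectrum of \<open>\<Phi>(v v\<^sup>*)\<close> is majorized by the one for
  a coherent \<open>v\<close>: passing from \<open>A A\<^sup>*\<close> to \<open>A\<^sup>* A\<close> turns \<open>\<Phi>(v v\<^sup>*)\<close> into the Gram form \<open>|e v|\<^sup>2\<close> in degree \<open>k\<close>,
  which Bombieri's identity writes as a sum of lifts, to degree \<open>k\<close>, of contractions of \<open>v\<close> of degree
  \<open>l \<le> min n k\<close>; this allows induction on \<open>n + k\<close>, because all these lifts of a coherent state are
  diagonal in the same basis and ordered in the same way. The lower symbol of the normalized lift is
  \<open>\<langle>\<omega>|\<rho>|\<omega>\<rangle>\<close>, so Jensen's and Karamata's inequalities bound the integral below by the normalized trace
  of \<open>f\<close> over the spectrum of the lifted coherent state. That trace is the integral of a Bernstein-type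
  sum, which converges for \<open>k \<rightarrow> \<infinity>\<close> to the integral of \<open>f\<close> for the coherent state.
\<close>

text \<open>The weights \<open>fact j * fact (n - j)\<close> are \<open>fact n\<close> times the
  usual ones. They make differentiation adjoint to multiplication by a variable, at the price that
  the power of a unit linear form has squared norm \<open>fact n\<close>, the source of most
  factorials below. The majorization bounds sums of a quadratic form over arbitrary orthonormal
  families instead of ordered eigenvalues: such bounds can be added over the terms of Bombieri's
  identity although the lifts occurring there do not commute. Two irregularities have to be
  absorbed. A concave \<open>f\<close> on the closed interval may jump at 0 and 1, so limits at the
  endpoints are separate cases. The phases chosen by \<psi> may vary in a non-measurable way, so the
  integrands are first rewritten through a fixed measurable choice of spinors. The resolution of the
  identity, computed once in spherical coordinates, stands in for rotation invariance: it yields the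
  distribution of the overlap with every base point alike.\<close>

hide_const (open) Module.smult

subsection \<open>The Bombieri inner product\<close>

text \<open>
  A polynomial \<open>p\<close> stands for the form \<open>\<Sum> p\<^sub>j x\<^bsup>n - j\<^esup> y\<^sup>j\<close>, so the degree \<open>n\<close> is a separate argument and
  coefficients above \<open>n\<close> are ignored.
\<close>

definition bombieri_ip :: "nat \<Rightarrow> complex poly \<Rightarrow> complex poly \<Rightarrow> complex" where
  "bombieri_ip n p q = (\<Sum>j\<le>n. of_nat (fact j * fact (n - j)) * cnj (coeff p j) * coeff q j)"

definition bombieri_nsq :: "nat \<Rightarrow> complex poly \<Rightarrow> real" where
  "bombieri_nsq n p = (\<Sum>j\<le>n. fact j * fact (n - j) * (cmod (coeff p j))\<^sup>2)"

definition bombieri_orthonormal :: "nat \<Rightarrow> nat \<Rightarrow> (nat \<Rightarrow> complex poly) \<Rightarrow> bool" where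
  "bombieri_orthonormal n r e \<longleftrightarrow> (\<forall>i<r. \<forall>j<r. bombieri_ip n (e i) (e j) = (if i = j then 1 else 0))"

lemma bombieri_ip_add_right: "bombieri_ip n p (q + r) = bombieri_ip n p q + bombieri_ip n p r"
  and bombieri_ip_diff_right: "bombieri_ip n p (q - r) = bombieri_ip n p q - bombieri_ip n p r"
  and bombieri_ip_smult_right: "bombieri_ip n p (smult c q) = c * bombieri_ip n p q"
  by (simp_all add: bombieri_ip_def sum.distrib sum_subtractf sum_distrib_left algebra_simps)

lemma bombieri_ip_sum_right: "bombieri_ip n p (\<Sum>i\<in>A. q i) = (\<Sum>i\<in>A. bombieri_ip n p (q i))"
  by (induction A rule: infinite_finite_induct) (simp_all add: bombieri_ip_add_right, simp_all add: bombieri_ip_def)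

lemma bombieri_ip_commute: "bombieri_ip n q p = cnj (bombieri_ip n p q)"
  by (simp add: bombieri_ip_def mult_ac)

lemma bombieri_ip_self: "bombieri_ip n p p = of_real (bombieri_nsq n p)"
  by (simp add: bombieri_ip_def bombieri_nsq_def complex_norm_square mult_ac del: of_real_power)

lemma bombieri_ip_add_left: "bombieri_ip n (q + r) p = bombieri_ip n q p + bombieri_ip n r p"
  and bombieri_ip_smult_left: "bombieri_ip n (smult c q) p = cnj c * bombieri_ip n q p"
  by (simp_all add: bombieri_ip_def sum.distrib sum_subtractf sum_distrib_left algebra_simps)

lemma bombieri_ip_sum_left: "bombieri_ip n (\<Sum>i\<in>A. q i) p = (\<Sum>i\<in>A. bombieri_ip n (q i) p)"
  by (induction A rule: infinite_finite_induct) (simp_all add: bombieri_ip_add_left, simp_all add: bombieri_ip_def)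

lemma bombieri_nsq_nonneg: "0 \<le> bombieri_nsq n p"
  by (simp add: bombieri_nsq_def sum_nonneg)

lemma bombieri_nsq_smult: "bombieri_nsq n (smult c p) = (cmod c)\<^sup>2 * bombieri_nsq n p"
  by (simp add: bombieri_nsq_def sum_distrib_left norm_mult power_mult_distrib mult_ac)

section \<open>Bessel's inequality and Gram-Schmidt orthonormalization\<close>

lemma bombieri_orthonormal_residual:
  assumes "bombieri_orthonormal n r e"
  defines "y x \<equiv> x - (\<Sum>j<r. smult (bombieri_ip n (e j) x) (e j))"
  shows "i < r \<Longrightarrow> bombieri_ip n (e i) (y x) = 0"
    and "bombieri_ip n (y x) x = bombieri_ip n (y x) (y x)"
    and "bombieri_nsq n x = (\<Sum>j<r. (cmod (bombieri_ip n (e j) x))\<^sup>2) + bombieri_nsq n (y x)"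
proof -
  show orth: "bombieri_ip n (e i) (y x) = 0" if "i < r" for i
  proof -
    have "bombieri_ip n (e i) (y x) = bombieri_ip n (e i) x - (\<Sum>j<r. if j = i then bombieri_ip n (e j) x else 0)"
      unfolding y_def bombieri_ip_diff_right bombieri_ip_sum_right bombieri_ip_smult_right using assms(1) that
      by (intro arg_cong2[of _ _ _ _ "(-)"] sum.cong) (auto simp: bombieri_orthonormal_def)
    then show ?thesis using that by simp
  qed
  have orth': "bombieri_ip n (y x) (e i) = 0" if "i < r" for i
    using orth[OF that] bombieri_ip_commute[of n "y x" "e i"] by simp
  have x: "x = y x + (\<Sum>j<r. smult (bombieri_ip n (e j) x) (e j))"
    by (simp add: y_def)
  show *: "bombieri_ip n (y x) x = bombieri_ip n (y x) (y x)"
    by (subst (2) x) (simp add: bombieri_ip_add_right bombieri_ip_sum_right bombieri_ip_smult_right orth')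
  have "bombieri_ip n x x = bombieri_ip n (y x) x + bombieri_ip n (\<Sum>j<r. smult (bombieri_ip n (e j) x) (e j)) x"
    by (subst (1) x) (simp add: bombieri_ip_add_left)
  also have "bombieri_ip n (\<Sum>j<r. smult (bombieri_ip n (e j) x) (e j)) x = of_real (\<Sum>j<r. (cmod (bombieri_ip n (e j) x))\<^sup>2)"
    by (simp add: bombieri_ip_sum_left bombieri_ip_smult_left complex_norm_square mult_ac del: of_real_power)
  finally show "bombieri_nsq n x = (\<Sum>j<r. (cmod (bombieri_ip n (e j) x))\<^sup>2) + bombieri_nsq n (y x)"
    unfolding * bombieri_ip_self by (metis add.commute of_real_add of_real_eq_iff)
qed

lemma bessel:
  assumes "bombieri_orthonormal n r e"
  shows "(\<Sum>j<r. (cmod (bombieri_ip n (e j) x))\<^sup>2) \<le> bombieri_nsq n x"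
  unfolding bombieri_orthonormal_residual(3)[OF assms, of x] by (simp add: bombieri_nsq_nonneg)

text \<open>Parseval's equality stands for membership in the span, the form in which
  \<open>lift_form_transfer\<close> consumes it. Dependent vectors add nothing to the family, whence
  \<open>r \<le> m\<close>.\<close>

lemma gram_schmidt_poly:
  fixes w :: "nat \<Rightarrow> complex poly"
  assumes "\<And>i. i < m \<Longrightarrow> degree (w i) \<le> n"
  shows "\<exists>r e. r \<le> m \<and> bombieri_orthonormal n r e \<and> (\<forall>j<r. degree (e j) \<le> n) \<and>
     (\<forall>i<m. bombieri_nsq n (w i) = (\<Sum>j<r. (cmod (bombieri_ip n (e j) (w i)))\<^sup>2))"
  using assms
proof (induction m)
  case 0
  then show ?case by (auto simp: bombieri_orthonormal_def)
next
  case (Suc m)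
  then obtain r e where r: "r \<le> m" and e: "bombieri_orthonormal n r e" and deg: "\<And>j. j < r \<Longrightarrow> degree (e j) \<le> n"
    and w: "\<And>i. i < m \<Longrightarrow> bombieri_nsq n (w i) = (\<Sum>j<r. (cmod (bombieri_ip n (e j) (w i)))\<^sup>2)"
    by (metis less_SucI)
  define y where "y = w m - (\<Sum>j<r. smult (bombieri_ip n (e j) (w m)) (e j))"
  note y = bombieri_orthonormal_residual[OF e, where x = "w m", folded y_def]
  show ?case
  proof (cases "bombieri_nsq n y = 0")
    case True
    then have "bombieri_nsq n (w i) = (\<Sum>j<r. (cmod (bombieri_ip n (e j) (w i)))\<^sup>2)" if "i < Suc m" for i
      using w y(3) that by (auto simp: less_Suc_eq)
    then show ?thesis using r e deg by (metis le_SucI)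
  next
    case False
    define s where "s = sqrt (bombieri_nsq n y)"
    have s: "s > 0" "s\<^sup>2 = bombieri_nsq n y"
      using False bombieri_nsq_nonneg[of n y] by (auto simp: s_def)
    define e' where "e' = e(r := smult (of_real (1 / s)) y)"
    have e'old: "e' j = e j" if "j < r" for j
      using that by (simp add: e'_def)
    have new: "bombieri_ip n (e' r) (e' r) = 1"
      using s False by (simp add: e'_def bombieri_ip_self bombieri_nsq_smult norm_divide power_divide)
    have zero: "bombieri_ip n (e i) (e' r) = 0" "bombieri_ip n (e' r) (e i) = 0" if "i < r" for i
      using y(1)[OF that] bombieri_ip_commute[of n y "e i"]
      by (simp_all add: e'_def bombieri_ip_smult_left bombieri_ip_smult_right)
    have on: "bombieri_orthonormal n (Suc r) e'"
      using e new zero by (auto simp: bombieri_orthonormal_def less_Suc_eq e'old)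
    have dy: "degree y \<le> n"
      unfolding y_def
      by (intro degree_diff_le degree_sum_le order.trans[OF degree_smult_le] deg Suc.prems) auto
    have deg': "degree (e' j) \<le> n" if "j < Suc r" for j
      using that deg dy by (auto simp: e'_def less_Suc_eq)
    have "bombieri_nsq n (w i) = (\<Sum>j<Suc r. (cmod (bombieri_ip n (e' j) (w i)))\<^sup>2)" if "i < Suc m" for i
    proof (cases "i = m")
      case True
      have "bombieri_ip n (e' r) (w m) = of_real (1 / s) * of_real (s\<^sup>2)"
        using y(2) s by (simp add: e'_def bombieri_ip_smult_left bombieri_ip_self)
      then have "bombieri_ip n (e' r) (w m) = of_real s"
        using s(1) by (simp add: power2_eq_square)
      then show ?thesis
        using True y(3) s by (simp add: e'old)
    next
      case False
      then have "i < m" using that by simp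
      \<comment> \<open>The old family already exhausts the norm of \<open>w i\<close>, so the new
        term can only increase the sum; Bessel for the enlarged family then forces equality.\<close>
      have "bombieri_nsq n (w i) \<le> (\<Sum>j<Suc r. (cmod (bombieri_ip n (e' j) (w i)))\<^sup>2)"
        using w[OF \<open>i < m\<close>] by (simp add: e'old)
      then show ?thesis using bessel[OF on, of "w i"] by linarith
    qed
    then show ?thesis using r on deg' by (intro exI[of _ "Suc r"] exI[of _ e']) auto
  qed
qed

lemma bombieri_ip_monom_left: "j \<le> n \<Longrightarrow> bombieri_ip n (monom c j) p = of_nat (fact j * fact (n - j)) * cnj c * coeff p j"
proof -
  assume "j \<le> n"
  have "bombieri_ip n (monom c j) p = (\<Sum>i\<le>n. if i = j then of_nat (fact j * fact (n - j)) * cnj c * coeff p j else 0)"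
    unfolding bombieri_ip_def by (rule sum.cong) auto
  then show ?thesis using \<open>j \<le> n\<close> by simp
qed

text \<open>Double counting of the squared inner products between \<open>e\<close> and the
  normalized monomials \<open>E\<close>: Parseval in one order gives \<open>r\<close>, Bessel in the
  other gives at most \<open>n + 1\<close>. In the induction it keeps indices below the cutoff of
  \<open>coherent_weight\<close>.\<close>

lemma bombieri_orthonormal_length:
  assumes "bombieri_orthonormal n r e"
  shows "r \<le> n + 1"
proof -
  define E :: "nat \<Rightarrow> complex poly" where "E a = monom (of_real (1 / sqrt (fact a * fact (n - a)))) a" for a
  have inner: "(cmod (bombieri_ip n (E a) p))\<^sup>2 = fact a * fact (n - a) * (cmod (coeff p a))\<^sup>2" if "a \<le> n" for a p
  proof -
    have "cmod (bombieri_ip n (E a) p) = fact a * fact (n - a) / sqrt (fact a * fact (n - a)) * cmod (coeff p a)"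
      unfolding E_def bombieri_ip_monom_left[OF that] by (simp add: norm_mult norm_divide flip: of_real_mult)
    then show ?thesis by (simp add: power_mult_distrib power_divide power2_eq_square)
  qed
  have total: "bombieri_nsq n p = (\<Sum>a\<le>n. (cmod (bombieri_ip n (E a) p))\<^sup>2)" for p
    unfolding bombieri_nsq_def by (rule sum.cong) (simp_all add: inner)
  have E1: "bombieri_nsq n (E a) = 1" if "a \<le> n" for a
  proof -
    have "(cmod (coeff (E a) j))\<^sup>2 = (if j = a then 1 / (fact a * fact (n - a)) else 0)" for j
      by (simp add: E_def norm_divide power_divide)
    then have "bombieri_nsq n (E a) = (\<Sum>j\<le>n. if j = a then 1 else 0)"
      unfolding bombieri_nsq_def by (intro sum.cong) auto
    then show ?thesis using that by simp
  qed
  have "real r = (\<Sum>j<r. bombieri_nsq n (e j))"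
  proof -
    have "bombieri_nsq n (e j) = 1" if "j < r" for j
    proof -
      have "complex_of_real (bombieri_nsq n (e j)) = 1"
        using assms that by (simp add: bombieri_orthonormal_def flip: bombieri_ip_self)
      then show ?thesis by simp
    qed
    then show ?thesis by simp
  qed
  also have "\<dots> = (\<Sum>a\<le>n. \<Sum>j<r. (cmod (bombieri_ip n (e j) (E a)))\<^sup>2)"
  proof -
    have "cmod (bombieri_ip n (E a) (e j)) = cmod (bombieri_ip n (e j) (E a))" for a j
      by (subst bombieri_ip_commute) simp
    then show ?thesis unfolding total by (subst sum.swap) simp
  qed
  also have "\<dots> \<le> (\<Sum>a\<le>n. bombieri_nsq n (E a))"
    by (intro sum_mono bessel assms)
  also have "\<dots> = real (n + 1)"
    by (simp add: E1)
  finally show ?thesis by linarith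
qed

text \<open>The quadratic form of the lift of \<open>v v\<^sup>*\<close> from degree \<open>n\<close> to degree \<open>n + k\<close>.\<close>

definition lift_form :: "nat \<Rightarrow> nat \<Rightarrow> complex poly \<Rightarrow> complex poly \<Rightarrow> real" where
  "lift_form n k v u = (\<Sum>a\<le>k. (cmod (bombieri_ip (n + k) u (monom 1 a * v)))\<^sup>2 / (fact a * fact (k - a)))"

lemma lift_form_nonneg: "0 \<le> lift_form n k v u"
  by (simp add: lift_form_def sum_nonneg)

text \<open>\<open>w\<close> is the adjoint of multiplication by \<open>v\<close>, applied to
  \<open>u\<close>. So the lift is multiplication composed with its adjoint, and its quadratic form
  is a squared norm in degree \<open>k\<close>.\<close>

lemma lift_form_adjoint:
  fixes v u :: "complex poly"
  shows "\<exists>w. degree w \<le> k \<and> bombieri_nsq k w = lift_form n k v u \<and>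
     (\<forall>e. degree e \<le> k \<longrightarrow> bombieri_ip k e w = bombieri_ip (n + k) (e * v) u)"
proof -
  \<comment> \<open>Dividing by the weight of a monomial turns the values of a functional on
    monomials into the coefficients of the vector representing it.\<close>
  define c where "c a = bombieri_ip (n + k) (monom 1 a * v) u / of_nat (fact a * fact (k - a))" for a
  define w where "w = (\<Sum>a\<le>k. monom (c a) a)"
  have coeff: "coeff w a = c a" if "a \<le> k" for a
    using that by (simp add: w_def coeff_sum)
  have cc: "of_nat (fact a * fact (k - a)) * c a = bombieri_ip (n + k) (monom 1 a * v) u" for a
    by (simp add: c_def)
  have "degree w \<le> k"
    unfolding w_def by (intro degree_sum_le order.trans[OF degree_monom_le]) auto
  moreover have "bombieri_nsq k w = lift_form n k v u"
    unfolding bombieri_nsq_def lift_form_def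
  proof (rule sum.cong)
    fix a assume "a \<in> {..k}"
    then show "fact a * fact (k - a) * (cmod (coeff w a))\<^sup>2 =
        (cmod (bombieri_ip (n + k) u (monom 1 a * v)))\<^sup>2 / (fact a * fact (k - a))"
      unfolding bombieri_ip_commute[of "n+k" u]
      by (simp add: coeff c_def norm_divide norm_mult power_divide power2_eq_square)
  qed simp
  moreover have "bombieri_ip k e w = bombieri_ip (n + k) (e * v) u" if "degree e \<le> k" for e
  proof -
    have "bombieri_ip k e w = (\<Sum>a\<le>k. cnj (coeff e a) * bombieri_ip (n + k) (monom 1 a * v) u)"
      unfolding bombieri_ip_def[of k] by (rule sum.cong) (simp_all add: coeff c_def)
    also have "\<dots> = bombieri_ip (n + k) ((\<Sum>a\<le>k. monom (coeff e a) a) * v) u"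
      unfolding sum_distrib_right bombieri_ip_sum_left
      by (rule sum.cong) (simp_all flip: bombieri_ip_smult_left mult_smult_left add: smult_monom)
    finally show ?thesis
      by (simp add: poly_as_sum_of_monoms'[OF that])
  qed
  ultimately show ?thesis by blast
qed

text \<open>The left side sums the squared norms of the adjoint vectors \<open>w i\<close>. An
  orthonormal basis \<open>e\<close> of their span has at most \<open>m\<close> members; exchanging
  the two sums and applying Bessel to \<open>u\<close> leaves the squared norms of the products
  \<open>e j * v\<close>. Since \<open>r \<le> m\<close>, a partial sum is compared with one that is
  no longer.\<close>

lemma lift_form_transfer:
  fixes u :: "nat \<Rightarrow> complex poly"
  assumes u: "bombieri_orthonormal (n + k) m u"
  shows "\<exists>r e. r \<le> m \<and> bombieri_orthonormal k r e \<and> (\<forall>j<r. degree (e j) \<le> k) \<and>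
     (\<Sum>i<m. lift_form n k v (u i)) \<le> (\<Sum>j<r. bombieri_nsq (n + k) (e j * v))"
proof -
  have "\<forall>i. \<exists>w. degree w \<le> k \<and> bombieri_nsq k w = lift_form n k v (u i) \<and>
     (\<forall>e. degree e \<le> k \<longrightarrow> bombieri_ip k e w = bombieri_ip (n + k) (e * v) (u i))"
    using lift_form_adjoint[of k n v] by blast
  then obtain w where w: "\<And>i. degree (w i) \<le> k" "\<And>i. bombieri_nsq k (w i) = lift_form n k v (u i)"
    "\<And>i e. degree e \<le> k \<Longrightarrow> bombieri_ip k e (w i) = bombieri_ip (n + k) (e * v) (u i)"
    by metis
  obtain r e where r: "r \<le> m" and e: "bombieri_orthonormal k r e" and deg: "\<And>j. j < r \<Longrightarrow> degree (e j) \<le> k"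
    and ws: "\<And>i. i < m \<Longrightarrow> bombieri_nsq k (w i) = (\<Sum>j<r. (cmod (bombieri_ip k (e j) (w i)))\<^sup>2)"
    using gram_schmidt_poly[of m w k] w(1) by blast
  have "(\<Sum>i<m. lift_form n k v (u i)) = (\<Sum>i<m. \<Sum>j<r. (cmod (bombieri_ip (n + k) (u i) (e j * v)))\<^sup>2)"
  proof (intro sum.cong refl)
    fix i assume "i \<in> {..<m}"
    then have "lift_form n k v (u i) = (\<Sum>j<r. (cmod (bombieri_ip k (e j) (w i)))\<^sup>2)"
      using ws by (simp flip: w(2))
    also have "\<dots> = (\<Sum>j<r. (cmod (bombieri_ip (n + k) (u i) (e j * v)))\<^sup>2)"
    proof (intro sum.cong refl)
      fix j assume "j \<in> {..<r}"
      then have "cmod (bombieri_ip k (e j) (w i)) = cmod (bombieri_ip (n + k) (u i) (e j * v))"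
        by (subst w(3)) (use deg in auto, subst bombieri_ip_commute, simp)
      then show "(cmod (bombieri_ip k (e j) (w i)))\<^sup>2 = (cmod (bombieri_ip (n + k) (u i) (e j * v)))\<^sup>2" by simp
    qed
    finally show "lift_form n k v (u i) = (\<Sum>j<r. (cmod (bombieri_ip (n + k) (u i) (e j * v)))\<^sup>2)" .
  qed
  also have "\<dots> = (\<Sum>j<r. \<Sum>i<m. (cmod (bombieri_ip (n + k) (u i) (e j * v)))\<^sup>2)"
    by (rule sum.swap)
  also have "\<dots> \<le> (\<Sum>j<r. bombieri_nsq (n + k) (e j * v))"
    by (intro sum_mono bessel u)
  finally show ?thesis using r e deg by blast
qed

subsection \<open>Bombieri's identity and majorization\<close>

text \<open>The derivative of order \<open>b\<close> in \<open>y\<close> and order \<open>n - l - b\<close> in \<open>x\<close>, a form of degree \<open>l\<close>.\<close>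

definition poly_contract :: "nat \<Rightarrow> nat \<Rightarrow> nat \<Rightarrow> complex poly \<Rightarrow> complex poly" where
  "poly_contract n l b v = (\<Sum>s\<le>l. monom (of_real (fact (s + b) * fact (n - (s + b)) / (fact s * fact (l - s)))
      * coeff v (s + b)) s)"

lemma coeff_poly_contract: "coeff (poly_contract n l b v) s = (if s \<le> l then
    of_real (fact (s + b) * fact (n - (s + b)) / (fact s * fact (l - s))) * coeff v (s + b) else 0)"
  by (simp add: poly_contract_def coeff_sum)

lemma degree_poly_contract: "degree (poly_contract n l b v) \<le> l"
  by (rule degree_le) (simp add: coeff_poly_contract)

lemma bombieri_ip_monom_poly_contract:
  assumes "l \<le> k" "a \<le> k - l"
  shows "bombieri_ip k e (monom 1 a * poly_contract n l b v) = (\<Sum>s\<le>l.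
     of_real (fact (s + a) * fact (k - (s + a)) * fact (s + b) * fact (n - (s + b)) / (fact s * fact (l - s)))
       * (cnj (coeff e (s + a)) * coeff v (s + b)))"
proof -
  have "bombieri_ip k e (monom c j) = of_nat (fact j * fact (k - j)) * cnj (coeff e j) * c" if "j \<le> k" for c j
    using that by (subst bombieri_ip_commute) (simp add: bombieri_ip_monom_left)
  then show ?thesis
    using assms
    by (simp add: poly_contract_def sum_distrib_left mult_monom bombieri_ip_sum_right add.commute[of a] mult_ac)
qed

text \<open>The term-by-term comparison behind Bombieri's identity: the left side carries the
  Vandermonde binomials, the right side the factors of two pairings with a contraction.\<close>

lemma bombieri_coefficient:
  fixes s t s' t' a a' b b' :: nat
  assumes "s + t = s' + t'"
  shows "fact (s' + a) * fact (s + b) * fact (t' + a') * fact (t + b') *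
      real ((s' + b choose s') * (s + a choose a) * (t' + b' choose t') * (t + a' choose a'))
    = (fact (s' + a) * fact (t' + a') * fact (s' + b) * fact (t' + b') / (fact s' * fact t')) *
      (fact (s + a) * fact (t + a') * fact (s + b) * fact (t + b') / (fact s * fact t))
      / (fact a * fact a' * fact b * fact b')"
  by (simp add: binomial_fact field_simps)

text \<open>The norm of a product is a sum over matchings between the linear factors of two copies
  of \<open>e * v\<close>; \<open>l\<close> counts the factors of the first \<open>e\<close> matched
  with the second \<open>v\<close>. In coefficients, both sides become sums of the same fourfold
  products once \<open>fact m * fact (n + k - m)\<close> has been opened up by two Vandermonde
  convolutions.\<close>

lemma bombieri_identity:
  assumes e: "degree e \<le> k" and v: "degree v \<le> n"
  shows "bombieri_nsq (n + k) (e * v) =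
     (\<Sum>l\<le>min n k. \<Sum>b\<le>n - l. lift_form l (k - l) (poly_contract n l b v) e / (fact b * fact (n - l - b)))"
proof -
  define c where "c l a b s = (fact (s + a) * fact (k - (s + a)) * fact (s + b) * fact (n - (s + b))
      / (fact s * fact (l - s)) :: real)" for l a b s
  define X where "X = (SIGMA l:{..min n k}. {..n - l} \<times> {..k - l} \<times> {..l} \<times> {..l})"
  define Y where "Y = (SIGMA m:{..n + k}. SIGMA j:{..m}. {..m} \<times> {..j} \<times> {..k - j})"
  define G where "G = (\<lambda>(l, b, a, s', s).
      of_real (c l a b s' * c l a b s / (fact a * fact (k - l - a) * fact b * fact (n - l - b)))
      * (cnj (coeff e (s' + a)) * coeff v (s' + b) * (coeff e (s + a) * cnj (coeff v (s + b)))))"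
  define H where "H = (\<lambda>(m, j, j', s', t').
      of_real (fact j * fact (m - j) * fact (k - j) * fact (n - (m - j)) *
        real ((m - j' choose s') * (j' choose (j - s')) * (n - (m - j') choose t') * (k - j' choose (k - j - t'))))
      * (cnj (coeff e j) * coeff v (m - j') * (coeff e j' * cnj (coeff v (m - j)))))"
  have fin: "finite X" "finite Y" by (auto simp: X_def Y_def)
  have ez: "coeff e j = 0" if "\<not> j \<le> k" for j using e that coeff_eq_0[of e j] by simp
  have vz: "coeff v j = 0" if "\<not> j \<le> n" for j using v that coeff_eq_0[of v j] by simp
  have "complex_of_real (\<Sum>l\<le>min n k. \<Sum>b\<le>n - l. lift_form l (k - l) (poly_contract n l b v) e / (fact b * fact (n - l - b)))
    = (\<Sum>l\<le>min n k. \<Sum>b\<le>n - l. \<Sum>a\<le>k - l. \<Sum>s'\<le>l. \<Sum>s\<le>l. G (l, b, a, s', s))"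
    unfolding of_real_sum
  proof (intro sum.cong refl)
    fix l b assume l: "l \<in> {..min n k}" and "b \<in> {..n - l}"
    have "complex_of_real (lift_form l (k - l) (poly_contract n l b v) e / (fact b * fact (n - l - b)))
      = (\<Sum>a\<le>k - l. of_real ((cmod (bombieri_ip k e (monom 1 a * poly_contract n l b v)))\<^sup>2)
          / (fact a * fact (k - l - a) * fact b * fact (n - l - b)))"
      using l by (simp add: lift_form_def sum_divide_distrib mult_ac)
    also have "\<dots> = (\<Sum>a\<le>k - l. \<Sum>s'\<le>l. \<Sum>s\<le>l. G (l, b, a, s', s))"
    proof (intro sum.cong refl)
      fix a assume a: "a \<in> {..k - l}"
      have z: "bombieri_ip k e (monom 1 a * poly_contract n l b v) =
          (\<Sum>s\<le>l. of_real (c l a b s) * (cnj (coeff e (s + a)) * coeff v (s + b)))"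
        using l a by (subst bombieri_ip_monom_poly_contract) (auto simp: c_def)
      have "of_real ((cmod (bombieri_ip k e (monom 1 a * poly_contract n l b v)))\<^sup>2) =
          (\<Sum>s'\<le>l. of_real (c l a b s') * (cnj (coeff e (s' + a)) * coeff v (s' + b))) *
          (\<Sum>s\<le>l. of_real (c l a b s) * (coeff e (s + a) * cnj (coeff v (s + b))))"
        unfolding complex_norm_square z by simp
      also have "\<dots> = (\<Sum>s'\<le>l. \<Sum>s\<le>l. of_real (c l a b s' * c l a b s) *
         (cnj (coeff e (s' + a)) * coeff v (s' + b) * (coeff e (s + a) * cnj (coeff v (s + b)))))"
        unfolding sum_product by (simp add: mult_ac)
      finally show "of_real ((cmod (bombieri_ip k e (monom 1 a * poly_contract n l b v)))\<^sup>2)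
          / (fact a * fact (k - l - a) * fact b * fact (n - l - b)) = (\<Sum>s'\<le>l. \<Sum>s\<le>l. G (l, b, a, s', s))"
        by (simp add: G_def sum_divide_distrib)
    qed
    finally show "complex_of_real (lift_form l (k - l) (poly_contract n l b v) e / (fact b * fact (n - l - b)))
       = (\<Sum>a\<le>k - l. \<Sum>s'\<le>l. \<Sum>s\<le>l. G (l, b, a, s', s))" .
  qed
  also have "\<dots> = (\<Sum>x\<in>X. G x)"
    unfolding X_def by (simp add: sum.Sigma sum.cartesian_product split_def)
  also have "\<dots> = (\<Sum>y\<in>Y. H y)"
  \<comment> \<open>The substitution matches coefficient indices: \<open>j = s' + a\<close> and
    \<open>j' = s + a\<close> for \<open>e\<close>, \<open>m - j' = s' + b\<close> and
    \<open>m - j = s + b\<close> for \<open>v\<close>, and \<open>t' = l - s'\<close>.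
    \<open>Y\<close> is a generous range whose surplus tuples vanish by the degree bounds or by a
    zero binomial.\<close>
  proof (rule sum.reindex_bij_witness_not_neutral[where S' = "{x\<in>X. G x = 0}" and T' = "{y\<in>Y. H y = 0}"
        and j = "\<lambda>(l, b, a, s', s). (s + s' + a + b, s' + a, s + a, s', l - s')"
        and i = "\<lambda>(m, j, j', s', t'). (t' + s', m - j' - s', j - s', s', j' - (j - s'))"])
    have eq: "H (s + s' + a + b, s' + a, s + a, s', l - s') = G (l, b, a, s', s)"
      if "(l, b, a, s', s) \<in> X" for l b a s' s
    proof -
      have *: "l \<le> n" "l \<le> k" "b \<le> n - l" "a \<le> k - l" "s \<le> l" "s' \<le> l"
        using that by (auto simp: X_def)
      define t t' a' b' where "t = l - s" "t' = l - s'" "a' = k - l - a" "b' = n - l - b"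
      have k: "k - (s' + a) = t' + a'" "k - (s + a) = t + a'"  "k - (s' + a) - t' = a'"
        and n: "n - (s' + b) = t' + b'" "n - (s + b) = t + b'" and st: "s + t = s' + t'"
        using * by (auto simp: t_t'_a'_b'_def)
      have m: "s + s' + a + b - (s' + a) = s + b" "s + s' + a + b - (s + a) = s' + b" by auto
      show ?thesis
        unfolding H_def G_def c_def split m t_t'_a'_b'_def(1-4)[symmetric] k n
        using bombieri_coefficient[OF st, of a b a' b'] by (simp add: mult_ac)
    qed
    \<comment> \<open>A nonzero term has nonzero coefficients and binomials; this supplies the
      inequalities under which the truncated subtractions in the inverse substitution are
      exact.\<close>
    have con: "j \<le> k \<and> j' \<le> k \<and> m - j \<le> n \<and> m - j' \<le> n \<and> s' \<le> m - j' \<and> j - s' \<le> j' \<and>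
        t' \<le> n - (m - j') \<and> k - j - t' \<le> k - j' \<and> j \<le> m \<and> j' \<le> m \<and> s' \<le> j \<and> t' \<le> k - j"
      if "(m, j, j', s', t') \<in> Y - {y\<in>Y. H y = 0}" for m j j' s' t'
      using that ez vz by (auto simp: Y_def H_def not_le[symmetric] binomial_eq_0_iff)
    show "finite {x\<in>X. G x = 0}" "finite {y\<in>Y. H y = 0}"
      using fin by auto
    show "H (case x of (l, b, a, s', s) \<Rightarrow> (s + s' + a + b, s' + a, s + a, s', l - s')) = G x"
      if "x \<in> X" for x
      using that eq by (cases x) auto
    show "(case (case x of (l, b, a, s', s) \<Rightarrow> (s + s' + a + b, s' + a, s + a, s', l - s')) of
         (m, j, j', s', t') \<Rightarrow> (t' + s', m - j' - s', j - s', s', j' - (j - s'))) = x"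
      if "x \<in> X - {x\<in>X. G x = 0}" for x
      using that by (cases x) (auto simp: X_def)
    show "(case x of (l, b, a, s', s) \<Rightarrow> (s + s' + a + b, s' + a, s + a, s', l - s')) \<in> Y - {y\<in>Y. H y = 0}"
      if "x \<in> X - {x\<in>X. G x = 0}" for x
    proof (cases x)
      case (fields l b a s' s)
      then have "H (s + s' + a + b, s' + a, s + a, s', l - s') \<noteq> 0" using that eq by auto
      moreover have "(s + s' + a + b, s' + a, s + a, s', l - s') \<in> Y"
        using that fields by (auto simp: X_def Y_def)
      ultimately show ?thesis using fields by auto
    qed
    show "(case (case y of (m, j, j', s', t') \<Rightarrow> (t' + s', m - j' - s', j - s', s', j' - (j - s'))) of
        (l, b, a, s', s) \<Rightarrow> (s + s' + a + b, s' + a, s + a, s', l - s')) = y"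
      if "y \<in> Y - {y\<in>Y. H y = 0}" for y
    proof (cases y)
      case (fields m j j' s' t')
      then show ?thesis using con[of m j j' s' t'] that by auto
    qed
    show "(case y of (m, j, j', s', t') \<Rightarrow> (t' + s', m - j' - s', j - s', s', j' - (j - s'))) \<in> X - {x\<in>X. G x = 0}"
      if "y \<in> Y - {y\<in>Y. H y = 0}" for y
    proof (cases y)
      case (fields m j j' s' t')
      note * = con[of m j j' s' t', folded fields, OF that]
      have f: "s' + j' \<le> m" "t' + m \<le> n + j'" "t' + j \<le> k" "s' \<le> j" using * by linarith+
      have g: "j' \<le> j + t'" using *[THEN conjunct1] * by linarith
      have "t' + s' \<le> n" "t' + s' \<le> k" "m - j' - s' \<le> n - (t' + s')"
        "j - s' \<le> k - (t' + s')" "j' - (j - s') \<le> t' + s'"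
        using f g by linarith+
      then have x: "(t' + s', m - j' - s', j - s', s', j' - (j - s')) \<in> X"
        by (simp add: X_def)
      have "G (t' + s', m - j' - s', j - s', s', j' - (j - s')) = H y"
        using eq[OF x] * by (auto simp: fields)
      then show ?thesis using x that fields by auto
    qed
    show "G x = 0" if "x \<in> {x\<in>X. G x = 0}" for x using that by simp
    show "H x = 0" if "x \<in> {x\<in>Y. H x = 0}" for x using that by simp
  qed
  also have "\<dots> = (\<Sum>m\<le>n + k. \<Sum>j\<le>m. \<Sum>j'\<le>m. \<Sum>s'\<le>j. \<Sum>t'\<le>k - j. H (m, j, j', s', t'))"
    unfolding Y_def by (simp add: sum.Sigma sum.cartesian_product split_def)
  also have "\<dots> = (\<Sum>m\<le>n + k. \<Sum>j\<le>m. \<Sum>j'\<le>m. of_real (fact m * fact (n + k - m)) *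
      (cnj (coeff e j) * coeff v (m - j') * (coeff e j' * cnj (coeff v (m - j)))))"
  proof (intro sum.cong refl)
    fix m j j' assume m: "m \<in> {..n + k}" and j: "j \<in> {..m}" and j': "j' \<in> {..m}"
    let ?T = "cnj (coeff e j) * coeff v (m - j') * (coeff e j' * cnj (coeff v (m - j)))"
    show "(\<Sum>s'\<le>j. \<Sum>t'\<le>k - j. H (m, j, j', s', t')) = of_real (fact m * fact (n + k - m)) * ?T"
    proof (cases "?T = 0")
      case True
      then show ?thesis by (simp only: H_def split) simp
    next
      case False
      then have *: "j \<le> k" "j' \<le> k" "m - j \<le> n" "m - j' \<le> n"
        using ez vz by auto
      let ?A = "fact j * fact (m - j) * fact (k - j) * fact (n - (m - j)) :: real"
      \<comment> \<open>\<open>m\<close> is split as \<open>(m - j') + j'\<close>, along the other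
        pair of coefficients than the one that defines \<open>?A\<close>; this introduces
        \<open>s'\<close>. \<open>W\<close> does the same for \<open>n + k - m\<close> and
        \<open>t'\<close>.\<close>
      have V: "(\<Sum>s'\<le>j. (m - j' choose s') * (j' choose (j - s'))) = m choose j"
        using j' by (simp add: vandermonde)
      have W: "(\<Sum>t'\<le>k - j. (n - (m - j') choose t') * (k - j' choose (k - j - t'))) = (n + k - m) choose (k - j)"
      proof -
        have "n - (m - j') + (k - j') = n + k - m" using * j' by auto
        then show ?thesis unfolding vandermonde by (rule arg_cong)
      qed
      have "(\<Sum>s'\<le>j. \<Sum>t'\<le>k - j. H (m, j, j', s', t')) =
          of_real (?A * (\<Sum>s'\<le>j. \<Sum>t'\<le>k - j. real ((m - j' choose s') * (j' choose (j - s')) *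
             (n - (m - j') choose t') * (k - j' choose (k - j - t'))))) * ?T"
        unfolding H_def split by (simp add: sum_distrib_left sum_distrib_right mult_ac)
      also have "(\<Sum>s'\<le>j. \<Sum>t'\<le>k - j. real ((m - j' choose s') * (j' choose (j - s')) *
             (n - (m - j') choose t') * (k - j' choose (k - j - t')))) =
          real ((\<Sum>s'\<le>j. (m - j' choose s') * (j' choose (j - s'))) *
             (\<Sum>t'\<le>k - j. (n - (m - j') choose t') * (k - j' choose (k - j - t'))))"
        by (simp add: sum_product mult_ac)
      also have "?A * \<dots> = fact m * fact (n + k - m)"
      proof -
        have "n + k - m - (k - j) = n - (m - j)" using * j by auto
        moreover have "k - j \<le> n + k - m" using * j by auto
        ultimately show ?thesis
          unfolding V W using j by (simp add: binomial_fact)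
      qed
      finally show ?thesis .
    qed
  qed
  also have "\<dots> = complex_of_real (bombieri_nsq (n + k) (e * v))"
    unfolding bombieri_nsq_def of_real_sum
  proof (intro sum.cong refl)
    fix m assume "m \<in> {..n + k}"
    have "complex_of_real ((cmod (coeff (e * v) m))\<^sup>2) =
      (\<Sum>j\<le>m. cnj (coeff e j) * cnj (coeff v (m - j))) * (\<Sum>j'\<le>m. coeff e j' * coeff v (m - j'))"
      unfolding complex_norm_square coeff_mult by (simp add: mult.commute)
    also have "\<dots> = (\<Sum>j\<le>m. \<Sum>j'\<le>m.
        (cnj (coeff e j) * coeff v (m - j') * (coeff e j' * cnj (coeff v (m - j)))))"
      unfolding sum_product by (simp add: mult_ac)
    finally show "(\<Sum>j\<le>m. \<Sum>j'\<le>m. of_real (fact m * fact (n + k - m)) *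
      (cnj (coeff e j) * coeff v (m - j') * (coeff e j' * cnj (coeff v (m - j))))) =
      complex_of_real (fact m * fact (n + k - m) * (cmod (coeff (e * v) m))\<^sup>2)"
      by (simp add: sum_distrib_left del: of_real_power)
  qed
  finally show ?thesis
    unfolding of_real_eq_iff by (rule sym)
qed

text \<open>Contraction multiplies the contribution of the coefficient \<open>j\<close> by
  \<open>(j choose s) * (n - j choose (l - s))\<close>, and Vandermonde makes the total the same for
  every \<open>j\<close>. The result is the factor with which the degree \<open>l\<close> enters the
  induction.\<close>

lemma sum_bombieri_nsq_poly_contract:
  assumes l: "l \<le> n"
  shows "(\<Sum>b\<le>n - l. bombieri_nsq l (poly_contract n l b v) / (fact b * fact (n - l - b))) = real (n choose l) * bombieri_nsq n v"
proof -
  define g where "g j s = fact j * fact (n - j) * (cmod (coeff v j))\<^sup>2 *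
      real ((j choose s) * (n - j choose (l - s)))" for j s
  have "(\<Sum>b\<le>n - l. bombieri_nsq l (poly_contract n l b v) / (fact b * fact (n - l - b))) =
      (\<Sum>b\<le>n - l. \<Sum>s\<le>l. g (s + b) s)"
  proof (intro sum.cong refl)
    fix b assume b: "b \<in> {..n - l}"
    show "bombieri_nsq l (poly_contract n l b v) / (fact b * fact (n - l - b)) = (\<Sum>s\<le>l. g (s + b) s)"
      unfolding bombieri_nsq_def sum_divide_distrib
    proof (intro sum.cong refl)
      fix s assume s: "s \<in> {..l}"
      define t b' where "t = l - s" "b' = n - l - b"
      have eqs: "n - (s + b) = t + b'" "l - s = t" "n - l - b = b'" using b s l by (auto simp: t_b'_def)
      have cD: "coeff (poly_contract n l b v) s = of_real (fact (s + b) * fact (t + b') / (fact s * fact t)) * coeff v (s + b)"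
        using s unfolding coeff_poly_contract eqs by simp
      show "fact s * fact (l - s) * (cmod (coeff (poly_contract n l b v) s))\<^sup>2 / (fact b * fact (n - l - b)) = g (s + b) s"
        unfolding g_def eqs cD norm_mult norm_of_real
        by (simp add: binomial_fact field_simps power2_eq_square)
    qed
  qed
  also have "\<dots> = (\<Sum>(b, s)\<in>{..n - l} \<times> {..l}. g (s + b) s)"
    by (simp add: sum.cartesian_product)
  also have "\<dots> = (\<Sum>(j, s)\<in>{..n} \<times> {..l}. g j s)"
  proof (rule sum.reindex_bij_witness_not_neutral[where S' = "{(b, s)\<in>{..n - l} \<times> {..l}. g (s + b) s = 0}"
        and T' = "{(j, s)\<in>{..n} \<times> {..l}. g j s = 0}"
        and j = "\<lambda>(b, s). (s + b, s)" and i = "\<lambda>(j, s). (j - s, s)"], goal_cases)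
    case 1
    show ?case by (rule finite_subset[of _ "{..n - l} \<times> {..l}"]) auto
  next
    case 2
    show ?case by (rule finite_subset[of _ "{..n} \<times> {..l}"]) auto
  qed ((use l in \<open>auto simp: g_def\<close>), metis le_add_diff_inverse not_le)
  also have "\<dots> = (\<Sum>j\<le>n. fact j * fact (n - j) * (cmod (coeff v j))\<^sup>2 * real (n choose l))"
    unfolding sum.cartesian_product[symmetric]
  proof (intro sum.cong refl)
    fix j assume j: "j \<in> {..n}"
    have "(\<Sum>s\<le>l. real ((j choose s) * (n - j choose (l - s)))) = real (n choose l)"
      using j vandermonde[of j "n - j" l] by (simp flip: of_nat_sum of_nat_mult)
    then show "(\<Sum>s\<le>l. g j s) = fact j * fact (n - j) * (cmod (coeff v j))\<^sup>2 * real (n choose l)"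
      unfolding g_def sum_distrib_left[symmetric] by simp
  qed
  finally show ?thesis
    by (simp add: bombieri_nsq_def sum_distrib_left mult_ac)
qed

text \<open>The decreasing eigenvalues of the lift of a normalized coherent state.\<close>

definition coherent_weight :: "nat \<Rightarrow> nat \<Rightarrow> nat \<Rightarrow> real" where
  "coherent_weight n k i = (if i \<le> k then real (n + k - i choose n) else 0)"

text \<open>Contractions of a pure power of the first variable vanish or are again such powers.
  Their lifts are all diagonal in the monomials with decreasing eigenvalues, so for them the leading
  eigenvalues simply add. This is that addition; it lets the induction recombine its bounds without
  loss.\<close>

lemma coherent_weight_vandermonde:
  assumes "i \<le> k"
  shows "(\<Sum>l\<le>min n k. real (n choose l) * coherent_weight l (k - l) i) = coherent_weight n k i"
proof -
  have "(\<Sum>l\<le>min n k. real (n choose l) * coherent_weight l (k - l) i) =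
      (\<Sum>l\<le>n. real (n choose l) * real (k - i choose l))"
    by (rule sum.mono_neutral_cong_left) (use assms in \<open>auto simp: coherent_weight_def binomial_eq_0_iff\<close>)
  also have "\<dots> = real (\<Sum>l\<le>n. (k - i choose l) * (n choose (n - l)))"
    by (simp add: binomial_symmetric[symmetric] mult.commute)
  also have "\<dots> = coherent_weight n k i"
    unfolding vandermonde using assms by (simp add: coherent_weight_def add.commute)
  finally show ?thesis .
qed

text \<open>Bounds over arbitrary orthonormal families, as in Ky Fan's principle, survive summation
  over \<open>l\<close> and \<open>b\<close>. After the transfer only lifts from degree
  \<open>l\<close> to degree \<open>l + (k - l) = k\<close> occur, and \<open>k\<close> is less than
  \<open>n + k\<close> unless \<open>n = 0\<close>.\<close>

theorem lift_form_majorized: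
  assumes "degree v \<le> n" "bombieri_orthonormal (n + k) m u"
  shows "(\<Sum>i<m. lift_form n k v (u i)) \<le> bombieri_nsq n v * (\<Sum>i<m. coherent_weight n k i)"
  using assms
proof (induction "n + k" arbitrary: n k m u v rule: less_induct)
  case less
  note v = less.prems(1) and u = less.prems(2)
  obtain r e where r: "r \<le> m" and e: "bombieri_orthonormal k r e" and deg: "\<And>j. j < r \<Longrightarrow> degree (e j) \<le> k"
    and le: "(\<Sum>i<m. lift_form n k v (u i)) \<le> (\<Sum>j<r. bombieri_nsq (n + k) (e j * v))"
    using lift_form_transfer[OF u, of v] by blast
  have rk: "r \<le> k + 1" using bombieri_orthonormal_length[OF e] .
  have "(\<Sum>j<r. bombieri_nsq (n + k) (e j * v)) \<le> bombieri_nsq n v * (\<Sum>i<r. coherent_weight n k i)"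
  \<comment> \<open>Base of the induction: a constant scales squared norms by its squared modulus,
    and all weights are 1. The bound \<open>r \<le> k + 1\<close> enters here because the weights
    are cut off above \<open>k\<close>.\<close>
  proof (cases "n = 0")
    case True
    then obtain c where c: "v = [:c:]" using v degree_eq_zeroE[of v] by auto
    have "bombieri_nsq k (e j) = 1" if "j < r" for j
    proof -
      have "complex_of_real (bombieri_nsq k (e j)) = 1"
        using e that by (simp add: bombieri_orthonormal_def flip: bombieri_ip_self)
      then show ?thesis by simp
    qed
    moreover have "coherent_weight 0 k i = 1" if "i < r" for i using rk that by (simp add: coherent_weight_def)
    ultimately show ?thesis using True by (simp add: c bombieri_nsq_smult) (simp add: bombieri_nsq_def)
  next
    case False
    have "(\<Sum>j<r. bombieri_nsq (n + k) (e j * v)) =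
        (\<Sum>l\<le>min n k. \<Sum>b\<le>n - l. (\<Sum>j<r. lift_form l (k - l) (poly_contract n l b v) (e j)) / (fact b * fact (n - l - b)))"
    proof -
      have swap: "(\<Sum>j<r. \<Sum>l\<le>min n k. \<Sum>b\<le>n - l. F j l b) =
          (\<Sum>l\<le>min n k. \<Sum>b\<le>n - l. \<Sum>j<r. F j l b)" for F :: "nat \<Rightarrow> nat \<Rightarrow> nat \<Rightarrow> real"
        by (rule trans[OF sum.swap], rule sum.cong[OF refl], rule sum.swap)
      have "(\<Sum>j<r. bombieri_nsq (n + k) (e j * v)) = (\<Sum>j<r. \<Sum>l\<le>min n k. \<Sum>b\<le>n - l.
          lift_form l (k - l) (poly_contract n l b v) (e j) / (fact b * fact (n - l - b)))"
        using deg v by (intro sum.cong refl bombieri_identity) auto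
      then show ?thesis unfolding swap sum_divide_distrib .
    qed
    also have "\<dots> \<le> (\<Sum>l\<le>min n k. \<Sum>b\<le>n - l.
        (bombieri_nsq l (poly_contract n l b v) * (\<Sum>i<r. coherent_weight l (k - l) i)) / (fact b * fact (n - l - b)))"
    proof (intro sum_mono divide_right_mono)
      fix l b assume "l \<in> {..min n k}"
      then show "(\<Sum>j<r. lift_form l (k - l) (poly_contract n l b v) (e j)) \<le> bombieri_nsq l (poly_contract n l b v) * (\<Sum>i<r. coherent_weight l (k - l) i)"
        using False e by (intro less.hyps degree_poly_contract) auto
    qed simp
    also have "\<dots> = (\<Sum>l\<le>min n k. (\<Sum>b\<le>n - l. bombieri_nsq l (poly_contract n l b v) / (fact b * fact (n - l - b)))
        * (\<Sum>i<r. coherent_weight l (k - l) i))"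
      by (simp add: sum_distrib_right)
    also have "\<dots> = (\<Sum>l\<le>min n k. real (n choose l) * bombieri_nsq n v * (\<Sum>i<r. coherent_weight l (k - l) i))"
      by (intro sum.cong refl, subst sum_bombieri_nsq_poly_contract) auto
    also have "\<dots> = bombieri_nsq n v * (\<Sum>i<r. \<Sum>l\<le>min n k. real (n choose l) * coherent_weight l (k - l) i)"
      by (subst sum.swap) (simp add: sum_distrib_left mult_ac)
    also have "(\<Sum>i<r. \<Sum>l\<le>min n k. real (n choose l) * coherent_weight l (k - l) i) = (\<Sum>i<r. coherent_weight n k i)"
      using rk by (intro sum.cong refl coherent_weight_vandermonde) auto
    finally show ?thesis .
  qed
  also have "\<dots> \<le> bombieri_nsq n v * (\<Sum>i<m. coherent_weight n k i)"
    using r by (intro mult_left_mono sum_mono2 bombieri_nsq_nonneg) (auto simp: coherent_weight_def)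
  finally show ?case using le by simp
qed

subsection \<open>Diagonalization of Hermitian matrices\<close>

text \<open>A Schur form has the same trace and carries the eigenvalues on its diagonal; if all of
  them were \<open>t\<close>, the trace would be \<open>d * t\<close>.\<close>

lemma ex_eigenvector_ne:
  fixes a :: "nat \<Rightarrow> nat \<Rightarrow> complex"
  assumes "(\<Sum>i<d. a i i) \<noteq> of_nat d * t"
  shows "\<exists>e v. e \<noteq> t \<and> (\<exists>i<d. v i \<noteq> 0) \<and> (\<forall>i<d. (\<Sum>j<d. a i j * v j) = e * v i)"
proof -
  define A where "A = Matrix.mat d d (\<lambda>(i, j). a i j)"
  have A: "A \<in> carrier_mat d d" by (simp add: A_def)
  obtain es where es: "char_poly A = (\<Prod>e\<leftarrow>es. [:- e, 1:])" and len: "length es = d"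
    using char_poly_factorized[OF A] by blast
  obtain B P Q where B: "schur_decomposition A es = (B, P, Q)" by (cases "schur_decomposition A es")
  from schur_decomposition[OF A es B] have sim: "similar_mat_wit A B P Q" and diag: "diag_mat B = es"
    by auto
  note w = similar_mat_witD2[OF A sim]
  have idx: "(X * Y) $$ (i, j) = (\<Sum>k<d. X $$ (i, k) * Y $$ (k, j))"
    if "X \<in> carrier_mat d d" "Y \<in> carrier_mat d d" "i < d" "j < d" for X Y :: "complex mat" and i j
    using that by (auto simp: scalar_prod_def atLeast0LessThan)
  have "(\<Sum>i<d. a i i) = (\<Sum>i<d. ((P * B) * Q) $$ (i, i))"
    by (rule sum.cong) (simp_all add: A_def flip: w(3))
  also have "\<dots> = (\<Sum>i<d. \<Sum>j<d. (P * B) $$ (i, j) * Q $$ (j, i))"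
    using w(4-7) by (intro sum.cong[OF refl] idx) auto
  also have "\<dots> = (\<Sum>j<d. \<Sum>i<d. Q $$ (j, i) * (P * B) $$ (i, j))"
    by (subst sum.swap) (simp add: mult.commute)
  also have "\<dots> = (\<Sum>j<d. (Q * (P * B)) $$ (j, j))"
    using w(4-7) by (intro sum.cong[OF refl] idx[symmetric]) auto
  also have "Q * (P * B) = B"
    by (simp add: assoc_mult_mat[OF w(7) w(6) w(5), symmetric] w(2) left_mult_one_mat[OF w(5)])
  also have "(\<Sum>j<d. B $$ (j, j)) = sum_list es"
    unfolding diag[symmetric] diag_mat_def using w(5) by (simp add: sum_list_sum_nth atLeast0LessThan)
  finally have "sum_list es \<noteq> of_nat d * t" using assms by simp
  moreover have "sum_list es = of_nat d * t" if "\<forall>e\<in>set es. e = t"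
  proof -
    have "es = replicate d t" using that len by (metis replicate_length_same)
    then show ?thesis by (simp add: sum_list_replicate)
  qed
  ultimately obtain e where e: "e \<in> set es" "e \<noteq> t" by blast
  then have "poly (char_poly A) e = 0"
    unfolding es by (induction es) (auto simp: poly_prod_list)
  then obtain v where "eigenvector A v e"
    using eigenvalue_root_char_poly[OF A] by (auto simp: eigenvalue_def)
  then have v: "v \<in> carrier_vec d" "v \<noteq> 0\<^sub>v d" "A *\<^sub>v v = e \<cdot>\<^sub>v v"
    using A by (auto simp: eigenvector_def)
  have "(\<Sum>j<d. a i j * (v $ j)) = e * v $ i" if "i < d" for i
  proof -
    have "(A *\<^sub>v v) $ i = (\<Sum>j<d. a i j * (v $ j))"
      using that v(1) by (simp add: A_def scalar_prod_def atLeast0LessThan)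
    then show ?thesis using v that by simp
  qed
  moreover have "\<exists>i<d. v $ i \<noteq> 0"
    using v(1,2) by (metis carrier_vecD eq_vecI index_zero_vec(1) index_zero_vec(2))
  ultimately show ?thesis using e(2) by blast
qed

text \<open>A one-sided inverse of a square matrix is two-sided. This turns orthonormality of a full
  family of eigenvectors into completeness.\<close>

lemma left_right_inverse_sums:
  fixes x y :: "nat \<Rightarrow> nat \<Rightarrow> complex"
  assumes "\<And>i j. i < d \<Longrightarrow> j < d \<Longrightarrow> (\<Sum>k<d. x i k * y k j) = (if i = j then 1 else 0)"
    and "i < d" "j < d"
  shows "(\<Sum>k<d. y i k * x k j) = (if i = j then 1 else 0)"
proof -
  define X where "X = Matrix.mat d d (\<lambda>(i, j). x i j)"
  define Y where "Y = Matrix.mat d d (\<lambda>(i, j). y i j)"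
  have XY: "X \<in> carrier_mat d d" "Y \<in> carrier_mat d d" by (simp_all add: X_def Y_def)
  have "X * Y = 1\<^sub>m d"
    by (rule eq_matI) (auto simp: X_def Y_def scalar_prod_def atLeast0LessThan assms(1))
  then have "Y * X = 1\<^sub>m d"
    using mat_mult_left_right_inverse XY by blast
  then have "(Y * X) $$ (i, j) = (if i = j then 1 else 0)"
    using assms by simp
  then show ?thesis
    using assms by (simp add: X_def Y_def scalar_prod_def atLeast0LessThan)
qed

lemma hermitian_swap:
  fixes a :: "nat \<Rightarrow> nat \<Rightarrow> complex"
  assumes "\<And>i j. i < d \<Longrightarrow> j < d \<Longrightarrow> a i j = cnj (a j i)"
  shows "(\<Sum>i<d. (\<Sum>j<d. a i j * v j) * cnj (w i)) = (\<Sum>i<d. v i * cnj (\<Sum>j<d. a i j * w j))"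
proof -
  have "(\<Sum>i<d. (\<Sum>j<d. a i j * v j) * cnj (w i)) = (\<Sum>j<d. \<Sum>i<d. a i j * v j * cnj (w i))"
    by (subst sum.swap) (simp add: sum_distrib_right)
  also have "\<dots> = (\<Sum>j<d. \<Sum>i<d. v j * cnj (a j i * w i))"
    by (intro sum.cong refl, subst assms) auto
  finally show ?thesis by (simp add: sum_distrib_left)
qed

text \<open>
  Deflation: shifting the known eigenvalues to a common \<open>t\<close> with \<open>d * t\<close> different from the new trace
  leaves an eigenvalue other than \<open>t\<close>, whose eigenvector is orthogonal to the known ones.
\<close>

lemma hermitian_eigenvector_step:
  fixes a :: "nat \<Rightarrow> nat \<Rightarrow> complex" and u :: "nat \<Rightarrow> nat \<Rightarrow> complex" and l :: "nat \<Rightarrow> real"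
  assumes herm: "\<And>i j. i < d \<Longrightarrow> j < d \<Longrightarrow> a i j = cnj (a j i)"
    and r: "r < d"
    and on: "\<And>k m. k < r \<Longrightarrow> m < r \<Longrightarrow> (\<Sum>i<d. u k i * cnj (u m i)) = (if k = m then 1 else 0)"
    and eig: "\<And>k i. k < r \<Longrightarrow> i < d \<Longrightarrow> (\<Sum>j<d. a i j * u k j) = of_real (l k) * u k i"
  shows "\<exists>v e. (\<Sum>i<d. v i * cnj (v i)) = 1 \<and> (\<forall>k<r. (\<Sum>i<d. v i * cnj (u k i)) = 0) \<and>
    (\<forall>i<d. (\<Sum>j<d. a i j * v j) = of_real (e :: real) * v i)"
proof -
  define tr where "tr = (\<Sum>i<d. a i i) - (\<Sum>k<r. of_real (l k))"
  \<comment> \<open>The trace of \<open>b\<close> is \<open>tr + r * t\<close> and has to differ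
    from \<open>d * t\<close>: the value 0 achieves this if \<open>tr \<noteq> 0\<close>, and
    otherwise 1 does because \<open>r < d\<close>.\<close>
  define t :: real where "t = (if tr = 0 then 1 else 0)"
  define b where "b i j = a i j + (\<Sum>k<r. of_real (t - l k) * u k i * cnj (u k j))" for i j
  have herm_b: "b i j = cnj (b j i)" if "i < d" "j < d" for i j
    using herm[OF that] by (simp add: b_def mult_ac)
  have act: "(\<Sum>j<d. b i j * x j) = (\<Sum>j<d. a i j * x j) +
      (\<Sum>k<r. of_real (t - l k) * u k i * (\<Sum>j<d. x j * cnj (u k j)))" for i x
  proof -
    have "(\<Sum>j<d. b i j * x j) = (\<Sum>j<d. a i j * x j) +
        (\<Sum>j<d. \<Sum>k<r. of_real (t - l k) * u k i * cnj (u k j) * x j)"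
      by (simp only: b_def distrib_right sum.distrib sum_distrib_right)
    also have "(\<Sum>j<d. \<Sum>k<r. of_real (t - l k) * u k i * cnj (u k j) * x j) =
        (\<Sum>k<r. \<Sum>j<d. of_real (t - l k) * u k i * cnj (u k j) * x j)"
      by (rule sum.swap)
    also have "\<dots> = (\<Sum>k<r. of_real (t - l k) * u k i * (\<Sum>j<d. x j * cnj (u k j)))"
      unfolding sum_distrib_left by (intro sum.cong refl) (simp only: mult_ac)
    finally show ?thesis .
  qed
  have trb: "(\<Sum>i<d. b i i) = tr + of_nat r * of_real t"
  proof -
    have "(\<Sum>i<d. b i i) = (\<Sum>i<d. a i i) + (\<Sum>k<r. of_real (t - l k) * (\<Sum>i<d. u k i * cnj (u k i)))"
      unfolding b_def sum.distrib sum_distrib_left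
      by (rule arg_cong, rule trans[OF sum.swap]) (simp only: mult_ac)
    also have "(\<Sum>k<r. of_real (t - l k) * (\<Sum>i<d. u k i * cnj (u k i))) = (\<Sum>k<r. of_real (t - l k))"
      by (rule sum.cong) (simp_all add: on)
    finally show ?thesis by (simp add: tr_def sum_subtractf)
  qed
  have "(\<Sum>i<d. b i i) \<noteq> of_nat d * of_real t"
    unfolding trb using r by (auto simp: t_def)
  then obtain e v where e: "e \<noteq> of_real t" and v0: "\<exists>i<d. v i \<noteq> 0"
    and v: "\<And>i. i < d \<Longrightarrow> (\<Sum>j<d. b i j * v j) = e * v i"
    using ex_eigenvector_ne[of b d "of_real t"] by blast
  define nv where "nv = (\<Sum>i<d. (cmod (v i))\<^sup>2)"
  have nv: "nv > 0"
  proof -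
    obtain i where "i < d" "v i \<noteq> 0" using v0 by blast
    then show ?thesis unfolding nv_def by (intro sum_pos2[of _ i]) auto
  qed
  have vv: "(\<Sum>i<d. v i * cnj (v i)) = of_real nv"
    by (simp add: nv_def complex_norm_square del: of_real_power)
  have "e * of_real nv = cnj e * of_real nv"
  proof -
    have "e * of_real nv = (\<Sum>i<d. (\<Sum>j<d. b i j * v j) * cnj (v i))"
      by (simp add: v mult.assoc flip: vv sum_distrib_left)
    also have "\<dots> = (\<Sum>i<d. v i * cnj (\<Sum>j<d. b i j * v j))"
      by (rule hermitian_swap[OF herm_b])
    also have "\<dots> = (\<Sum>i<d. cnj e * (v i * cnj (v i)))"
      by (intro sum.cong refl, subst v) auto
    also have "\<dots> = cnj e * of_real nv"
      by (simp only: vv flip: sum_distrib_left)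
    finally show ?thesis .
  qed
  then have "e = cnj e" using nv by simp
  then obtain e' where e': "e = of_real e'" by (metis Reals_cases Reals_cnj_iff)
  have orth: "(\<Sum>i<d. v i * cnj (u k i)) = 0" if k: "k < r" for k
  proof -
    have bu: "(\<Sum>j<d. b i j * u k j) = of_real t * u k i" if "i < d" for i
    proof -
      have "(\<Sum>m<r. of_real (t - l m) * u m i * (\<Sum>j<d. u k j * cnj (u m j))) =
          (\<Sum>m<r. if m = k then of_real (t - l k) * u k i else 0)"
        using k by (intro sum.cong) (auto simp: on)
      then show ?thesis unfolding act using k eig[OF k that] by (simp add: algebra_simps)
    qed
    have "e * (\<Sum>i<d. v i * cnj (u k i)) = (\<Sum>i<d. (\<Sum>j<d. b i j * v j) * cnj (u k i))"
      by (simp add: v mult.assoc flip: sum_distrib_left)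
    also have "\<dots> = (\<Sum>i<d. v i * cnj (\<Sum>j<d. b i j * u k j))"
      by (rule hermitian_swap[OF herm_b])
    also have "\<dots> = (\<Sum>i<d. of_real t * (v i * cnj (u k i)))"
      by (intro sum.cong refl, subst bu) auto
    also have "\<dots> = of_real t * (\<Sum>i<d. v i * cnj (u k i))"
      by (simp only: sum_distrib_left)
    finally show ?thesis using e by simp
  qed
  have av: "(\<Sum>j<d. a i j * v j) = of_real e' * v i" if "i < d" for i
    using v[OF that] unfolding act e' by (simp add: orth)
  define w where "w i = v i / of_real (sqrt nv)" for i
  have "(\<Sum>i<d. w i * cnj (w i)) = (\<Sum>i<d. v i * cnj (v i)) / (of_real (sqrt nv) * of_real (sqrt nv))"
    unfolding sum_divide_distrib by (simp add: w_def)
  also have "\<dots> = 1" unfolding vv using nv by (simp flip: of_real_mult)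
  finally have 1: "(\<Sum>i<d. w i * cnj (w i)) = 1" .
  have 2: "(\<Sum>i<d. w i * cnj (u k i)) = 0" if "k < r" for k
    using orth[OF that] by (simp add: w_def flip: sum_divide_distrib)
  have 3: "(\<Sum>j<d. a i j * w j) = of_real e' * w i" if "i < d" for i
    using av[OF that] by (simp add: w_def flip: sum_divide_distrib)
  from 1 2 3 show ?thesis by blast
qed

theorem hermitian_diagonalization:
  fixes a :: "nat \<Rightarrow> nat \<Rightarrow> complex"
  assumes herm: "\<And>i j. i < d \<Longrightarrow> j < d \<Longrightarrow> a i j = cnj (a j i)"
  shows "\<exists>(u :: nat \<Rightarrow> nat \<Rightarrow> complex) (l :: nat \<Rightarrow> real).
    (\<forall>k<d. \<forall>m<d. (\<Sum>i<d. u k i * cnj (u m i)) = (if k = m then 1 else 0)) \<and>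
    (\<forall>i<d. \<forall>j<d. (\<Sum>k<d. u k i * cnj (u k j)) = (if i = j then 1 else 0)) \<and>
    (\<forall>i<d. \<forall>j<d. a i j = (\<Sum>k<d. of_real (l k) * (u k i * cnj (u k j))))"
proof -
  have ex: "\<exists>(u :: nat \<Rightarrow> nat \<Rightarrow> complex) (l :: nat \<Rightarrow> real).
    (\<forall>k<r. \<forall>m<r. (\<Sum>i<d. u k i * cnj (u m i)) = (if k = m then 1 else 0)) \<and>
    (\<forall>k<r. \<forall>i<d. (\<Sum>j<d. a i j * u k j) = of_real (l k) * u k i)" if "r \<le> d" for r
    using that
  proof (induction r)
    case 0
    then show ?case by simp
  next
    case (Suc r)
    from Suc.IH[OF Suc_leD[OF Suc.prems]] obtain u :: "nat \<Rightarrow> nat \<Rightarrow> complex" and l :: "nat \<Rightarrow> real"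
      where on: "\<And>k m. k < r \<Longrightarrow> m < r \<Longrightarrow> (\<Sum>i<d. u k i * cnj (u m i)) = (if k = m then 1 else 0)"
        and eig: "\<And>k i. k < r \<Longrightarrow> i < d \<Longrightarrow> (\<Sum>j<d. a i j * u k j) = of_real (l k) * u k i"
      by blast
    from Suc.prems have "r < d" by simp
    from hermitian_eigenvector_step[OF herm this on eig] obtain v e
      where v: "(\<Sum>i<d. v i * cnj (v i)) = 1" "\<And>k. k < r \<Longrightarrow> (\<Sum>i<d. v i * cnj (u k i)) = 0"
        "\<And>i. i < d \<Longrightarrow> (\<Sum>j<d. a i j * v j) = of_real (e :: real) * v i" by blast
    have v': "(\<Sum>i<d. u k i * cnj (v i)) = 0" if "k < r" for k
    proof -
      have "(\<Sum>i<d. u k i * cnj (v i)) = cnj (\<Sum>i<d. v i * cnj (u k i))" by (simp add: mult.commute)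
      then show ?thesis using v(2)[OF that] by simp
    qed
    show ?case
      by (rule exI[of _ "u(r := v)"], rule exI[of _ "l(r := e)"])
        (auto simp: less_Suc_eq on eig v v')
  qed
  from ex[OF order_refl] obtain u :: "nat \<Rightarrow> nat \<Rightarrow> complex" and l :: "nat \<Rightarrow> real"
    where on: "\<And>k m. k < d \<Longrightarrow> m < d \<Longrightarrow> (\<Sum>i<d. u k i * cnj (u m i)) = (if k = m then 1 else 0)"
      and eig: "\<And>k i. k < d \<Longrightarrow> i < d \<Longrightarrow> (\<Sum>j<d. a i j * u k j) = of_real (l k) * u k i"
    by blast
  have complete: "(\<Sum>k<d. u k i * cnj (u k j)) = (if i = j then 1 else 0)" if "i < d" "j < d" for i j
  proof -
    have "(\<Sum>k<d. cnj (u k j) * u k i) = (if j = i then 1 else 0)"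
      by (rule left_right_inverse_sums[where x = u]) (use on that in auto)
    then show ?thesis by (auto simp: mult.commute)
  qed
  have "a i j = (\<Sum>k<d. of_real (l k) * (u k i * cnj (u k j)))" if "i < d" "j < d" for i j
  proof -
    have "a i j = (\<Sum>m<d. if m = j then a i j else 0)" using that by simp
    also have "\<dots> = (\<Sum>m<d. a i m * (\<Sum>k<d. u k m * cnj (u k j)))"
      using that by (intro sum.cong) (auto simp: complete)
    also have "\<dots> = (\<Sum>k<d. (\<Sum>m<d. a i m * u k m) * cnj (u k j))"
      unfolding sum_distrib_left sum_distrib_right by (subst sum.swap) (simp add: mult_ac)
    also have "\<dots> = (\<Sum>k<d. of_real (l k) * (u k i * cnj (u k j)))"
      using that by (intro sum.cong) (auto simp: eig)
    finally show ?thesis .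
  qed
  with on complete show ?thesis by blast
qed

subsection \<open>Concave functions and Bernstein sums\<close>

text \<open>The chord from \<open>a\<close> to \<open>d\<close> is the intermediate one: moving
  first the right end and then the left end to the right lowers the slope each time.\<close>

lemma concave_on_slope_le:
  fixes f :: "real \<Rightarrow> real"
  assumes f: "concave_on I f" and I: "a \<in> I" "b \<in> I" "c \<in> I" "d \<in> I"
    and le: "a < b" "c < d" "a \<le> c" "b \<le> d"
  shows "(f d - f c) / (d - c) \<le> (f b - f a) / (b - a)"
proof -
  have g: "convex_on I (\<lambda>x. - f x)" using f by (simp add: concave_on_def)
  have 1: "(f d - f a) / (d - a) \<le> (f b - f a) / (b - a)"
  proof (cases "b = d")
    case False
    then show ?thesis
      using convex_on_slope_le(1)[OF g, of a d b] I le
        minus_divide_divide[of "f d - f a" "d - a"] minus_divide_divide[of "f b - f a" "b - a"]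
      by (simp add: divide_simps) (simp add: algebra_simps)
  qed simp
  have 2: "(f d - f c) / (d - c) \<le> (f d - f a) / (d - a)"
  proof (cases "a = c")
    case False
    then show ?thesis
      using convex_on_slope_le(2)[OF g, of a d c] I le
      by (simp add: divide_simps) (simp add: algebra_simps)
  qed simp
  from 1 2 show ?thesis by linarith
qed

text \<open>Abel summation, peeled off from the last index. Monotonicity of \<open>c\<close> is
  asked only where \<open>d\<close> is nonzero, since in Karamata's inequality \<open>c i\<close> is
  a chord slope, which is meaningless where the two points coincide.\<close>

lemma abel_sum_le:
  fixes c d :: "nat \<Rightarrow> real"
  assumes partial: "\<And>m. m \<le> N \<Longrightarrow> 0 \<le> (\<Sum>i<m. d i)"
    and mono: "\<And>i j. i < j \<Longrightarrow> j < N \<Longrightarrow> d i \<noteq> 0 \<Longrightarrow> d j \<noteq> 0 \<Longrightarrow> c i \<le> c j"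
    and C: "\<And>i. i < N \<Longrightarrow> d i \<noteq> 0 \<Longrightarrow> c i \<le> C"
  shows "(\<Sum>i<N. c i * d i) \<le> C * (\<Sum>i<N. d i)"
  using assms
proof (induction N arbitrary: C)
  case (Suc N)
  show ?case
  proof (cases "d N = 0")
    case True
    then show ?thesis using Suc.IH[of C] Suc.prems by simp
  next
    case False
    have "(\<Sum>i<N. c i * d i) \<le> c N * (\<Sum>i<N. d i)"
      using Suc.prems False by (intro Suc.IH) auto
    then have "(\<Sum>i<Suc N. c i * d i) \<le> c N * (\<Sum>i<Suc N. d i)"
      by (simp add: distrib_left)
    also have "\<dots> \<le> C * (\<Sum>i<Suc N. d i)"
      using Suc.prems(1)[of "Suc N"] Suc.prems(3)[of N] False by (intro mult_right_mono) auto
    finally show ?thesis .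
  qed
qed simp

text \<open>Each difference \<open>f (y i) - f (x i)\<close> is a chord slope times
  \<open>y i - x i\<close>. As both sequences decrease, the chords move to the left and their slopes
  increase, which is the monotonicity that Abel summation wants.\<close>

lemma karamata:
  fixes f :: "real \<Rightarrow> real" and x y :: "nat \<Rightarrow> real"
  assumes f: "concave_on I f"
    and I: "\<And>i. i < N \<Longrightarrow> x i \<in> I" "\<And>i. i < N \<Longrightarrow> y i \<in> I"
    and anti: "\<And>i j. i < j \<Longrightarrow> j < N \<Longrightarrow> x j \<le> x i" "\<And>i j. i < j \<Longrightarrow> j < N \<Longrightarrow> y j \<le> y i"
    and partial: "\<And>m. m \<le> N \<Longrightarrow> (\<Sum>i<m. x i) \<le> (\<Sum>i<m. y i)"
    and total: "(\<Sum>i<N. x i) = (\<Sum>i<N. y i)"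
  shows "(\<Sum>i<N. f (y i)) \<le> (\<Sum>i<N. f (x i))"
proof -
  define c where "c i = (f (y i) - f (x i)) / (y i - x i)" for i
  \<comment> \<open>Any upper bound for the slopes would do, because the equal totals annihilate the
    factor \<open>C\<close>; the inserted 0 keeps the set nonempty.\<close>
  define C where "C = Max (insert 0 (c ` {..<N}))"
  have c_minmax: "c i = (f (max (x i) (y i)) - f (min (x i) (y i))) / (max (x i) (y i) - min (x i) (y i))" for i
    using minus_divide_divide[of "f (y i) - f (x i)" "y i - x i"] by (auto simp: c_def max_def min_def)
  have "(\<Sum>i<N. c i * (y i - x i)) \<le> C * (\<Sum>i<N. y i - x i)"
  proof (rule abel_sum_le)
    show "0 \<le> (\<Sum>i<m. y i - x i)" if "m \<le> N" for m
      using partial[OF that] by (simp add: sum_subtractf)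
    show "c i \<le> C" if "i < N" for i
      unfolding C_def using that by (intro Max_ge) auto
    show "c i \<le> c j" if "i < j" "j < N" "y i - x i \<noteq> 0" "y j - x j \<noteq> 0" for i j
      unfolding c_minmax[of i] c_minmax[of j]
      by (rule concave_on_slope_le[OF f])
        (use that I[of i] I[of j] anti[of i j] in \<open>auto simp: max_def min_def\<close>)
  qed
  moreover have "c i * (y i - x i) = f (y i) - f (x i)" for i
    by (cases "y i = x i") (auto simp: c_def)
  ultimately show ?thesis
    using total by (simp add: sum_subtractf)
qed

section \<open>Boundedness and measurability of concave functions on the closed unit
  interval\<close>

lemma concave_on_unit_bounded:
  fixes f :: "real \<Rightarrow> real"
  assumes f: "concave_on {0..1} f"
  shows "\<exists>M. \<forall>x\<in>{0..1}. \<bar>f x\<bar> \<le> M"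
proof -
  have low: "- \<bar>f 0\<bar> - \<bar>f 1\<bar> \<le> f x" if x: "x \<in> {0..1}" for x
  proof -
    have "(1 - x) * f 0 + x * f 1 \<le> f x"
      using concave_onD[OF f, of x 0 1] x by simp
    moreover have "\<bar>(1 - x) * f 0\<bar> \<le> \<bar>f 0\<bar>" "\<bar>x * f 1\<bar> \<le> \<bar>f 1\<bar>"
      using x by (simp_all add: abs_mult mult_left_le_one_le)
    ultimately show ?thesis by linarith
  qed
  \<comment> \<open>The midpoint of \<open>x\<close> and \<open>1 - x\<close> is
    \<open>1 / 2\<close>, so the lower bound at \<open>1 - x\<close> yields an upper bound at
    \<open>x\<close>.\<close>
  have "\<bar>f x\<bar> \<le> 2 * \<bar>f (1 / 2)\<bar> + \<bar>f 0\<bar> + \<bar>f 1\<bar>" if x: "x \<in> {0..1}" for x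
  proof -
    have "f x / 2 + f (1 - x) / 2 \<le> f (1 / 2)"
      using concave_onD[OF f, of "1/2" x "1 - x"] x by (simp add: field_simps)
    then show ?thesis using low[OF x] low[of "1 - x"] x by auto
  qed
  then show ?thesis by blast
qed

lemma continuous_on_concave_unit:
  fixes f :: "real \<Rightarrow> real"
  assumes f: "concave_on {0..1} f"
  shows "continuous_on {0<..<1} f"
proof -
  have "convex_on {0<..<1} (\<lambda>x. - f x)"
    using f unfolding concave_on_def by (rule convex_on_subset) auto
  then have "continuous_on {0<..<1} (\<lambda>x. - f x)"
    by (intro convex_on_continuous) auto
  then have "continuous_on {0<..<1} (\<lambda>x. - (- f x))"
    by (rule continuous_on_minus)
  then show ?thesis by simp
qed

lemma borel_measurable_concave_unit:
  fixes f :: "real \<Rightarrow> real"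
  assumes f: "concave_on {0..1} f" and g: "g \<in> borel_measurable M"
    and g01: "\<And>x. x \<in> space M \<Longrightarrow> g x \<in> {0..1}"
  shows "(\<lambda>x. f (g x)) \<in> borel_measurable M"
proof -
  \<comment> \<open>\<open>f\<close> may jump at 0 and 1, so its two end values are attached by hand
    to the continuous restriction.\<close>
  define h where "h x = indicator {0<..<1} x *\<^sub>R f x + indicator {0} x * f 0 + indicator {1} x * f 1" for x :: real
  have "(\<lambda>x. indicator {0<..<1} x *\<^sub>R f x) \<in> borel_measurable borel"
    by (rule borel_measurable_continuous_on_indicator) (use continuous_on_concave_unit[OF f] in auto)
  then have "h \<in> borel_measurable borel"
    unfolding h_def by (intro borel_measurable_add borel_measurable_times) auto
  then have "(\<lambda>x. h (g x)) \<in> borel_measurable M"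
    using g by simp
  moreover have "h (g x) = f (g x)" if "x \<in> space M" for x
    using g01[OF that] by (auto simp: h_def indicator_def)
  ultimately show ?thesis by (simp cong: measurable_cong)
qed

section \<open>Bernstein sums\<close>

lemma Bernstein_variance:
  assumes "N > 0"
  shows "(\<Sum>k\<le>N. (real k / real N - x)\<^sup>2 * Bernstein N k x) = x * (1 - x) / real N"
proof -
  have "(real k / real N - x)\<^sup>2 * Bernstein N k x =
      (real k * (real k - 1) * Bernstein N k x + (1 - 2 * real N * x) * (real k * Bernstein N k x)
       + (real N)\<^sup>2 * x\<^sup>2 * Bernstein N k x) / (real N)\<^sup>2" for k
    using assms by (simp add: field_simps power2_eq_square)
  then have "(\<Sum>k\<le>N. (real k / real N - x)\<^sup>2 * Bernstein N k x) =
     (real N * (real N - 1) * x\<^sup>2 + (1 - 2 * real N * x) * (real N * x) + (real N)\<^sup>2 * x\<^sup>2) / (real N)\<^sup>2"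
    by (simp add: sum.distrib flip: sum_divide_distrib sum_distrib_left)
  also have "\<dots> = x * (1 - x) / real N"
    using assms by (simp add: field_simps power2_eq_square)
  finally show ?thesis .
qed

text \<open>Chebyshev's argument from Bernstein's proof of the Weierstrass theorem, for node values
  that also depend on \<open>N\<close>. \<open>H\<close> extends them off the nodes, so that
  convergence can be asked for \<open>N\<close> large and \<open>x\<close> near \<open>t\<close>
  simultaneously.\<close>

lemma Bernstein_tendsto:
  fixes h :: "nat \<Rightarrow> nat \<Rightarrow> real" and H :: "nat \<times> real \<Rightarrow> real"
  assumes t: "t \<in> {0..1}"
    and hH: "\<And>N i. 0 < N \<Longrightarrow> i \<le> N \<Longrightarrow> h N i = H (N, real i / real N)"
    and lim: "(H \<longlongrightarrow> L) (sequentially \<times>\<^sub>F nhds t)"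
    and bound: "\<And>N i. i \<le> N \<Longrightarrow> \<bar>h N i\<bar> \<le> M"
  shows "(\<lambda>N. \<Sum>i\<le>N. h N i * Bernstein N i t) \<longlonglongrightarrow> L"
proof (rule LIMSEQ_I)
  fix r :: real assume r: "r > 0"
  define C where "C = M + \<bar>L\<bar>"
  have C: "C \<ge> 0" using bound[of 0 0] by (simp add: C_def)
  have "\<forall>\<^sub>F p in sequentially \<times>\<^sub>F nhds t. dist (H p) L < r / 2"
    using lim r unfolding tendsto_iff by (meson half_gt_zero)
  then obtain P Q where P: "eventually P sequentially" and Q: "eventually Q (nhds t)"
    and PQ: "\<And>N x. P N \<Longrightarrow> Q x \<Longrightarrow> dist (H (N, x)) L < r / 2"
    unfolding eventually_prod_filter by blast
  obtain N0 where N0: "\<And>N. N \<ge> N0 \<Longrightarrow> P N" using P by (auto simp: eventually_sequentially)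
  obtain d where d: "d > 0" "\<And>x. dist x t < d \<Longrightarrow> Q x" using Q by (auto simp: eventually_nhds_metric)
  obtain N1 :: nat where N1: "real N1 > 2 * (C / d\<^sup>2) / r" using reals_Archimedean2 by blast
  show "\<exists>no. \<forall>N\<ge>no. norm ((\<Sum>i\<le>N. h N i * Bernstein N i t) - L) < r"
  proof (intro exI allI impI)
    fix N assume N: "N \<ge> max 1 (max N0 N1)"
    then have Npos: "N > 0" by auto
    \<comment> \<open>Near \<open>t\<close> the limit controls the deviation. Away from
      \<open>t\<close> the quadratic term exceeds the crude bound \<open>C\<close>, and its
      Bernstein average is a variance of order \<open>1 / N\<close>.\<close>
    have dev: "\<bar>h N i - L\<bar> \<le> r / 2 + C / d\<^sup>2 * (real i / real N - t)\<^sup>2" if i: "i \<le> N" for i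
    proof (cases "dist (real i / real N) t < d")
      case True
      then have "\<bar>h N i - L\<bar> < r / 2"
        using PQ[OF N0 d(2)[OF True], of N] N hH[OF Npos i] by (simp add: dist_real_def)
      moreover have "0 \<le> C / d\<^sup>2 * (real i / real N - t)\<^sup>2" using C by simp
      ultimately show ?thesis by linarith
    next
      case False
      then have "d\<^sup>2 \<le> (real i / real N - t)\<^sup>2"
        using d(1) by (simp add: dist_real_def abs_le_square_iff[symmetric])
      then have "C / d\<^sup>2 * d\<^sup>2 \<le> C / d\<^sup>2 * (real i / real N - t)\<^sup>2"
        using C by (intro mult_left_mono) auto
      moreover have "\<bar>h N i - L\<bar> \<le> C" using bound[OF i] by (simp add: C_def)
      ultimately show ?thesis using r d(1) by simp
    qed
    have B0: "0 \<le> Bernstein N i t" for i using t by (simp add: Bernstein_nonneg)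
    have "(\<Sum>i\<le>N. h N i * Bernstein N i t) - L = (\<Sum>i\<le>N. (h N i - L) * Bernstein N i t)"
      by (simp add: left_diff_distrib sum_subtractf flip: sum_distrib_left)
    then have "\<bar>(\<Sum>i\<le>N. h N i * Bernstein N i t) - L\<bar> \<le> (\<Sum>i\<le>N. \<bar>h N i - L\<bar> * Bernstein N i t)"
      using sum_abs[of "\<lambda>i. (h N i - L) * Bernstein N i t" "{..N}"] B0 by (simp add: abs_mult)
    also have "\<dots> \<le> (\<Sum>i\<le>N. (r / 2 + C / d\<^sup>2 * (real i / real N - t)\<^sup>2) * Bernstein N i t)"
      by (intro sum_mono mult_right_mono dev B0) auto
    also have "\<dots> = r / 2 * (\<Sum>i\<le>N. Bernstein N i t) +
        C / d\<^sup>2 * (\<Sum>i\<le>N. (real i / real N - t)\<^sup>2 * Bernstein N i t)"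
      by (simp only: distrib_right sum.distrib sum_distrib_left mult.assoc)
    also have "\<dots> = r / 2 + C / d\<^sup>2 * (t * (1 - t) / real N)"
      unfolding Bernstein_variance[OF Npos] by simp
    also have "\<dots> \<le> r / 2 + C / d\<^sup>2 * (1 / real N)"
    proof -
      have "t * (1 - t) \<le> 1 * 1" using t by (intro mult_mono) auto
      then show ?thesis using C by (intro add_left_mono mult_left_mono divide_right_mono) auto
    qed
    also have "\<dots> < r / 2 + r / 2"
    proof -
      have "2 * (C / d\<^sup>2) / r < real N" using N1 N by simp
      then have "2 * (C / d\<^sup>2) < real N * r" unfolding pos_divide_less_eq[OF r] .
      then have "C / d\<^sup>2 < r / 2 * real N" by (simp add: mult.commute)
      then have "C / d\<^sup>2 / real N < r / 2" using Npos by (subst pos_divide_less_eq) auto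
      then have "C / d\<^sup>2 * (1 / real N) < r / 2" by (simp only: times_divide_eq_right mult_1_right)
      then show ?thesis by (rule add_strict_left_mono)
    qed
    finally show "norm ((\<Sum>i\<le>N. h N i * Bernstein N i t) - L) < r" by simp
  qed
qed

lemma binomial_ratio:
  assumes "n \<le> N"
  shows "real (i choose n) / real (N choose n) = (\<Prod>j<n. (real i - real j) / (real N - real j))"
  unfolding binomial_gbinomial gbinomial_prod_rev of_nat_id
  by (simp add: prod_dividef atLeast0LessThan)

text \<open>The ratio behaves like \<open>(i / N) ^ n\<close>, and the weights concentrate where
  \<open>i / N\<close> is near \<open>t\<close>. At \<open>t = 0\<close> and \<open>t = 1\<close>,
  where continuity of \<open>f\<close> may fail, all the weight sits on a single node, and there the
  ratio is eventually exactly 0 or 1.\<close>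

lemma Bernstein_binomial_tendsto:
  fixes f :: "real \<Rightarrow> real"
  assumes f: "concave_on {0..1} f" and t: "t \<in> {0..1}"
  shows "(\<lambda>N. \<Sum>i\<le>N. f (real (i choose n) / real (N choose n)) * Bernstein N i t) \<longlonglongrightarrow> f (t ^ n)"
proof -
  let ?S = "\<lambda>N. \<Sum>i\<le>N. f (real (i choose n) / real (N choose n)) * Bernstein N i t"
  consider "n = 0" | "n > 0" "t = 0" | "t = 1" | "n > 0" "t \<in> {0<..<1}"
    using t by fastforce
  then show ?thesis
  proof cases
    case 1
    then have "?S N = f 1" for N by (simp flip: sum_distrib_left)
    then show ?thesis using 1 by simp
  next
    case 2
    have "?S N = (\<Sum>i\<le>N. if i = 0 then f 0 else 0)" for N
      using 2 by (intro sum.cong) (auto simp: Bernstein_def gr0_conv_Suc)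
    then show ?thesis using 2 by (simp add: power_0_left)
  next
    case 3
    have "?S N = f 1" if "N \<ge> n" for N
    proof -
      have "?S N = (\<Sum>i\<le>N. if i = N then f 1 else 0)"
        using 3 that by (intro sum.cong) (auto simp: Bernstein_def)
      then show ?thesis by simp
    qed
    then show ?thesis
      using 3 by (intro tendsto_eventually eventually_sequentiallyI[of n]) simp
  next
    case 4
    obtain M where M: "\<And>x. x \<in> {0..1} \<Longrightarrow> \<bar>f x\<bar> \<le> M"
      using concave_on_unit_bounded[OF f] by blast
    define R where "R = (\<lambda>(N :: nat, x). \<Prod>j<n. (x - real j * (1 / real N)) / (1 - real j * (1 / real N)))"
    \<comment> \<open>For \<open>N < n\<close> the denominator \<open>N choose n\<close> is 0 and
      the product formula fails. Rounding \<open>x * N\<close> then recovers the index from a node,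
      so that \<open>H\<close> agrees with the node values for every positive
      \<open>N\<close>.\<close>
    define H where "H = (\<lambda>(N :: nat, x). if n \<le> N then f (R (N, x)) else
        f (real (nat \<lfloor>x * real N + 1 / 2\<rfloor> choose n) / real (N choose n)))"
    have N: "((\<lambda>p. 1 / real (fst p)) \<longlongrightarrow> 0) (sequentially \<times>\<^sub>F nhds t)"
      by (rule filterlim_compose[OF lim_1_over_n filterlim_fst])
    have x: "(snd \<longlongrightarrow> t) (sequentially \<times>\<^sub>F nhds t)"
      by (rule filterlim_snd)
    have "((\<lambda>p. \<Prod>j<n. (snd p - real j * (1 / real (fst p))) / (1 - real j * (1 / real (fst p))))
        \<longlongrightarrow> (\<Prod>j<n. (t - real j * 0) / (1 - real j * 0))) (sequentially \<times>\<^sub>F nhds t)"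
      by (intro tendsto_intros N x) simp
    then have R: "(R \<longlongrightarrow> t ^ n) (sequentially \<times>\<^sub>F nhds t)"
      by (simp add: R_def split_def)
    have "t ^ n \<in> {0<..<1}"
      using 4 by (auto simp: power_less_one_iff)
    then have "isCont f (t ^ n)"
      using continuous_on_concave_unit[OF f] by (simp add: continuous_on_eq_continuous_at)
    then have "((\<lambda>p. f (R p)) \<longlongrightarrow> f (t ^ n)) (sequentially \<times>\<^sub>F nhds t)"
      using R by (rule isCont_tendsto_compose)
    moreover have "\<forall>\<^sub>F p in sequentially \<times>\<^sub>F nhds t. f (R p) = H p"
      unfolding eventually_prod_filter
      by (intro exI[of _ "\<lambda>N. n \<le> N"] exI[of _ "\<lambda>_. True"]) (auto simp: H_def eventually_ge_at_top)
    ultimately have lim: "(H \<longlongrightarrow> f (t ^ n)) (sequentially \<times>\<^sub>F nhds t)"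
      by (rule Lim_transform_eventually)
    show ?thesis
    proof (rule Bernstein_tendsto[OF t _ lim])
      fix N i :: nat assume i: "i \<le> N"
      have "real (i choose n) / real (N choose n) \<in> {0..1}"
        using i binomial_mono[of n n] by (auto simp: divide_le_eq_1 binomial_right_mono)
      then show "\<bar>f (real (i choose n) / real (N choose n))\<bar> \<le> M" by (rule M)
      assume N: "0 < N"
      show "f (real (i choose n) / real (N choose n)) = H (N, real i / real N)"
      proof (cases "n \<le> N")
        case True
        have "(real i - real j) / (real N - real j) =
            (real i / real N - real j * (1 / real N)) / (1 - real j * (1 / real N))" if "j < n" for j
          using N True that by (simp add: divide_simps)
        then show ?thesis using True by (simp add: H_def R_def binomial_ratio)
      next
        case False
        have "nat \<lfloor>real i / real N * real N + 1 / 2\<rfloor> = i"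
          using N by simp
        then show ?thesis using False by (simp add: H_def)
      qed
    qed
  qed
qed

subsection \<open>Coherent states on the sphere\<close>

text \<open>The Hopf map: \<open>(z, w)\<close> is a unit vector over the point \<omega>. It is a
  relation because a common phase is free.\<close>

definition spinor :: "real ^ 3 \<Rightarrow> complex \<Rightarrow> complex \<Rightarrow> bool" where
  "spinor \<omega> z w \<longleftrightarrow> (cmod z)\<^sup>2 + (cmod w)\<^sup>2 = 1 \<and> 2 * cnj z * w = Complex (\<omega> $ 1) (\<omega> $ 2) \<and>
     (cmod z)\<^sup>2 - (cmod w)\<^sup>2 = \<omega> $ 3"

text \<open>The choice with a real nonnegative first component, the cosine of half the polar
  angle.\<close>

definition spinor_up :: "real ^ 3 \<Rightarrow> complex" where
  "spinor_up \<omega> = of_real (sqrt ((1 + \<omega> $ 3) / 2))"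

text \<open>At the south pole the phase of the second component is arbitrary.\<close>

definition spinor_down :: "real ^ 3 \<Rightarrow> complex" where
  "spinor_down \<omega> = (if \<omega> $ 3 = -1 then 1
     else Complex (\<omega> $ 1) (\<omega> $ 2) / of_real (2 * sqrt ((1 + \<omega> $ 3) / 2)))"

lemma spinor_up_down:
  assumes "\<omega> \<in> sphere 0 1"
  shows "spinor \<omega> (spinor_up \<omega>) (spinor_down \<omega>)"
proof -
  have n: "(\<omega> $ 1)\<^sup>2 + (\<omega> $ 2)\<^sup>2 + (\<omega> $ 3)\<^sup>2 = 1"
    using assms by (simp add: norm_vec_def L2_set_def sum_3)
  then have "(\<omega> $ 3)\<^sup>2 \<le> 1" using zero_le_power2[of "\<omega> $ 1"] zero_le_power2[of "\<omega> $ 2"] by linarith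
  then have le: "\<bar>\<omega> $ 3\<bar> \<le> 1" by (simp add: abs_square_le_1)
  define s where "s = sqrt ((1 + \<omega> $ 3) / 2)"
  have s2: "s\<^sup>2 = (1 + \<omega> $ 3) / 2" using le by (simp add: s_def)
  show ?thesis
  proof (cases "\<omega> $ 3 = -1")
    case True
    then have "\<omega> $ 1 = 0" "\<omega> $ 2 = 0" using n by (auto simp: sum_power2_eq_zero_iff)
    then show ?thesis using True by (simp add: spinor_def spinor_up_def spinor_down_def complex_eq_iff)
  next
    case False
    then have s0: "s > 0" using le by (auto simp: s_def)
    have w: "(cmod (spinor_down \<omega>))\<^sup>2 = ((\<omega> $ 1)\<^sup>2 + (\<omega> $ 2)\<^sup>2) / (4 * s\<^sup>2)"
      using False s0 by (simp add: spinor_down_def norm_divide norm_mult power_divide cmod_power2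
          power_mult_distrib flip: s_def)
    also have "\<dots> = (1 - \<omega> $ 3) / 2"
    proof -
      have "(\<omega> $ 1)\<^sup>2 + (\<omega> $ 2)\<^sup>2 = (1 - \<omega> $ 3) * (1 + \<omega> $ 3)"
        using n by (simp add: algebra_simps power2_eq_square)
      then show ?thesis unfolding s2 using False by (simp add: field_simps)
    qed
    finally have w: "(cmod (spinor_down \<omega>))\<^sup>2 = (1 - \<omega> $ 3) / 2" .
    have z: "(cmod (spinor_up \<omega>))\<^sup>2 = (1 + \<omega> $ 3) / 2"
      using s2 by (simp add: spinor_up_def flip: s_def)
    have "2 * cnj (spinor_up \<omega>) * spinor_down \<omega> = Complex (\<omega> $ 1) (\<omega> $ 2)"
      using False s0 by (simp add: spinor_down_def spinor_up_def flip: s_def)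
    then show ?thesis unfolding spinor_def z w by (simp add: field_simps)
  qed
qed

lemma spinor_measurable:
  "spinor_up \<in> borel_measurable sphere_measure" "spinor_down \<in> borel_measurable sphere_measure"
proof -
  have sets: "sets sphere_measure = sets (restrict_space borel (sphere 0 1))"
    by (simp add: sphere_measure_def)
  have c: "(\<lambda>\<omega>. \<omega> $ i) \<in> borel_measurable sphere_measure" for i :: 3
    unfolding measurable_cong_sets[OF sets refl]
    by (intro measurable_restrict_space1 borel_measurable_continuous_onI continuous_intros)
  show "spinor_up \<in> borel_measurable sphere_measure"
    unfolding spinor_up_def using c by measurable
  have "(\<lambda>\<omega>. of_real (\<omega> $ 1) + \<i> * of_real (\<omega> $ 2) :: complex) \<in> borel_measurable sphere_measure"
    using c by measurable
  then have C: "(\<lambda>\<omega>. Complex (\<omega> $ 1) (\<omega> $ 2)) \<in> borel_measurable sphere_measure"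
    by (simp add: Complex_eq)
  have "(\<lambda>\<omega>. Complex (\<omega> $ 1) (\<omega> $ 2) / of_real (2 * sqrt ((1 + \<omega> $ 3) / 2))) \<in> borel_measurable sphere_measure"
    using c C by measurable
  moreover have "{\<omega> \<in> space sphere_measure. \<omega> $ 3 = -1} \<in> sets sphere_measure"
    using c by measurable
  ultimately show "spinor_down \<in> borel_measurable sphere_measure"
    unfolding spinor_down_def by (intro measurable_If) auto
qed

text \<open>The value of the form of degree \<open>n\<close> at \<open>(cnj z, cnj w)\<close>; the
  conjugates arise because the coherent state stands in the antilinear slot.\<close>

definition coherent_eval :: "nat \<Rightarrow> complex \<Rightarrow> complex \<Rightarrow> complex poly \<Rightarrow> complex" where
  "coherent_eval n z w p = (\<Sum>j\<le>n. coeff p j * cnj z ^ (n - j) * cnj w ^ j)"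

text \<open>Reproducing property: the binomial coefficients of the power reduce all weights to
  \<open>fact n\<close>.\<close>

lemma bombieri_ip_linear_power: "bombieri_ip n ([:z, w:] ^ n) p = fact n * coherent_eval n z w p"
proof -
  have "of_nat (fact j * fact (n - j)) * cnj (coeff ([:z, w:] ^ n) j) * coeff p j =
      fact n * (coeff p j * cnj z ^ (n - j) * cnj w ^ j)" if "j \<le> n" for j
    using that by (simp add: coeff_linear_poly_power binomial_fact)
  then show ?thesis unfolding bombieri_ip_def coherent_eval_def sum_distrib_left by (intro sum.cong refl) auto
qed

lemma coherent_eval_linear_power: "coherent_eval n z w ([:x, y:] ^ n) = (x * cnj z + y * cnj w) ^ n"
proof -
  have "coherent_eval n z w ([:x, y:] ^ n) = (\<Sum>j\<le>n. of_nat (n choose j) * (y * cnj w) ^ j * (x * cnj z) ^ (n - j))"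
    unfolding coherent_eval_def
    by (intro sum.cong) (simp_all add: coeff_linear_poly_power power_mult_distrib mult_ac)
  also have "\<dots> = (y * cnj w + x * cnj z) ^ n" by (simp add: binomial_ring)
  finally show ?thesis by (simp add: add.commute)
qed

lemma bombieri_nsq_linear_power: "bombieri_nsq n ([:z, w:] ^ n) = fact n * ((cmod z)\<^sup>2 + (cmod w)\<^sup>2) ^ n"
proof -
  have "complex_of_real (bombieri_nsq n ([:z, w:] ^ n)) = of_real (fact n * ((cmod z)\<^sup>2 + (cmod w)\<^sup>2) ^ n)"
    unfolding bombieri_ip_self[symmetric] bombieri_ip_linear_power coherent_eval_linear_power
    by (simp add: complex_norm_square del: of_real_power)
      (simp add: complex_norm_square[symmetric])
  then show ?thesis unfolding of_real_eq_iff .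
qed

lemma coherent_eval_monom_mult:
  assumes "a \<le> k" "degree v \<le> n"
  shows "coherent_eval (n + k) z w (monom 1 a * v) = cnj z ^ (k - a) * cnj w ^ a * coherent_eval n z w v"
proof -
  have "coherent_eval (n + k) z w (monom 1 a * v) =
      (\<Sum>j\<le>n + k. if a \<le> j then coeff v (j - a) * cnj z ^ (n + k - j) * cnj w ^ j else 0)"
    unfolding coherent_eval_def by (intro sum.cong) (simp_all add: coeff_monom_mult)
  also have "\<dots> = (\<Sum>j\<in>{a..n + a}. coeff v (j - a) * cnj z ^ (n + k - j) * cnj w ^ j)"
    by (rule sum.mono_neutral_cong_right) (use assms in \<open>auto intro!: coeff_eq_0\<close>)
  also have "\<dots> = (\<Sum>i\<le>n. coeff v i * cnj z ^ (n + k - (i + a)) * cnj w ^ (i + a))"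
    by (rule sum.reindex_bij_witness[where i = "\<lambda>i. i + a" and j = "\<lambda>j. j - a"]) auto
  also have "\<dots> = cnj z ^ (k - a) * cnj w ^ a * coherent_eval n z w v"
  proof -
    have "coeff v i * cnj z ^ (n + k - (i + a)) * cnj w ^ (i + a) =
        cnj z ^ (k - a) * cnj w ^ a * (coeff v i * cnj z ^ (n - i) * cnj w ^ i)" if "i \<le> n" for i
    proof -
      have "n + k - (i + a) = (k - a) + (n - i)" using that assms by simp
      then show ?thesis by (simp add: power_add mult_ac)
    qed
    then show ?thesis unfolding coherent_eval_def sum_distrib_left by (intro sum.cong refl) auto
  qed
  finally show ?thesis .
qed

text \<open>Evaluation is multiplicative, so the monomials factor out and their contributions form a
  binomial expansion of 1, divided by \<open>fact k\<close>. Hence lifting changes the lower symbol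
  only by a constant, and Jensen's inequality in degree \<open>n + k\<close> speaks about the
  original integrand.\<close>

lemma lift_form_coherent:
  assumes "(cmod z)\<^sup>2 + (cmod w)\<^sup>2 = 1" "degree v \<le> n"
  shows "lift_form n k v ([:z, w:] ^ (n + k)) = (fact (n + k))\<^sup>2 / fact k * (cmod (coherent_eval n z w v))\<^sup>2"
proof -
  let ?X = "(fact (n + k))\<^sup>2 * (cmod (coherent_eval n z w v))\<^sup>2"
  have "lift_form n k v ([:z, w:] ^ (n + k)) = (\<Sum>a\<le>k. ?X / fact k *
      (of_nat (k choose a) * ((cmod w)\<^sup>2) ^ a * ((cmod z)\<^sup>2) ^ (k - a)))"
    unfolding lift_form_def
  proof (intro sum.cong refl)
    fix a assume a: "a \<in> {..k}"
    have "(cmod (bombieri_ip (n + k) ([:z, w:] ^ (n + k)) (monom 1 a * v)))\<^sup>2 =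
        ?X * (((cmod w)\<^sup>2) ^ a * ((cmod z)\<^sup>2) ^ (k - a))"
    proof -
      have "a \<le> k" using a by simp
      then show ?thesis
        unfolding bombieri_ip_linear_power coherent_eval_monom_mult[OF \<open>a \<le> k\<close> assms(2)]
        by (simp add: norm_mult norm_power power_mult_distrib mult_ac flip: power_mult)
    qed
    then show "(cmod (bombieri_ip (n + k) ([:z, w:] ^ (n + k)) (monom 1 a * v)))\<^sup>2 / (fact a * fact (k - a)) =
        ?X / fact k * (of_nat (k choose a) * ((cmod w)\<^sup>2) ^ a * ((cmod z)\<^sup>2) ^ (k - a))"
      using a by (simp add: binomial_fact)
  qed
  also have "\<dots> = ?X / fact k * ((cmod w)\<^sup>2 + (cmod z)\<^sup>2) ^ k"
    by (simp only: binomial_ring sum_distrib_left)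
  finally show ?thesis using assms(1) by (simp add: add.commute)
qed

section \<open>The resolution of the identity by coherent states\<close>

lemma has_integral_cis:
  "((\<lambda>t. cis (of_int m * t)) has_integral (if m = 0 then 2 * pi else 0)) {0..2 * pi}"
proof (cases "m = 0")
  case True
  then show ?thesis using has_integral_const_real[of "1 :: complex" 0 "2 * pi"] by (simp add: scaleR_conv_of_real)
next
  case False
  have "((\<lambda>t. cis (of_int m * t)) has_integral
      (cis (of_int m * (2 * pi)) / (\<i> * of_int m) - cis (of_int m * 0) / (\<i> * of_int m))) {0..2 * pi}"
  proof (rule fundamental_theorem_of_calculus)
    fix x assume "x \<in> {0..2 * pi}"
    have "((\<lambda>z. exp (\<i> * (of_int m * z)) / (\<i> * of_int m)) has_field_derivative exp (\<i> * (of_int m * of_real x)))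
        (at (of_real x))"
      using False by (auto intro!: derivative_eq_intros simp: mult_ac)
    from has_vector_derivative_real_field[OF this]
    show "((\<lambda>t. cis (of_int m * t) / (\<i> * of_int m)) has_vector_derivative cis (of_int m * x)) (at x within {0..2 * pi})"
      by (simp add: cis_conv_exp)
  qed simp
  moreover have "cis (of_int m * (2 * pi)) = 1"
    using cis_multiple_2pi[of "of_int m"] by (simp add: mult.commute mult.left_commute)
  ultimately show ?thesis using False by simp
qed

lemma has_integral_parseval:
  fixes a :: "nat \<Rightarrow> complex"
  shows "((\<lambda>t. (cmod (\<Sum>j\<le>n. a j * cis (- (real j * t))))\<^sup>2) has_integral 2 * pi * (\<Sum>j\<le>n. (cmod (a j))\<^sup>2)) {0..2 * pi}"
proof -
  have "(\<Sum>j\<le>n. \<Sum>i\<le>n. a j * cnj (a i) * cis (of_int (int i - int j) * t)) =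
      of_real ((cmod (\<Sum>j\<le>n. a j * cis (- (real j * t))))\<^sup>2)" for t
    unfolding complex_norm_square cnj_sum sum_product
    by (intro sum.cong refl) (simp add: cis_cnj cis_mult algebra_simps)
  moreover have "(\<Sum>j\<le>n. \<Sum>i\<le>n. a j * cnj (a i) * (if int i - int j = 0 then 2 * pi else 0)) =
      of_real (2 * pi * (\<Sum>j\<le>n. (cmod (a j))\<^sup>2))"
  proof -
    have "(\<Sum>i\<le>n. a j * cnj (a i) * (if int i - int j = 0 then 2 * pi else 0)) = a j * cnj (a j) * (2 * pi)"
      if "j \<le> n" for j
    proof -
      have "(\<Sum>i\<le>n. a j * cnj (a i) * (if int i - int j = 0 then 2 * pi else 0)) =
         (\<Sum>i\<le>n. if i = j then a j * cnj (a j) * (2 * pi) else 0)"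
        by (intro sum.cong) auto
      then show ?thesis using that by simp
    qed
    then show ?thesis
      by (simp add: complex_norm_square sum_distrib_left mult_ac del: of_real_power)
  qed
  moreover have "((\<lambda>t. \<Sum>j\<le>n. \<Sum>i\<le>n. a j * cnj (a i) * cis (of_int (int i - int j) * t)) has_integral
     (\<Sum>j\<le>n. \<Sum>i\<le>n. a j * cnj (a i) * (if int i - int j = 0 then 2 * pi else 0))) {0..2 * pi}"
    by (intro has_integral_sum has_integral_mult_right has_integral_cis) auto
  ultimately have "((\<lambda>t. complex_of_real ((cmod (\<Sum>j\<le>n. a j * cis (- (real j * t))))\<^sup>2)) has_integral
      of_real (2 * pi * (\<Sum>j\<le>n. (cmod (a j))\<^sup>2))) {0..2 * pi}"
    by (simp only:)
  from has_integral_Re[OF this] show ?thesis by (simp only: Re_complex_of_real)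
qed

lemma power_cos_half_deriv:
  "((\<lambda>t. cos (t / 2) ^ m) has_real_derivative real m * cos (x / 2) ^ (m - 1) * (- sin (x / 2) * (1 / 2))) (at x within S)"
  "((\<lambda>t. sin (t / 2) ^ m) has_real_derivative real m * sin (x / 2) ^ (m - 1) * (cos (x / 2) * (1 / 2))) (at x within S)"
  by (auto intro!: derivative_eq_intros)

text \<open>A beta integral in the variable \<open>sin (t / 2) ^ 2\<close>. Integration by parts
  trades a squared sine for a squared cosine, which is why \<open>p\<close> varies in the
  induction.\<close>

lemma has_integral_cos_sin_half:
  "((\<lambda>t. cos (t / 2) ^ (2 * p) * sin (t / 2) ^ (2 * q) * sin t) has_integral
     2 * fact p * fact q / fact (p + q + 1)) {0..pi}"
proof (induction q arbitrary: p)
  case 0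
  have sin_t: "sin t = 2 * sin (t / 2) * cos (t / 2)" for t :: real
    using sin_double[of "t / 2"] by simp
  have "((\<lambda>t. cos (t / 2) ^ (2 * p) * sin t) has_integral
      (- 2 / (real p + 1) * cos (pi / 2) ^ (2 * p + 2) - (- 2 / (real p + 1) * cos (0 / 2) ^ (2 * p + 2)))) {0..pi}"
  proof (rule fundamental_theorem_of_calculus)
    fix x assume "x \<in> {0..pi}"
    have "((\<lambda>t. - 2 / (real p + 1) * cos (t / 2) ^ (2 * p + 2)) has_real_derivative
       - 2 / (real p + 1) * (real (2 * p + 2) * cos (x / 2) ^ (2 * p + 1) * (- sin (x / 2) * (1 / 2)))) (at x within {0..pi})"
      using power_cos_half_deriv(1)[of "2 * p + 2"] by (intro DERIV_cmult) simp
    also have "- 2 / (real p + 1) * (real (2 * p + 2) * cos (x / 2) ^ (2 * p + 1) * (- sin (x / 2) * (1 / 2)))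
        = cos (x / 2) ^ (2 * p) * sin x"
      by (simp add: sin_t[of x] divide_simps)
    finally show "((\<lambda>t. - 2 / (real p + 1) * cos (t / 2) ^ (2 * p + 2)) has_vector_derivative
        cos (x / 2) ^ (2 * p) * sin x) (at x within {0..pi})"
      by (simp add: has_real_derivative_iff_has_vector_derivative)
  qed simp
  moreover have "2 * fact p * fact 0 / fact (p + 0 + 1) = 2 / (real p + 1)"
    by (simp add: divide_simps)
  ultimately show ?case by (simp add: add.commute)
next
  case (Suc q)
  have sin_t: "sin t = 2 * sin (t / 2) * cos (t / 2)" for t :: real
    using sin_double[of "t / 2"] by simp
  \<comment> \<open>The boundary term of the integration by parts, scaled so that \<open>A\<close>
    gets the coefficient 1; it vanishes at both ends because \<open>cos (pi / 2) = 0\<close> and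
    \<open>sin 0 = 0\<close>.\<close>
  define g where "g t = - 2 / (real p + 1) * (cos (t / 2) ^ (2 * p + 2) * sin (t / 2) ^ (2 * q + 2))" for t :: real
  define A where "A t = cos (t / 2) ^ (2 * p) * sin (t / 2) ^ (2 * Suc q) * sin t" for t :: real
  define B where "B t = cos (t / 2) ^ (2 * Suc p) * sin (t / 2) ^ (2 * q) * sin t" for t :: real
  have "((\<lambda>t. A t - (real q + 1) / (real p + 1) * B t) has_integral (g pi - g 0)) {0..pi}"
  proof (rule fundamental_theorem_of_calculus)
    fix x assume "x \<in> {0..pi}"
    have "(g has_real_derivative - 2 / (real p + 1) *
        (real (2 * p + 2) * cos (x / 2) ^ (2 * p + 1) * (- sin (x / 2) * (1 / 2)) * sin (x / 2) ^ (2 * q + 2)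
         + cos (x / 2) ^ (2 * p + 2) * (real (2 * q + 2) * sin (x / 2) ^ (2 * q + 1) * (cos (x / 2) * (1 / 2)))))
        (at x within {0..pi})"
      unfolding g_def
      using DERIV_mult'[OF power_cos_half_deriv(1)[of "2 * p + 2"] power_cos_half_deriv(2)[of "2 * q + 2"]]
      by (intro DERIV_cmult) (simp add: add.commute mult_ac)
    also have "- 2 / (real p + 1) *
        (real (2 * p + 2) * cos (x / 2) ^ (2 * p + 1) * (- sin (x / 2) * (1 / 2)) * sin (x / 2) ^ (2 * q + 2)
         + cos (x / 2) ^ (2 * p + 2) * (real (2 * q + 2) * sin (x / 2) ^ (2 * q + 1) * (cos (x / 2) * (1 / 2))))
       = A x - (real q + 1) / (real p + 1) * B x"
      unfolding A_def B_def sin_t[of x] by (simp add: divide_simps) (simp add: algebra_simps)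
    finally show "(g has_vector_derivative A x - (real q + 1) / (real p + 1) * B x) (at x within {0..pi})"
      by (simp add: has_real_derivative_iff_has_vector_derivative)
  qed simp
  moreover have "((\<lambda>t. (real q + 1) / (real p + 1) * B t) has_integral
      (real q + 1) / (real p + 1) * (2 * fact (Suc p) * fact q / fact (Suc p + q + 1))) {0..pi}"
    unfolding B_def by (intro has_integral_mult_right Suc.IH)
  ultimately have "((\<lambda>t. (A t - (real q + 1) / (real p + 1) * B t) + (real q + 1) / (real p + 1) * B t) has_integral
     (g pi - g 0) + (real q + 1) / (real p + 1) * (2 * fact (Suc p) * fact q / fact (Suc p + q + 1))) {0..pi}"
    by (rule has_integral_add)
  moreover have "g pi = 0" "g 0 = 0" by (simp_all add: g_def)
  moreover have "(real q + 1) / (real p + 1) * (2 * fact (Suc p) * fact q / fact (Suc p + q + 1)) =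
      2 * fact p * fact (Suc q) / fact (p + Suc q + 1)"
  proof -
    have "(real q + 1) / (real p + 1) * (2 * ((real p + 1) * P) * Q / F) = 2 * P * ((real q + 1) * Q) / F"
      for P Q F :: real
      by (simp add: divide_simps)
    from this[of "fact p" "fact q" "fact (p + Suc q + 1)"] show ?thesis
      by (simp only: fact_Suc of_nat_Suc add.commute[of 1] add_Suc add_Suc_right)
  qed
  ultimately show ?case by (simp add: A_def)
qed

text \<open>The south pole is left out, since the phase of \<open>spinor_down\<close> is fixed there
  by convention and does not follow \<open>cis \<phi>\<close>.\<close>

lemma spinor_spherical_coords:
  assumes "\<theta> \<in> {0..<pi}"
  shows "spinor_up (spherical_coords (\<theta>, \<phi>)) = of_real (cos (\<theta> / 2))"
    and "spinor_down (spherical_coords (\<theta>, \<phi>)) = of_real (sin (\<theta> / 2)) * cis \<phi>"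
proof -
  have pos: "cos (\<theta> / 2) > 0" using assms by (intro cos_gt_zero_pi) auto
  have c: "cos \<theta> = 2 * (cos (\<theta> / 2))\<^sup>2 - 1" and s: "sin \<theta> = 2 * sin (\<theta> / 2) * cos (\<theta> / 2)"
    using cos_double_cos[of "\<theta> / 2"] sin_double[of "\<theta> / 2"] by simp_all
  have sq: "sqrt ((1 + cos \<theta>) / 2) = cos (\<theta> / 2)"
    using pos unfolding c by (simp add: real_sqrt_unique)
  have [simp]: "spherical_coords (\<theta>, \<phi>) $ 1 = sin \<theta> * cos \<phi>" "spherical_coords (\<theta>, \<phi>) $ 2 = sin \<theta> * sin \<phi>"
    "spherical_coords (\<theta>, \<phi>) $ 3 = cos \<theta>"
    by (simp_all add: spherical_coords_def vector_3)
  show "spinor_up (spherical_coords (\<theta>, \<phi>)) = of_real (cos (\<theta> / 2))"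
    by (simp add: spinor_up_def sq)
  have "cos \<theta> \<noteq> -1" using pos unfolding c by auto
  moreover have "Complex (sin \<theta> * cos \<phi>) (sin \<theta> * sin \<phi>) = of_real (sin \<theta>) * cis \<phi>"
    by (simp add: complex_eq_iff)
  ultimately show "spinor_down (spherical_coords (\<theta>, \<phi>)) = of_real (sin (\<theta> / 2)) * cis \<phi>"
    using pos by (simp add: spinor_down_def sq) (simp add: s)
qed

lemma coherent_eval_spinor_measurable [measurable]:
  "(\<lambda>\<omega>. coherent_eval n (spinor_up \<omega>) (spinor_down \<omega>) p) \<in> borel_measurable sphere_measure"
proof -
  have "cnj \<in> borel_measurable borel" by (intro borel_measurable_continuous_onI continuous_intros)
  then have "(\<lambda>\<omega>. cnj (spinor_up \<omega>)) \<in> borel_measurable sphere_measure"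
    "(\<lambda>\<omega>. cnj (spinor_down \<omega>)) \<in> borel_measurable sphere_measure"
    using spinor_measurable by (auto intro: measurable_compose)
  then show ?thesis unfolding coherent_eval_def by measurable
qed

text \<open>Integration over \<phi> removes the cross terms by Parseval, and the beta integral over
  \<theta> returns the weights \<open>fact j * fact (n - j)\<close>. The nonnegative integral gives
  access to Tonelli's theorem before integrability is known.\<close>

lemma coherent_resolution_nn:
  "(\<integral>\<^sup>+\<omega>. ennreal ((cmod (coherent_eval n (spinor_up \<omega>) (spinor_down \<omega>) p))\<^sup>2) \<partial>sphere_measure) =
     ennreal (4 * pi * bombieri_nsq n p / fact (n + 1))"
proof -
  let ?g = "\<lambda>\<omega>. (cmod (coherent_eval n (spinor_up \<omega>) (spinor_down \<omega>) p))\<^sup>2"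
  let ?D = "\<lambda>(\<theta>, \<phi>). ennreal (sin \<theta> * indicator ({0..pi} \<times> {0..2 * pi}) (\<theta>, \<phi>))"
  have D: "?D \<in> borel_measurable (lborel \<Otimes>\<^sub>M lborel)" by measurable
  have gm: "?g \<in> borel_measurable sphere_measure" by measurable
  have gm': "?g \<in> borel_measurable (restrict_space borel (sphere 0 1))"
    using gm by (simp add: measurable_def sphere_measure_def)
  have gs: "(\<lambda>x. ?g (spherical_coords x)) \<in> borel_measurable borel"
    by (rule measurable_compose[OF measurable_spherical_coords gm'])
  have gs2: "(\<lambda>x. ennreal (?g (spherical_coords x))) \<in> borel_measurable (lborel \<Otimes>\<^sub>M lborel)"
    unfolding lborel_prod using gs by simp
  define c where "c \<theta> j = coeff p j * of_real (cos (\<theta> / 2) ^ (n - j) * sin (\<theta> / 2) ^ j)" for \<theta> j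
  have "(\<integral>\<^sup>+\<omega>. ennreal (?g \<omega>) \<partial>sphere_measure) =
      (\<integral>\<^sup>+x. ennreal (?g (spherical_coords x)) \<partial>density lborel ?D)"
    unfolding sphere_measure_def
    by (rule nn_integral_distr) (use measurable_spherical_coords gm in \<open>auto simp: sphere_measure_def\<close>)
  also have "\<dots> = (\<integral>\<^sup>+x. ?D x * ennreal (?g (spherical_coords x)) \<partial>(lborel \<Otimes>\<^sub>M lborel))"
    unfolding lborel_prod
    by (rule nn_integral_density) (use D gs2 in \<open>simp_all add: lborel_prod\<close>)
  also have "\<dots> = (\<integral>\<^sup>+\<theta>. (\<integral>\<^sup>+\<phi>. ?D (\<theta>, \<phi>) * ennreal (?g (spherical_coords (\<theta>, \<phi>))) \<partial>lborel) \<partial>lborel)"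
    by (rule lborel.nn_integral_fst[symmetric]) (intro borel_measurable_times_ennreal D gs2)
  also have "\<dots> = (\<integral>\<^sup>+\<theta>. ennreal (indicator {0..pi} \<theta> *
      (sin \<theta> * (2 * pi * (\<Sum>j\<le>n. (cmod (c \<theta> j))\<^sup>2)))) \<partial>lborel)"
  proof (rule nn_integral_cong)
    fix \<theta> :: real
    show "(\<integral>\<^sup>+\<phi>. ?D (\<theta>, \<phi>) * ennreal (?g (spherical_coords (\<theta>, \<phi>))) \<partial>lborel) =
       ennreal (indicator {0..pi} \<theta> * (sin \<theta> * (2 * pi * (\<Sum>j\<le>n. (cmod (c \<theta> j))\<^sup>2))))"
    proof (cases "\<theta> \<in> {0..<pi}")
      case False
      \<comment> \<open>The value \<open>\<theta> = pi\<close> belongs to this case and contributes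
        nothing because \<open>sin pi = 0\<close>.\<close>
      then have "?D (\<theta>, \<phi>) = 0" for \<phi> by (cases "\<theta> = pi") (auto simp: indicator_def)
      moreover have "indicator {0..pi} \<theta> * (sin \<theta> * x) = 0" for x
        using False by (cases "\<theta> = pi") (auto simp: indicator_def)
      ultimately show ?thesis by (simp only: mult_zero_left nn_integral_0_iff_AE nn_integral_const ennreal_0)
    next
      case True
      have sin: "sin \<theta> \<ge> 0" using True by (intro sin_ge_zero) auto
      have ev: "coherent_eval n (spinor_up (spherical_coords (\<theta>, \<phi>))) (spinor_down (spherical_coords (\<theta>, \<phi>))) p =
          (\<Sum>j\<le>n. c \<theta> j * cis (- (real j * \<phi>)))" for \<phi>
        unfolding coherent_eval_def spinor_spherical_coords[OF True] c_def
        by (intro sum.cong refl) (simp add: power_mult_distrib cis_cnj Complex.DeMoivre mult_ac)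
      have "(\<integral>\<^sup>+\<phi>. ?D (\<theta>, \<phi>) * ennreal (?g (spherical_coords (\<theta>, \<phi>))) \<partial>lborel) =
          (\<integral>\<^sup>+\<phi>. ennreal (sin \<theta>) * ennreal (indicator {0..2 * pi} \<phi> *
             (cmod (\<Sum>j\<le>n. c \<theta> j * cis (- (real j * \<phi>))))\<^sup>2) \<partial>lborel)"
        using True sin unfolding ev by (intro nn_integral_cong) (auto simp: indicator_def)
      also have "\<dots> = ennreal (sin \<theta>) * (\<integral>\<^sup>+\<phi>. ennreal (indicator {0..2 * pi} \<phi> *
             (cmod (\<Sum>j\<le>n. c \<theta> j * cis (- (real j * \<phi>))))\<^sup>2) \<partial>lborel)"
      proof (rule nn_integral_cmult)
        have "(\<lambda>\<phi>. (cmod (\<Sum>j\<le>n. c \<theta> j * cis (- (real j * \<phi>))))\<^sup>2) \<in> borel_measurable borel"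
          by (intro borel_measurable_continuous_onI continuous_intros)
        then show "(\<lambda>\<phi>. ennreal (indicator {0..2 * pi} \<phi> *
             (cmod (\<Sum>j\<le>n. c \<theta> j * cis (- (real j * \<phi>))))\<^sup>2)) \<in> borel_measurable lborel"
          by measurable
      qed
      also have "\<dots> = ennreal (sin \<theta>) * ennreal (2 * pi * (\<Sum>j\<le>n. (cmod (c \<theta> j))\<^sup>2))"
        by (subst nn_integral_has_integral_lebesgue[OF _ has_integral_parseval]) auto
      also have "\<dots> = ennreal (indicator {0..pi} \<theta> * (sin \<theta> * (2 * pi * (\<Sum>j\<le>n. (cmod (c \<theta> j))\<^sup>2))))"
        using True sin by (simp add: ennreal_mult' flip: ennreal_mult)
      finally show ?thesis .
    qed
  qed
  also have "\<dots> = ennreal (\<Sum>j\<le>n. 2 * pi * (cmod (coeff p j))\<^sup>2 * (2 * fact (n - j) * fact j / fact (n - j + j + 1)))"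
  proof (rule nn_integral_has_integral_lebesgue)
    show "0 \<le> sin \<theta> * (2 * pi * (\<Sum>j\<le>n. (cmod (c \<theta> j))\<^sup>2))" if "\<theta> \<in> {0..pi}" for \<theta>
      using that by (intro mult_nonneg_nonneg sin_ge_zero sum_nonneg) auto
    have "((\<lambda>\<theta>. \<Sum>j\<le>n. 2 * pi * (cmod (coeff p j))\<^sup>2 *
        (cos (\<theta> / 2) ^ (2 * (n - j)) * sin (\<theta> / 2) ^ (2 * j) * sin \<theta>)) has_integral
      (\<Sum>j\<le>n. 2 * pi * (cmod (coeff p j))\<^sup>2 * (2 * fact (n - j) * fact j / fact (n - j + j + 1)))) {0..pi}"
      by (intro has_integral_sum has_integral_mult_right has_integral_cos_sin_half) simp
    moreover have "(\<Sum>j\<le>n. 2 * pi * (cmod (coeff p j))\<^sup>2 *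
        (cos (\<theta> / 2) ^ (2 * (n - j)) * sin (\<theta> / 2) ^ (2 * j) * sin \<theta>)) =
        sin \<theta> * (2 * pi * (\<Sum>j\<le>n. (cmod (c \<theta> j))\<^sup>2))" for \<theta>
      unfolding sum_distrib_left
      by (intro sum.cong refl)
        (simp add: c_def norm_mult power_mult_distrib mult_ac power_mult[symmetric] power_abs del: of_real_mult of_real_power)
    ultimately show "((\<lambda>\<theta>. sin \<theta> * (2 * pi * (\<Sum>j\<le>n. (cmod (c \<theta> j))\<^sup>2))) has_integral
      (\<Sum>j\<le>n. 2 * pi * (cmod (coeff p j))\<^sup>2 * (2 * fact (n - j) * fact j / fact (n - j + j + 1)))) {0..pi}"
      by simp
  qed
  also have "(\<Sum>j\<le>n. 2 * pi * (cmod (coeff p j))\<^sup>2 * (2 * fact (n - j) * fact j / fact (n - j + j + 1)))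
      = 4 * pi * bombieri_nsq n p / fact (n + 1)"
    unfolding bombieri_nsq_def sum_distrib_left sum_divide_distrib
    by (intro sum.cong refl) (simp add: mult_ac)
  finally show ?thesis .
qed

lemma coherent_resolution:
  "integrable sphere_measure (\<lambda>\<omega>. (cmod (coherent_eval n (spinor_up \<omega>) (spinor_down \<omega>) p))\<^sup>2)"
  "(LINT \<omega>|sphere_measure. (cmod (coherent_eval n (spinor_up \<omega>) (spinor_down \<omega>) p))\<^sup>2) =
     4 * pi * bombieri_nsq n p / fact (n + 1)"
proof -
  have "has_bochner_integral sphere_measure (\<lambda>\<omega>. (cmod (coherent_eval n (spinor_up \<omega>) (spinor_down \<omega>) p))\<^sup>2)
     (4 * pi * bombieri_nsq n p / fact (n + 1))"
    by (rule has_bochner_integral_nn_integral)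
      (use coherent_resolution_nn in \<open>auto intro!: divide_nonneg_nonneg mult_nonneg_nonneg bombieri_nsq_nonneg\<close>)
  then show "integrable sphere_measure (\<lambda>\<omega>. (cmod (coherent_eval n (spinor_up \<omega>) (spinor_down \<omega>) p))\<^sup>2)"
    "(LINT \<omega>|sphere_measure. (cmod (coherent_eval n (spinor_up \<omega>) (spinor_down \<omega>) p))\<^sup>2) =
     4 * pi * bombieri_nsq n p / fact (n + 1)"
    by (simp_all add: has_bochner_integral_iff)
qed

subsection \<open>Eigenvalues and the Berezin-Lieb inequality\<close>

lemma ex_antimono_arrangement:
  fixes l :: "nat \<Rightarrow> real"
  shows "\<exists>\<pi>. bij_betw \<pi> {..<d} {..<d} \<and> (\<forall>i j. i < j \<longrightarrow> j < d \<longrightarrow> l (\<pi> j) \<le> l (\<pi> i))"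
proof -
  define xs where "xs = sort_key (\<lambda>i. - l i) [0..<d]"
  have xs: "distinct xs" "set xs = {..<d}" "length xs = d"
    by (auto simp: xs_def)
  have "bij_betw (\<lambda>i. xs ! i) {..<d} {..<d}"
    by (rule bij_betw_nth) (use xs in auto)
  moreover have "l (xs ! j) \<le> l (xs ! i)" if "i < j" "j < d" for i j
  proof -
    have "sorted (map (\<lambda>i. - l i) xs)" unfolding xs_def by (rule sorted_sort_key)
    then have "map (\<lambda>i. - l i) xs ! i \<le> map (\<lambda>i. - l i) xs ! j"
      using that xs(3) by (intro sorted_nth_mono) auto
    then show ?thesis using that xs(3) by simp
  qed
  ultimately show ?thesis by blast
qed

section \<open>Quadratic forms on polynomials in normalized coordinates\<close>

lemma quadratic_form_expand:
  fixes w :: "'m \<Rightarrow> real" and u :: "'m \<Rightarrow> 'i \<Rightarrow> complex"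
  shows "complex_of_real (\<Sum>m\<in>M. w m * (cmod (\<Sum>i\<in>I. b i * u m i))\<^sup>2) =
    (\<Sum>i\<in>I. \<Sum>j\<in>I. b i * cnj (b j) * (\<Sum>m\<in>M. of_real (w m) * (u m i * cnj (u m j))))"
proof -
  have "complex_of_real (\<Sum>m\<in>M. w m * (cmod (\<Sum>i\<in>I. b i * u m i))\<^sup>2) =
    (\<Sum>m\<in>M. \<Sum>i\<in>I. \<Sum>j\<in>I. of_real (w m) * (b i * u m i * cnj (b j * u m j)))"
    by (simp only: of_real_sum of_real_mult complex_norm_square cnj_sum sum_product) (simp only: sum_distrib_left)
  also have "\<dots> = (\<Sum>i\<in>I. \<Sum>m\<in>M. \<Sum>j\<in>I. of_real (w m) * (b i * u m i * cnj (b j * u m j)))"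
    by (rule sum.swap)
  also have "\<dots> = (\<Sum>i\<in>I. \<Sum>j\<in>I. \<Sum>m\<in>M. of_real (w m) * (b i * u m i * cnj (b j * u m j)))"
    by (intro sum.cong refl sum.swap)
  also have "\<dots> = (\<Sum>i\<in>I. \<Sum>j\<in>I. b i * cnj (b j) * (\<Sum>m\<in>M. of_real (w m) * (u m i * cnj (u m j))))"
    unfolding sum_distrib_left by (intro sum.cong refl) (simp add: mult_ac)
  finally show ?thesis .
qed

text \<open>The norm of the monomial number \<open>j\<close>. Dividing by it sends standard basis
  vectors to unit polynomials, so that \<open>coord_poly\<close> is an isometry.\<close>

definition coord_weight :: "nat \<Rightarrow> nat \<Rightarrow> real" where
  "coord_weight n j = sqrt (fact j * fact (n - j))"

lemma coord_weight: "coord_weight n j > 0" "coord_weight n j * coord_weight n j = fact j * fact (n - j)"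
  by (simp_all add: coord_weight_def)

definition coord_poly :: "nat \<Rightarrow> (nat \<Rightarrow> complex) \<Rightarrow> complex poly" where
  "coord_poly n x = (\<Sum>j\<le>n. monom (x j / of_real (coord_weight n j)) j)"

lemma coeff_coord_poly: "coeff (coord_poly n x) j = (if j \<le> n then x j / of_real (coord_weight n j) else 0)"
  by (simp add: coord_poly_def coeff_sum)

lemma degree_coord_poly: "degree (coord_poly n x) \<le> n"
  by (rule degree_le) (simp add: coeff_coord_poly)

lemma bombieri_ip_weighted:
  "bombieri_ip n p q = (\<Sum>j\<le>n. cnj (of_real (coord_weight n j) * coeff p j) * (of_real (coord_weight n j) * coeff q j))"
proof -
  have "of_nat (fact j * fact (n - j)) = complex_of_real (coord_weight n j) * of_real (coord_weight n j)" for j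
    unfolding of_real_mult[symmetric] coord_weight(2) by simp
  then show ?thesis unfolding bombieri_ip_def by (intro sum.cong refl) (simp add: mult_ac)
qed

lemma coord_weight_coeff_coord_poly: "j \<le> n \<Longrightarrow> of_real (coord_weight n j) * coeff (coord_poly n x) j = x j"
  using coord_weight(1)[of n j] by (simp add: coeff_coord_poly)

lemma bombieri_ip_coord_poly: "bombieri_ip n (coord_poly n x) (coord_poly n y) = (\<Sum>j\<le>n. cnj (x j) * y j)"
  unfolding bombieri_ip_weighted by (intro sum.cong refl) (simp add: coord_weight_coeff_coord_poly)

text \<open>The spectral theorem for the frame operator of the weighted vectors \<open>q s\<close>,
  expressed through its quadratic form; the eigenvalues decrease, as Karamata's inequality
  requires.\<close>

lemma frame_diagonalization:
  fixes c :: "'s \<Rightarrow> real" and q :: "'s \<Rightarrow> complex poly"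
  shows "\<exists>e l. bombieri_orthonormal n (n + 1) e \<and> (\<forall>m\<le>n. degree (e m) \<le> n) \<and>
    (\<forall>x. bombieri_nsq n x = (\<Sum>m\<le>n. (cmod (bombieri_ip n x (e m)))\<^sup>2)) \<and>
    (\<forall>x. (\<Sum>s\<in>S. c s * (cmod (bombieri_ip n x (q s)))\<^sup>2) = (\<Sum>m\<le>n. l m * (cmod (bombieri_ip n x (e m)))\<^sup>2)) \<and>
    (\<forall>i j. i < j \<longrightarrow> j \<le> n \<longrightarrow> l j \<le> l i)"
proof -
  define h where "h p j = of_real (coord_weight n j) * coeff p j" for p :: "complex poly" and j
  have ip: "bombieri_ip n x y = (\<Sum>j\<le>n. cnj (h x j) * h y j)" for x y
    unfolding bombieri_ip_weighted h_def ..
  define a where "a i j = (\<Sum>s\<in>S. of_real (c s) * (h (q s) i * cnj (h (q s) j)))" for i j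
  have herm: "a i j = cnj (a j i)" for i j by (simp add: a_def mult_ac)
  from hermitian_diagonalization[of "Suc n" a, OF herm, unfolded lessThan_Suc_atMost less_Suc_eq_le]
  obtain u l0 where
        on: "\<forall>k\<le>n. \<forall>m\<le>n. (\<Sum>i\<le>n. u k i * cnj (u m i)) = (if k = m then 1 else 0)"
    and comp: "\<forall>i\<le>n. \<forall>j\<le>n. (\<Sum>k\<le>n. u k i * cnj (u k j)) = (if i = j then 1 else 0)"
    and diag: "\<forall>i\<le>n. \<forall>j\<le>n. a i j = (\<Sum>k\<le>n. of_real (l0 k) * (u k i * cnj (u k j)))"
    by (elim exE conjE)
  obtain \<pi> where \<pi>: "bij_betw \<pi> {..n} {..n}" and anti: "\<And>i j. i < j \<Longrightarrow> j \<le> n \<Longrightarrow> l0 (\<pi> j) \<le> l0 (\<pi> i)"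
    using ex_antimono_arrangement[of "Suc n" l0] unfolding lessThan_Suc_atMost less_Suc_eq_le by blast
  define e where "e m = coord_poly n (u (\<pi> m))" for m
  have \<pi>n: "\<pi> m \<le> n" if "m \<le> n" for m using \<pi> that by (auto simp: bij_betw_def)
  have e: "bombieri_ip n x (e m) = (\<Sum>j\<le>n. cnj (h x j) * u (\<pi> m) j)" for x m
    unfolding ip by (intro sum.cong refl) (simp add: h_def e_def coord_weight_coeff_coord_poly)
  have 1: "bombieri_orthonormal n (n + 1) e"
    unfolding bombieri_orthonormal_def
  proof (intro allI impI)
    fix i j assume ij: "i < n + 1" "j < n + 1"
    have "bombieri_ip n (e i) (e j) = (\<Sum>k\<le>n. u (\<pi> j) k * cnj (u (\<pi> i) k))"
      unfolding e_def bombieri_ip_coord_poly by (simp add: mult.commute)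
    also have "\<dots> = (if \<pi> j = \<pi> i then 1 else 0)" using ij \<pi>n on by simp
    also have "\<pi> j = \<pi> i \<longleftrightarrow> i = j"
      using \<pi> ij by (auto simp: bij_betw_def inj_on_def)
    finally show "bombieri_ip n (e i) (e j) = (if i = j then 1 else 0)" .
  qed
  have 2: "degree (e m) \<le> n" for m by (simp add: e_def degree_coord_poly)
  have 3: "bombieri_nsq n x = (\<Sum>m\<le>n. (cmod (bombieri_ip n x (e m)))\<^sup>2)" for x
  proof -
    have "(\<Sum>m\<le>n. (cmod (bombieri_ip n x (e m)))\<^sup>2) = (\<Sum>m\<le>n. 1 * (cmod (\<Sum>j\<le>n. cnj (h x j) * u m j))\<^sup>2)"
      unfolding e using sum.reindex_bij_betw[OF \<pi>, of "\<lambda>m. (cmod (\<Sum>j\<le>n. cnj (h x j) * u m j))\<^sup>2"] by simp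
    then have "complex_of_real (\<Sum>m\<le>n. (cmod (bombieri_ip n x (e m)))\<^sup>2) =
       (\<Sum>i\<le>n. \<Sum>j\<le>n. cnj (h x i) * cnj (cnj (h x j)) * (\<Sum>m\<le>n. of_real 1 * (u m i * cnj (u m j))))"
      by (simp only: quadratic_form_expand)
    also have "\<dots> = (\<Sum>i\<le>n. \<Sum>j\<le>n. if j = i then cnj (h x i) * h x i else 0)"
      by (intro sum.cong refl) (simp add: comp)
    also have "\<dots> = of_real (bombieri_nsq n x)"
      unfolding bombieri_ip_self[symmetric] ip by simp
    finally show ?thesis by (simp only: of_real_eq_iff)
  qed
  have 4: "(\<Sum>s\<in>S. c s * (cmod (bombieri_ip n x (q s)))\<^sup>2) = (\<Sum>m\<le>n. l0 (\<pi> m) * (cmod (bombieri_ip n x (e m)))\<^sup>2)" for x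
  proof -
    have "complex_of_real (\<Sum>s\<in>S. c s * (cmod (bombieri_ip n x (q s)))\<^sup>2) =
       (\<Sum>i\<le>n. \<Sum>j\<le>n. cnj (h x i) * cnj (cnj (h x j)) * a i j)"
      unfolding ip quadratic_form_expand a_def ..
    also have "\<dots> = (\<Sum>i\<le>n. \<Sum>j\<le>n. cnj (h x i) * cnj (cnj (h x j)) *
        (\<Sum>m\<le>n. of_real (l0 m) * (u m i * cnj (u m j))))"
      by (intro sum.cong refl arg_cong2[where f = "(*)"] diag[rule_format]) auto
    also have "\<dots> = of_real (\<Sum>m\<le>n. l0 m * (cmod (\<Sum>j\<le>n. cnj (h x j) * u m j))\<^sup>2)"
      by (simp only: quadratic_form_expand)
    also have "(\<Sum>m\<le>n. l0 m * (cmod (\<Sum>j\<le>n. cnj (h x j) * u m j))\<^sup>2) =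
        (\<Sum>m\<le>n. l0 (\<pi> m) * (cmod (bombieri_ip n x (e m)))\<^sup>2)"
      unfolding e using sum.reindex_bij_betw[OF \<pi>, of "\<lambda>m. l0 m * (cmod (\<Sum>j\<le>n. cnj (h x j) * u m j))\<^sup>2"] by simp
    finally show ?thesis by (simp only: of_real_eq_iff)
  qed
  show ?thesis
    by (rule exI[of _ e], rule exI[of _ "\<lambda>m. l0 (\<pi> m)"]) (use 1 2 3 4 anti in blast)
qed

lemma bombieri_orthonormal_imp_bombieri_nsq: "bombieri_orthonormal n r e \<Longrightarrow> i < r \<Longrightarrow> bombieri_nsq n (e i) = 1"
proof -
  assume "bombieri_orthonormal n r e" "i < r"
  then have "complex_of_real (bombieri_nsq n (e i)) = 1" by (simp add: bombieri_orthonormal_def flip: bombieri_ip_self)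
  then show ?thesis by simp
qed

text \<open>The trace of the lifted coherent state, by the hockey-stick identity; indices above
  \<open>k\<close> contribute 0.\<close>

lemma sum_coherent_weight: "(\<Sum>i\<le>n + k. coherent_weight n k i) = real (n + k + 1 choose (n + 1))"
proof -
  have "(\<Sum>i\<le>n + k. coherent_weight n k i) = (\<Sum>i\<le>n + k. real ((n + k - i) choose n))"
    by (intro sum.cong refl) (auto simp: coherent_weight_def binomial_eq_0_iff)
  also have "(\<Sum>i\<le>n + k. real ((n + k - i) choose n)) = (\<Sum>i\<le>n + k. real (i choose n))"
    by (rule sum.reindex_bij_witness[where i = "\<lambda>i. n + k - i" and j = "\<lambda>i. n + k - i"]) auto
  also have "\<dots> = real (n + k + 1 choose (n + 1))"
    using sum_choose_upper[of n "n + k"] by (simp flip: of_nat_sum)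
  finally show ?thesis by simp
qed

text \<open>The squared components \<open>W m\<close> of a coherent state in an eigenbasis of the
  lift are probability weights, so the lower symbol is an average of eigenvalues at each point of
  the sphere. Each \<open>W m\<close> has the same integral, which turns an integral of averages
  into a trace.\<close>

lemma coherent_integral_ge_trace:
  fixes c :: "'s \<Rightarrow> real" and p :: "'s \<Rightarrow> complex poly" and f :: "real \<Rightarrow> real"
  assumes f: "concave_on {0..1} f"
    and S: "finite S" "\<And>s. s \<in> S \<Longrightarrow> 0 \<le> c s" "(\<Sum>s\<in>S. c s) = 1"
    and p: "\<And>s. s \<in> S \<Longrightarrow> degree (p s) \<le> n" "\<And>s. s \<in> S \<Longrightarrow> bombieri_nsq n (p s) = 1"
    and int: "integrable sphere_measure (\<lambda>\<omega>. f (\<Sum>s\<in>S. c s * (fact n * (cmod (coherent_eval n (spinor_up \<omega>) (spinor_down \<omega>) (p s)))\<^sup>2)))"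
  shows "4 * pi / real (n + k + 1) * (\<Sum>i\<le>n + k. f (real (i choose n) / real (n + k choose n))) \<le>
    (LINT \<omega>|sphere_measure. f (\<Sum>s\<in>S. c s * (fact n * (cmod (coherent_eval n (spinor_up \<omega>) (spinor_down \<omega>) (p s)))\<^sup>2)))"
proof -
  define N where "N = n + k"
  define F where "F \<omega> = (\<Sum>s\<in>S. c s * (fact n * (cmod (coherent_eval n (spinor_up \<omega>) (spinor_down \<omega>) (p s)))\<^sup>2))" for \<omega>
  obtain e l where e: "bombieri_orthonormal N (N + 1) e" "\<And>m. m \<le> N \<Longrightarrow> degree (e m) \<le> N"
    and comp: "\<And>x. bombieri_nsq N x = (\<Sum>m\<le>N. (cmod (bombieri_ip N x (e m)))\<^sup>2)"
    and diag: "\<And>x. (\<Sum>y\<in>S \<times> {..k}. (case y of (s, a) \<Rightarrow> c s / (fact a * fact (k - a))) *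
       (cmod (bombieri_ip N x (case y of (s, a) \<Rightarrow> monom 1 a * p s)))\<^sup>2) = (\<Sum>m\<le>N. l m * (cmod (bombieri_ip N x (e m)))\<^sup>2)"
    and anti: "\<And>i j. i < j \<Longrightarrow> j \<le> N \<Longrightarrow> l j \<le> l i"
    using frame_diagonalization[where n = N and S = "S \<times> {..k}"
        and c = "\<lambda>(s, a). c s / (fact a * fact (k - a))" and q = "\<lambda>(s, a). monom 1 a * p s"] by blast
  have form: "(\<Sum>s\<in>S. c s * lift_form n k (p s) x) = (\<Sum>m\<le>N. l m * (cmod (bombieri_ip N x (e m)))\<^sup>2)" for x
  proof -
    have "(\<Sum>s\<in>S. c s * lift_form n k (p s) x) = (\<Sum>s\<in>S. \<Sum>a\<le>k. (case (s, a) of (s, a) \<Rightarrow> c s / (fact a * fact (k - a))) *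
       (cmod (bombieri_ip N x (case (s, a) of (s, a) \<Rightarrow> monom 1 a * p s)))\<^sup>2)"
      by (simp add: lift_form_def N_def sum_distrib_left)
    also have "\<dots> = (\<Sum>m\<le>N. l m * (cmod (bombieri_ip N x (e m)))\<^sup>2)"
      unfolding diag[symmetric] by (simp add: sum.cartesian_product split_def)
    finally show ?thesis .
  qed
  have l: "l m = (\<Sum>s\<in>S. c s * lift_form n k (p s) (e m))" if "m \<le> N" for m
  proof -
    have "(\<Sum>i\<le>N. l i * (cmod (bombieri_ip N (e m) (e i)))\<^sup>2) = (\<Sum>i\<le>N. if i = m then l m else 0)"
      using e(1) that by (intro sum.cong refl) (auto simp: bombieri_orthonormal_def)
    then show ?thesis using form[of "e m"] that by simp
  qed
  \<comment> \<open>The largest coherent weight, at index 0. Dividing by it puts both spectra into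
    \<open>{0..1}\<close> and makes the lower symbol of the lift equal to \<open>F\<close>
    exactly.\<close>
  define C where "C = real (N choose n)"
  have C: "C > 0" by (simp add: C_def N_def)
  define x where "x m = l m / C" for m
  define y where "y m = real (N - m choose n) / C" for m
  have y_coherent_weight: "y m = coherent_weight n k m / C" if "m \<le> N" for m
    using that by (auto simp: y_def coherent_weight_def N_def binomial_eq_0_iff)
  have partial: "(\<Sum>i<m. x i) \<le> (\<Sum>i<m. y i)" if m: "m \<le> N + 1" for m
  proof -
    have "bombieri_orthonormal N m e" using e(1) m by (simp add: bombieri_orthonormal_def)
    have "(\<Sum>i<m. l i) = (\<Sum>s\<in>S. c s * (\<Sum>i<m. lift_form n k (p s) (e i)))"
      unfolding sum_distrib_left by (subst sum.swap) (use m l in \<open>auto intro!: sum.cong\<close>)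
    also have "\<dots> \<le> (\<Sum>s\<in>S. c s * (bombieri_nsq n (p s) * (\<Sum>i<m. coherent_weight n k i)))"
      using \<open>bombieri_orthonormal N m e\<close> unfolding N_def by (intro sum_mono mult_left_mono lift_form_majorized p S)
    also have "\<dots> = (\<Sum>i<m. coherent_weight n k i)"
      using S(3) p(2) by (simp flip: sum_distrib_right)
    also have "\<dots> = C * (\<Sum>i<m. y i)"
      unfolding sum_distrib_left using m C by (intro sum.cong refl) (simp add: y_coherent_weight)
    finally show ?thesis using C by (simp add: x_def divide_le_eq mult.commute flip: sum_divide_distrib)
  qed
  have x0: "0 \<le> x m" if "m \<le> N" for m
    unfolding x_def l[OF that] using C S(2) by (intro divide_nonneg_pos sum_nonneg mult_nonneg_nonneg lift_form_nonneg)
  have y01: "y m \<in> {0..1}" for m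
    using C by (auto simp: y_def C_def divide_le_eq_1 binomial_right_mono)
  \<comment> \<open>Only partial sums of \<open>x\<close> are compared with those of
    \<open>y\<close>; as \<open>x\<close> decreases, the sum of length 1 bounds every
    eigenvalue.\<close>
  have x1: "x m \<le> 1" if "m \<le> N" for m
  proof -
    have "x m \<le> x 0" using anti[of 0 m] that C by (cases "m = 0") (auto simp: x_def divide_right_mono)
    also have "\<dots> \<le> y 0" using partial[of 1] by simp
    finally show ?thesis using y01[of 0] by simp
  qed
  \<comment> \<open>The squared inner product of \<open>e m\<close> with the unit coherent state of
    degree \<open>N\<close>: normalizing the power of the linear form cancels one of two factors
    \<open>fact N\<close>.\<close>
  define W where "W m \<omega> = fact N * (cmod (coherent_eval N (spinor_up \<omega>) (spinor_down \<omega>) (e m)))\<^sup>2" for m \<omega>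
  have W0: "0 \<le> W m \<omega>" for m \<omega> by (simp add: W_def)
  have WF: "(\<Sum>m\<le>N. W m \<omega>) = 1" "F \<omega> = (\<Sum>m\<le>N. W m \<omega> * x m)" if "\<omega> \<in> sphere 0 1" for \<omega>
  proof -
    let ?z = "spinor_up \<omega>" and ?w = "spinor_down \<omega>"
    have zw: "(cmod ?z)\<^sup>2 + (cmod ?w)\<^sup>2 = 1"
      using spinor_up_down[OF that] by (simp add: spinor_def)
    have be: "(cmod (bombieri_ip N ([:?z, ?w:] ^ N) q))\<^sup>2 = (fact N)\<^sup>2 * (cmod (coherent_eval N ?z ?w q))\<^sup>2" for q
      by (simp add: bombieri_ip_linear_power norm_mult power_mult_distrib)
    have "fact N = (\<Sum>m\<le>N. (fact N)\<^sup>2 * (cmod (coherent_eval N ?z ?w (e m)))\<^sup>2)"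
      using comp[of "[:?z, ?w:] ^ N"] unfolding be bombieri_nsq_linear_power zw by simp
    also have "\<dots> = fact N * (\<Sum>m\<le>N. W m \<omega>)"
      by (simp add: W_def sum_distrib_left power2_eq_square mult_ac)
    finally show "(\<Sum>m\<le>N. W m \<omega>) = 1" by simp
    have "(\<Sum>s\<in>S. c s * ((fact N)\<^sup>2 / fact k * (cmod (coherent_eval n ?z ?w (p s)))\<^sup>2)) =
        (\<Sum>m\<le>N. l m * ((fact N)\<^sup>2 * (cmod (coherent_eval N ?z ?w (e m)))\<^sup>2))"
    proof -
      have "(\<Sum>s\<in>S. c s * ((fact N)\<^sup>2 / fact k * (cmod (coherent_eval n ?z ?w (p s)))\<^sup>2)) =
          (\<Sum>s\<in>S. c s * lift_form n k (p s) ([:?z, ?w:] ^ N))"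
        unfolding N_def by (intro sum.cong refl) (simp add: lift_form_coherent[OF zw p(1)])
      then show ?thesis unfolding form be .
    qed
    also have "\<dots> = fact N * C * (\<Sum>m\<le>N. W m \<omega> * x m)"
      using C unfolding sum_distrib_left
      by (intro sum.cong refl) (simp add: W_def x_def power2_eq_square mult_ac)
    also have "(\<Sum>s\<in>S. c s * ((fact N)\<^sup>2 / fact k * (cmod (coherent_eval n ?z ?w (p s)))\<^sup>2)) = fact N * C * F \<omega>"
    proof -
      have "(fact N)\<^sup>2 / fact k = fact N * C * fact n"
        by (simp add: C_def N_def binomial_fact power2_eq_square)
      then show ?thesis unfolding F_def sum_distrib_left by (intro sum.cong refl) (simp add: mult_ac)
    qed
    finally show "F \<omega> = (\<Sum>m\<le>N. W m \<omega> * x m)" using C by simp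
  qed
  have IW: "integrable sphere_measure (W m)" "(LINT \<omega>|sphere_measure. W m \<omega>) = 4 * pi / real (N + 1)"
    if "m \<le> N" for m
  proof -
    show "integrable sphere_measure (W m)"
      unfolding W_def by (intro integrable_mult_right coherent_resolution(1))
    have "bombieri_nsq N (e m) = 1" using e(1) that by (intro bombieri_orthonormal_imp_bombieri_nsq) auto
    then show "(LINT \<omega>|sphere_measure. W m \<omega>) = 4 * pi / real (N + 1)"
    proof -
      assume 1: "bombieri_nsq N (e m) = 1"
      have "fact N * (4 * pi * 1 / ((real N + 1) * fact N)) = 4 * pi / (real N + 1)"
        by (simp add: divide_simps)
      then show ?thesis
        unfolding W_def by (simp add: coherent_resolution(2) 1 add.commute)
    qed
  qed
  \<comment> \<open>Equality of the traces: the symbol \<open>F\<close> is integrated once in degree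
    \<open>n\<close> and once in degree \<open>N\<close>, both times by the resolution of the
    identity.\<close>
  have "(LINT \<omega>|sphere_measure. F \<omega>) = (\<Sum>s\<in>S. c s * (fact n * (4 * pi / fact (n + 1))))"
    unfolding F_def using p(2) S(1)
    by (simp add: coherent_resolution del: fact_Suc)
  also have "fact n * (4 * pi / fact (n + 1)) = 4 * pi / real (n + 1)"
    unfolding Suc_eq_plus1[symmetric] fact_Suc by simp
  also have "(\<Sum>s\<in>S. c s * (4 * pi / real (n + 1))) = 4 * pi / real (n + 1)"
    unfolding sum_distrib_right[symmetric] S(3) by simp
  finally have F1: "(LINT \<omega>|sphere_measure. F \<omega>) = 4 * pi / real (n + 1)" .
  have "(LINT \<omega>|sphere_measure. F \<omega>) = (LINT \<omega>|sphere_measure. (\<Sum>m\<le>N. W m \<omega> * x m))"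
    by (rule Bochner_Integration.integral_cong) (use WF in auto)
  also have "\<dots> = (\<Sum>m\<le>N. 4 * pi / real (N + 1) * x m)"
    using IW by simp
  finally have *: "4 * pi / real (N + 1) * (\<Sum>m\<le>N. x m) = 4 * pi / real (n + 1)"
    unfolding F1 by (simp add: sum_distrib_left)
  have "(\<Sum>m\<le>N. x m) = real (N + 1) / (4 * pi) * (4 * pi / real (N + 1) * (\<Sum>m\<le>N. x m))"
    by simp
  also have "\<dots> = real (N + 1) / real (n + 1)"
    unfolding * by simp
  also have "\<dots> = (\<Sum>m\<le>N. y m)"
  proof -
    have "(\<Sum>m\<le>N. y m) = real (N + 1 choose (n + 1)) / C"
      using sum_coherent_weight[of n k] by (simp add: y_coherent_weight N_def flip: sum_divide_distrib)
    also have "\<dots> = real (N + 1) / real (n + 1)"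
    proof -
      have "Suc n * (Suc N choose Suc n) = Suc N * (N choose n)"
        using Suc_times_binomial_eq[of N n] by (simp only: mult.commute)
      then have "real (Suc n * (Suc N choose Suc n)) = real (Suc N * (N choose n))"
        by (rule arg_cong)
      then have "real (n + 1) * real (N + 1 choose (n + 1)) = real (N + 1) * C"
        by (simp only: of_nat_mult C_def Suc_eq_plus1)
      then show ?thesis using C by (simp add: field_simps)
    qed
    finally show ?thesis by simp
  qed
  finally have total: "(\<Sum>m<N + 1. x m) = (\<Sum>m<N + 1. y m)" by (simp add: lessThan_Suc_atMost)
  have "(\<Sum>i<N + 1. f (y i)) \<le> (\<Sum>i<N + 1. f (x i))"
  proof (rule karamata[OF f _ _ _ _ partial total])
    show "x i \<in> {0..1}" if "i < N + 1" for i using that x0[of i] x1[of i] by simp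
    show "y i \<in> {0..1}" for i by (rule y01)
    show "x j \<le> x i" if "i < j" "j < N + 1" for i j
      using anti[of i j] that C by (simp add: x_def divide_right_mono)
    show "y j \<le> y i" if "i < j" for i j
      using that C by (simp add: y_def divide_right_mono binomial_right_mono)
  qed
  then have kar: "(\<Sum>i\<le>N. f (y i)) \<le> (\<Sum>i\<le>N. f (x i))"
    by (simp only: Suc_eq_plus1[symmetric] lessThan_Suc_atMost)
  have "(\<Sum>i\<le>N. f (y i)) = (\<Sum>i\<le>N. f (real (i choose n) / C))"
    by (rule sum.reindex_bij_witness[where i = "\<lambda>i. N - i" and j = "\<lambda>i. N - i"]) (auto simp: y_def)
  then have "4 * pi / real (N + 1) * (\<Sum>i\<le>N. f (real (i choose n) / C)) \<le> 4 * pi / real (N + 1) * (\<Sum>i\<le>N. f (x i))"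
    using kar by (intro mult_left_mono) auto
  also have "\<dots> = (LINT \<omega>|sphere_measure. (\<Sum>m\<le>N. W m \<omega> * f (x m)))"
    using IW by (simp add: sum_distrib_left)
  also have "\<dots> \<le> (LINT \<omega>|sphere_measure. f (F \<omega>))"
  proof (rule integral_mono)
    show "integrable sphere_measure (\<lambda>\<omega>. \<Sum>m\<le>N. W m \<omega> * f (x m))"
      using IW(1) by (intro Bochner_Integration.integrable_sum integrable_mult_left) auto
    show "integrable sphere_measure (\<lambda>\<omega>. f (F \<omega>))" using int unfolding F_def .
    show "(\<Sum>m\<le>N. W m \<omega> * f (x m)) \<le> f (F \<omega>)" if "\<omega> \<in> space sphere_measure" for \<omega>
    proof -
      have \<omega>: "\<omega> \<in> sphere 0 1" using that by simp
      show ?thesis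
        unfolding WF(2)[OF \<omega>]
        using concave_on_sum[of "{..N}" "{0..1}" f "\<lambda>m. W m \<omega>" x] f WF(1)[OF \<omega>] W0 x0 x1 by simp
    qed
  qed
  finally show ?thesis unfolding F_def C_def N_def by simp
qed

subsection \<open>Bloch coherent states and density matrices\<close>

lemma scalar_prod_conjugate:
  assumes "u \<in> carrier_vec d" "v \<in> carrier_vec d"
  shows "u \<bullet>c v = (\<Sum>i<d. u $ i * cnj (v $ i))"
  using assms by (auto simp: scalar_prod_def atLeast0LessThan intro!: sum.cong)

lemma scalar_prod_coord_poly:
  assumes "u \<in> carrier_vec (n + 1)" "v \<in> carrier_vec (n + 1)"
  shows "u \<bullet>c v = bombieri_ip n (coord_poly n (($) v)) (coord_poly n (($) u))"
  unfolding scalar_prod_conjugate[OF assms] bombieri_ip_coord_poly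
  by (simp add: mult.commute lessThan_Suc_atMost del: sum.lessThan_Suc)

lemma spin_dot_mult_vec_index:
  fixes \<omega> :: "real ^ 3" and v :: "complex Matrix.vec"
  assumes i: "i \<le> n" and v: "v \<in> carrier_vec (n + 1)"
  defines "\<alpha> \<equiv> Complex (\<omega> $ 1) (\<omega> $ 2)"
    and "b \<equiv> \<lambda>k. complex_of_real (sqrt (real k * (real n + 1 - real k)))"
  shows "(spin_dot n \<omega> *\<^sub>v v) $ i = (if i < n then cnj \<alpha> / 2 * b (i + 1) * v $ (i + 1) else 0)
     + (if 1 \<le> i then \<alpha> / 2 * b i * v $ (i - 1) else 0)
     + of_real (\<omega> $ 3) * (of_nat n / 2 - of_nat i) * v $ i"
proof -
  have \<alpha>: "\<alpha> = of_real (\<omega> $ 1) + \<i> * of_real (\<omega> $ 2)" "cnj \<alpha> = of_real (\<omega> $ 1) - \<i> * of_real (\<omega> $ 2)"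
    by (simp_all add: \<alpha>_def complex_eq_iff)
  have carrier: "spin_dot n \<omega> \<in> carrier_mat (n + 1) (n + 1)"
    unfolding spin_dot_def by (intro add_carrier_mat smult_carrier_mat spin_x_carrier spin_y_carrier spin_z_carrier)
  have entry: "spin_dot n \<omega> $$ (i, k) = (if k = i + 1 then cnj \<alpha> / 2 * b k else 0)
      + (if k = i - 1 \<and> 1 \<le> i then \<alpha> / 2 * b i else 0)
      + (if k = i then of_real (\<omega> $ 3) * (of_nat n / 2 - of_nat i) else 0)" if "k < n + 1" for k
    using that i unfolding spin_dot_def \<alpha>
    by (auto simp: spin_x_eq spin_y_eq spin_z_def b_def algebra_simps add_divide_distrib diff_divide_distrib)
  have "(spin_dot n \<omega> *\<^sub>v v) $ i = (\<Sum>k<n + 1. spin_dot n \<omega> $$ (i, k) * v $ k)"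
    using i v carrier by (auto simp: scalar_prod_def atLeast0LessThan intro!: sum.cong)
  also have "\<dots> = (\<Sum>k<n + 1. (if k = i + 1 then cnj \<alpha> / 2 * b (i + 1) * v $ (i + 1) else 0)
      + (if k = i - 1 then (if 1 \<le> i then \<alpha> / 2 * b i * v $ (i - 1) else 0) else 0)
      + (if k = i then of_real (\<omega> $ 3) * (of_nat n / 2 - of_nat i) * v $ i else 0))"
    by (intro sum.cong refl) (auto simp: entry distrib_right)
  also have "\<dots> = (if i < n then cnj \<alpha> / 2 * b (i + 1) * v $ (i + 1) else 0)
     + (if 1 \<le> i then \<alpha> / 2 * b i * v $ (i - 1) else 0)
     + of_real (\<omega> $ 3) * (of_nat n / 2 - of_nat i) * v $ i"
    using i by (simp add: sum.distrib del: sum.lessThan_Suc) arith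
  finally show ?thesis .
qed

text \<open>In the rescaled coordinates the square roots of the ladder operators disappear, leaving
  the integer factors of first-order differential operators on forms.\<close>

lemma coord_weight_Suc:
  assumes "i < n"
  shows "sqrt (real (i + 1) * (real n + 1 - real (i + 1))) * coord_weight n (i + 1) = real (i + 1) * coord_weight n i"
    and "sqrt (real (i + 1) * (real n + 1 - real (i + 1))) * coord_weight n i = real (n - i) * coord_weight n (i + 1)"
proof -
  obtain m where n: "n = i + Suc m" using assms less_iff_Suc_add by auto
  have "real (i + 1) * (real n + 1 - real (i + 1)) * (fact (i + 1) * fact (n - (i + 1))) =
      (real (i + 1))\<^sup>2 * (fact i * fact (n - i))"
    by (simp add: n power2_eq_square algebra_simps)
  from arg_cong[OF this, of sqrt]
  show "sqrt (real (i + 1) * (real n + 1 - real (i + 1))) * coord_weight n (i + 1) = real (i + 1) * coord_weight n i"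
    unfolding coord_weight_def real_sqrt_mult real_sqrt_abs by simp
  have "real (i + 1) * (real n + 1 - real (i + 1)) * (fact i * fact (n - i)) =
      (real (n - i))\<^sup>2 * (fact (i + 1) * fact (n - (i + 1)))"
    by (simp add: n power2_eq_square algebra_simps)
  from arg_cong[OF this, of sqrt]
  show "sqrt (real (i + 1) * (real n + 1 - real (i + 1))) * coord_weight n i = real (n - i) * coord_weight n (i + 1)"
    unfolding coord_weight_def real_sqrt_mult real_sqrt_abs by simp
qed

text \<open>
  In the polynomial picture the eigenvalue equation says that \<open>z * g' - w * (n * g - x * g')\<close>
  vanishes, which characterizes the multiples of \<open>(z + w x)^n\<close>.
\<close>

lemma coherent_state_recurrence:
  fixes g :: "complex poly" and z w :: complex
  assumes zw: "z * cnj z + w * cnj w = 1"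
    and g: "degree g \<le> n"
    and eq: "\<And>i. i \<le> n \<Longrightarrow> z * cnj w * (of_nat (i + 1) * coeff g (i + 1))
        + cnj z * w * (if 1 \<le> i then of_nat (n + 1 - i) * coeff g (i - 1) else 0)
        + (z * cnj z - w * cnj w) * (of_nat n / 2 - of_nat i) * coeff g i = of_nat n / 2 * coeff g i"
  shows "\<exists>c. g = smult c ([:z, w:] ^ n)"
proof -
  define d where "d i = z * of_nat (i + 1) * coeff g (i + 1) - w * (of_nat n - of_nat i) * coeff g i" for i
  let ?X = "\<lambda>i. z * cnj w * (of_nat (i + 1) * coeff g (i + 1))
        + cnj z * w * (if 1 \<le> i then of_nat (n + 1 - i) * coeff g (i - 1) else 0)"
  have eq': "?X i = (of_nat i * (z * cnj z) + (of_nat n - of_nat i) * (w * cnj w)) * coeff g i" if "i \<le> n" for i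
  proof -
    have "?X i = of_nat n / 2 * (z * cnj z + w * cnj w) * coeff g i
        - (z * cnj z - w * cnj w) * (of_nat n / 2 - of_nat i) * coeff g i"
      unfolding eq_diff_eq using eq[OF that] by (simp only: zw mult_1_right)
    also have "\<dots> = (of_nat i * (z * cnj z) + (of_nat n - of_nat i) * (w * cnj w)) * coeff g i"
      by (simp add: field_simps)
    finally show ?thesis .
  qed
  \<comment> \<open>The three-term equation factors into
    \<open>cnj w * d i = cnj z * d (i - 1)\<close>, with 0 on the right for \<open>i = 0\<close>.
    Hence the \<open>d i\<close> vanish one after another, or at once if
    \<open>w = 0\<close>.\<close>
  have d0: "cnj w * d 0 = 0" using eq'[of 0] by (simp add: d_def algebra_simps)
  have dS: "cnj w * d (Suc i) = cnj z * d i" if "Suc i \<le> n" for i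
    using eq'[OF that] that by (simp add: d_def algebra_simps of_nat_diff)
  have d: "d i = 0" if "i < n" for i
  proof (cases "w = 0")
    case True
    then have "z \<noteq> 0" using zw by auto
    then show ?thesis using dS[of i] that True by simp
  next
    case False
    from that show ?thesis
    proof (induction i)
      case 0
      then show ?case using d0 False by simp
    next
      case (Suc i)
      then show ?case using dS[of i] False by simp
    qed
  qed
  have rec: "z * of_nat (i + 1) * coeff g (i + 1) = w * (of_nat n - of_nat i) * coeff g i" if "i < n" for i
    using d[OF that] by (simp add: d_def)
  have hi: "coeff g i = 0" "coeff ([:z, w:] ^ n) i = 0" if "i > n" for i
  proof -
    show "coeff g i = 0" using g that by (intro coeff_eq_0) simp
    have "degree ([:z, w:] ^ n) \<le> n"
      using degree_power_le[of "[:z, w:]" n] by (auto intro: order_trans split: if_splits)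
    then show "coeff ([:z, w:] ^ n) i = 0" using that by (intro coeff_eq_0) simp
  qed
  show ?thesis
  proof (cases "z = 0")
    case True
    then have w: "w \<noteq> 0" using zw by auto
    \<comment> \<open>For \<open>z = 0\<close>, the south pole, the recurrence kills all
      coefficients but the last, so the multiple is read off at index \<open>n\<close> instead of
      index 0.\<close>
    have "coeff g i = 0" if "i < n" for i
      using rec[OF that] that True w by auto
    then have "coeff g i = coeff (smult (coeff g n / w ^ n) ([:z, w:] ^ n)) i" for i
      using True w hi[of i] by (cases i n rule: linorder_cases) (auto simp: coeff_linear_poly_power)
    then show ?thesis by (intro exI poly_eqI)
  next
    case False
    have pw: "z ^ i * coeff g i = of_nat (n choose i) * w ^ i * coeff g 0" if "i \<le> n" for i
      using that
    proof (induction i)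
      case (Suc i)
      have "Suc i * (n choose Suc i) = (n - i) * (n choose i)"
        by (simp only: binomial_absorption binomial_absorb_comp)
      then have b: "of_nat (Suc i) * complex_of_nat (n choose Suc i) = (of_nat n - of_nat i) * of_nat (n choose i)"
        using Suc.prems by (metis Suc_leD of_nat_diff of_nat_mult)
      have "of_nat (Suc i) * (z ^ Suc i * coeff g (Suc i)) = z ^ i * (z * of_nat (i + 1) * coeff g (i + 1))"
        by (simp add: mult_ac)
      also have "\<dots> = w * (of_nat n - of_nat i) * (z ^ i * coeff g i)"
        using rec[of i] Suc.prems by (simp add: mult_ac)
      also have "\<dots> = ((of_nat n - of_nat i) * of_nat (n choose i)) * w ^ Suc i * coeff g 0"
        using Suc by (simp add: mult_ac)
      also have "\<dots> = of_nat (Suc i) * (of_nat (n choose Suc i) * w ^ Suc i * coeff g 0)"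
        unfolding b[symmetric] by (simp only: mult_ac)
      finally show ?case by (simp only: mult_cancel_left of_nat_eq_0_iff) simp
    qed simp
    have "coeff g i = coeff (smult (coeff g 0 / z ^ n) ([:z, w:] ^ n)) i" for i
    proof (cases "i \<le> n")
      case True
      have "z ^ n = z ^ i * z ^ (n - i)" using True by (simp flip: power_add)
      then show ?thesis using pw[OF True] False True
        by (simp add: coeff_linear_poly_power field_simps)
    qed (use hi in auto)
    then show ?thesis by (intro exI poly_eqI)
  qed
qed

text \<open>The eigenspace is one-dimensional, so the phase of \<open>v\<close> is absorbed in
  \<open>c\<close>, and the unit norm fixes its modulus.\<close>

lemma bloch_coherent_state_coord_poly:
  assumes sp: "spinor \<omega> z w" and bl: "bloch_coherent_state n \<omega> v"
  shows "\<exists>c. coord_poly n (($) v) = smult c ([:z, w:] ^ n) \<and> (cmod c)\<^sup>2 * fact n = 1"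
proof -
  define g where "g = coord_poly n (($) v)"
  from bl have v: "v \<in> carrier_vec (n + 1)" "v \<bullet>c v = 1"
    and ev: "spin_dot n \<omega> *\<^sub>v v = complex_of_real (real n / 2) \<cdot>\<^sub>v v"
    by (auto simp: bloch_coherent_state_def)
  have "complex_of_real ((cmod z)\<^sup>2 + (cmod w)\<^sup>2) = of_real 1"
    using sp by (simp only: spinor_def)
  then have zw: "z * cnj z + w * cnj w = 1"
    by (simp only: of_real_add complex_norm_square of_real_1)
  have "complex_of_real (\<omega> $ 3) = of_real ((cmod z)\<^sup>2 - (cmod w)\<^sup>2)"
    using sp by (simp only: spinor_def)
  then have w3: "complex_of_real (\<omega> $ 3) = z * cnj z - w * cnj w"
    by (simp only: of_real_diff complex_norm_square)
  have \<alpha>: "Complex (\<omega> $ 1) (\<omega> $ 2) = 2 * cnj z * w" using sp by (simp add: spinor_def)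
  have vg: "v $ i = of_real (coord_weight n i) * coeff g i" if "i \<le> n" for i
    using coord_weight_coeff_coord_poly[OF that, of "($) v"] by (simp add: g_def)
  have "\<exists>c. g = smult c ([:z, w:] ^ n)"
  proof (rule coherent_state_recurrence[OF zw])
    show "degree g \<le> n" by (simp add: g_def degree_coord_poly)
    fix i assume i: "i \<le> n"
    have up: "of_real (sqrt (real (i + 1) * (real n + 1 - real (i + 1)))) * v $ (i + 1) =
        of_real (coord_weight n i) * (of_nat (i + 1) * coeff g (i + 1))" if "i < n"
    proof -
      have "of_real (sqrt (real (i + 1) * (real n + 1 - real (i + 1)))) * v $ (i + 1) =
          complex_of_real (sqrt (real (i + 1) * (real n + 1 - real (i + 1))) * coord_weight n (i + 1)) * coeff g (i + 1)"
        using that by (subst vg) (simp, simp only: of_real_mult mult.assoc)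
      then show ?thesis unfolding coord_weight_Suc(1)[OF that] by (simp add: mult_ac)
    qed
    have down: "of_real (sqrt (real i * (real n + 1 - real i))) * v $ (i - 1) =
        of_real (coord_weight n i) * (of_nat (n + 1 - i) * coeff g (i - 1))" if "1 \<le> i"
    proof -
      obtain j where j: "i = j + 1" using \<open>1 \<le> i\<close> by (metis le_add_diff_inverse2)
      have "of_real (sqrt (real i * (real n + 1 - real i))) * v $ (i - 1) =
          complex_of_real (sqrt (real (j + 1) * (real n + 1 - real (j + 1))) * coord_weight n j) * coeff g j"
        using i j by (subst vg) (simp_all add: mult_ac)
      then show ?thesis using i unfolding j by (subst (asm) coord_weight_Suc(2)) (simp_all add: mult_ac)
    qed
    have gz: "coeff g (i + 1) = 0" if "\<not> i < n"
      using that by (simp add: g_def coeff_coord_poly)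
    have "of_real (coord_weight n i) * (z * cnj w * (of_nat (i + 1) * coeff g (i + 1))
        + cnj z * w * (if 1 \<le> i then of_nat (n + 1 - i) * coeff g (i - 1) else 0)
        + (z * cnj z - w * cnj w) * (of_nat n / 2 - of_nat i) * coeff g i)
      = (spin_dot n \<omega> *\<^sub>v v) $ i"
      unfolding spin_dot_mult_vec_index[OF i v(1)] \<alpha> w3 vg[OF i]
      using up down gz by (cases "i < n"; cases "1 \<le> i") (auto simp: distrib_left mult_ac)
    also have "\<dots> = of_real (coord_weight n i) * (of_nat n / 2 * coeff g i)"
      unfolding ev using i v(1) by (simp add: vg mult_ac)
    finally show "z * cnj w * (of_nat (i + 1) * coeff g (i + 1))
        + cnj z * w * (if 1 \<le> i then of_nat (n + 1 - i) * coeff g (i - 1) else 0)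
        + (z * cnj z - w * cnj w) * (of_nat n / 2 - of_nat i) * coeff g i = of_nat n / 2 * coeff g i"
      using coord_weight(1)[of n i] by (simp only: mult_cancel_left of_real_eq_0_iff) simp
  qed
  then obtain c where c: "g = smult c ([:z, w:] ^ n)" by blast
  have "complex_of_real (bombieri_nsq n g) = of_real 1"
    using v(2) unfolding scalar_prod_coord_poly[OF v(1) v(1)] bombieri_ip_self g_def of_real_1 .
  then have "bombieri_nsq n g = 1" by (simp only: of_real_eq_iff)
  then have "(cmod c)\<^sup>2 * fact n = 1"
    using sp unfolding c bombieri_nsq_smult bombieri_nsq_linear_power by (simp add: spinor_def)
  then show ?thesis using c unfolding g_def by blast
qed

lemma bloch_coherent_state_bombieri_ip:
  assumes "spinor \<omega> z w" "bloch_coherent_state n \<omega> v"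
  shows "(cmod (bombieri_ip n (coord_poly n (($) v)) p))\<^sup>2 = fact n * (cmod (coherent_eval n z w p))\<^sup>2"
proof -
  obtain c where c: "coord_poly n (($) v) = smult c ([:z, w:] ^ n)" "(cmod c)\<^sup>2 * fact n = 1"
    using bloch_coherent_state_coord_poly[OF assms] by blast
  have "(cmod (bombieri_ip n (coord_poly n (($) v)) p))\<^sup>2 = ((cmod c)\<^sup>2 * fact n) * (fact n * (cmod (coherent_eval n z w p))\<^sup>2)"
    unfolding c(1) bombieri_ip_smult_left bombieri_ip_linear_power
    by (simp add: norm_mult power_mult_distrib power2_eq_square mult_ac)
  then show ?thesis using c(2) by simp
qed

text \<open>The eigenvectors of \<rho> become unit polynomials. Testing \<rho> on them makes the
  eigenvalues nonnegative, and trace one makes the mixture convex.\<close>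

lemma density_matrix_decomposition:
  assumes \<rho>: "density_matrix (n + 1) \<rho>"
  shows "\<exists>c p. (\<forall>k\<le>n. 0 \<le> c k) \<and> (\<Sum>k\<le>n. c k) = 1 \<and> (\<forall>k\<le>n. degree (p k) \<le> n) \<and>
    (\<forall>k\<le>n. bombieri_nsq n (p k) = 1) \<and> (\<forall>v\<in>carrier_vec (n + 1).
      (\<rho> *\<^sub>v v) \<bullet>c v = complex_of_real (\<Sum>k\<le>n. c k * (cmod (bombieri_ip n (coord_poly n (($) v)) (p k)))\<^sup>2))"
proof -
  have carrier: "\<rho> \<in> carrier_mat (n + 1) (n + 1)" and adj: "mat_adjoint \<rho> = \<rho>"
    and psd: "\<And>v. v \<in> carrier_vec (n + 1) \<Longrightarrow> 0 \<le> (\<rho> *\<^sub>v v) \<bullet>c v"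
    and tr: "(\<Sum>i\<le>n. \<rho> $$ (i, i)) = 1"
    using \<rho> by (auto simp: density_matrix_def lessThan_Suc_atMost simp del: sum.lessThan_Suc)
  define a where "a i j = (if i \<le> n \<and> j \<le> n then \<rho> $$ (i, j) else 0)" for i j
  have herm: "a i j = cnj (a j i)" for i j
    using mat_adjoint_index[OF carrier, of i j] adj by (simp add: a_def)
  from hermitian_diagonalization[of "Suc n" a, OF herm, unfolded lessThan_Suc_atMost less_Suc_eq_le]
  obtain u l where
        on: "\<forall>k\<le>n. \<forall>m\<le>n. (\<Sum>i\<le>n. u k i * cnj (u m i)) = (if k = m then 1 else 0)"
    and "\<forall>i\<le>n. \<forall>j\<le>n. a i j = (\<Sum>k\<le>n. of_real (l k) * (u k i * cnj (u k j)))"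
    by (elim exE conjE)
  then have diag: "\<rho> $$ (i, j) = (\<Sum>k\<le>n. of_real (l k) * (u k i * cnj (u k j)))" if "i \<le> n" "j \<le> n" for i j
    using that by (simp add: a_def)
  define p where "p k = coord_poly n (u k)" for k
  have quad: "(\<rho> *\<^sub>v v) \<bullet>c v = complex_of_real (\<Sum>k\<le>n. l k * (cmod (bombieri_ip n (coord_poly n (($) v)) (p k)))\<^sup>2)"
    if v: "v \<in> carrier_vec (n + 1)" for v
  proof -
    have "(\<rho> *\<^sub>v v) \<bullet>c v = (\<Sum>i\<le>n. (\<Sum>j\<le>n. \<rho> $$ (i, j) * v $ j) * cnj (v $ i))"
      using carrier v
      by (subst scalar_prod_conjugate[of _ "n + 1"])
        (auto simp: scalar_prod_def atLeast0LessThan lessThan_Suc_atMost simp del: sum.lessThan_Suc intro!: sum.cong)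
    also have "\<dots> = (\<Sum>i\<le>n. \<Sum>j\<le>n. cnj (v $ i) * cnj (cnj (v $ j)) * (\<Sum>k\<le>n. of_real (l k) * (u k i * cnj (u k j))))"
      unfolding sum_distrib_right by (intro sum.cong refl) (simp add: diag mult_ac)
    also have "\<dots> = complex_of_real (\<Sum>k\<le>n. l k * (cmod (\<Sum>i\<le>n. cnj (v $ i) * u k i))\<^sup>2)"
      by (simp only: quadratic_form_expand)
    finally show ?thesis unfolding p_def bombieri_ip_coord_poly .
  qed
  have ortho: "bombieri_ip n (p m) (p k) = (if k = m then 1 else 0)" if "k \<le> n" "m \<le> n" for k m
    using on that unfolding p_def bombieri_ip_coord_poly by (simp add: mult.commute)
  have l0: "0 \<le> l k" if k: "k \<le> n" for k
  proof -
    define v where "v = Matrix.vec (n + 1) (u k)"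
    have "coord_poly n (($) v) = p k" unfolding p_def coord_poly_def by (intro sum.cong refl) (simp add: v_def)
    moreover have "(\<Sum>m\<le>n. l m * (cmod (bombieri_ip n (p k) (p m)))\<^sup>2) = (\<Sum>m\<le>n. if m = k then l k else 0)"
      using k by (intro sum.cong refl) (auto simp: ortho)
    ultimately have "(\<rho> *\<^sub>v v) \<bullet>c v = of_real (l k)"
      using k by (subst quad) (simp_all add: v_def)
    moreover have "0 \<le> (\<rho> *\<^sub>v v) \<bullet>c v" by (rule psd) (simp add: v_def)
    ultimately show ?thesis by (simp add: less_eq_complex_def)
  qed
  have "complex_of_real (\<Sum>k\<le>n. l k) = (\<Sum>k\<le>n. of_real (l k) * (\<Sum>i\<le>n. u k i * cnj (u k i)))"
    by (simp add: on)
  also have "\<dots> = (\<Sum>i\<le>n. \<rho> $$ (i, i))"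
    unfolding sum_distrib_left by (subst sum.swap) (simp add: diag)
  finally have "(\<Sum>k\<le>n. l k) = 1" unfolding tr by (metis of_real_1 of_real_eq_iff)
  moreover have "bombieri_nsq n (p k) = 1" if "k \<le> n" for k
    using ortho[OF that that] unfolding bombieri_ip_self by simp
  moreover have "degree (p k) \<le> n" for k by (simp add: p_def degree_coord_poly)
  ultimately show ?thesis using l0 quad by (intro exI[of _ l] exI[of _ p]) blast
qed

subsection \<open>The Wehrl integral of a coherent state\<close>

text \<open>The coherent overlap for spin 1/2; its power \<open>n\<close> is the overlap in degree
  \<open>n\<close>.\<close>

definition overlap :: "complex \<Rightarrow> complex \<Rightarrow> real ^ 3 \<Rightarrow> real" where
  "overlap z w \<omega> = (cmod (z * cnj (spinor_up \<omega>) + w * cnj (spinor_down \<omega>)))\<^sup>2"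

lemma overlap_power:
  "overlap z w \<omega> ^ m = (cmod (coherent_eval m (spinor_up \<omega>) (spinor_down \<omega>) ([:z, w:] ^ m)))\<^sup>2"
  unfolding overlap_def coherent_eval_linear_power by (simp add: norm_power flip: power_mult) (simp add: mult.commute)

text \<open>Cauchy-Schwarz in degree 1, obtained as Bessel's inequality for a single unit
  vector.\<close>

lemma overlap_bounds:
  assumes "(cmod z)\<^sup>2 + (cmod w)\<^sup>2 = 1" "\<omega> \<in> sphere 0 1"
  shows "overlap z w \<omega> \<in> {0..1}"
proof -
  have s: "(cmod (spinor_up \<omega>))\<^sup>2 + (cmod (spinor_down \<omega>))\<^sup>2 = 1"
    using spinor_up_down[OF assms(2)] by (simp add: spinor_def)
  let ?e = "[:spinor_up \<omega>, spinor_down \<omega>:] ^ 1"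
  have "bombieri_nsq 1 ?e = 1" unfolding bombieri_nsq_linear_power s by simp
  then have "bombieri_ip 1 ?e ?e = 1" unfolding bombieri_ip_self by simp
  then have "bombieri_orthonormal 1 1 (\<lambda>_. ?e)" by (simp add: bombieri_orthonormal_def)
  from bessel[OF this, of "[:z, w:] ^ 1"] have "overlap z w \<omega> \<le> bombieri_nsq 1 ([:z, w:] ^ 1)"
    unfolding bombieri_ip_linear_power coherent_eval_linear_power by (simp add: overlap_def)
  also have "\<dots> = 1" unfolding bombieri_nsq_linear_power assms(1) by simp
  finally show ?thesis by (simp add: overlap_def)
qed

text \<open>Archimedes' theorem in terms of moments: seen from any base point the overlap is
  uniformly distributed on the unit interval, so these are beta integrals times
  \<open>4 * pi\<close>. For \<open>j = 0\<close> this is the resolution of the identity applied to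
  a coherent state of degree \<open>i\<close>; factors \<open>1 - t\<close> are then split off by
  differences.\<close>

lemma overlap_beta:
  assumes zw: "(cmod z)\<^sup>2 + (cmod w)\<^sup>2 = 1"
  shows "integrable sphere_measure (\<lambda>\<omega>. overlap z w \<omega> ^ i * (1 - overlap z w \<omega>) ^ j) \<and>
    (LINT \<omega>|sphere_measure. overlap z w \<omega> ^ i * (1 - overlap z w \<omega>) ^ j) =
      4 * pi * fact i * fact j / fact (i + j + 1)"
proof (induction j arbitrary: i)
  case 0
  show ?case
    using coherent_resolution[of i "[:z, w:] ^ i"] unfolding overlap_power[symmetric] bombieri_nsq_linear_power zw
    by simp
next
  case (Suc j)
  let ?t = "overlap z w"
  have split: "?t \<omega> ^ i * (1 - ?t \<omega>) ^ Suc j = ?t \<omega> ^ i * (1 - ?t \<omega>) ^ j - ?t \<omega> ^ Suc i * (1 - ?t \<omega>) ^ j" for \<omega>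
    by (simp add: algebra_simps)
  have I: "integrable sphere_measure (\<lambda>\<omega>. ?t \<omega> ^ i * (1 - ?t \<omega>) ^ j)"
    "integrable sphere_measure (\<lambda>\<omega>. ?t \<omega> ^ Suc i * (1 - ?t \<omega>) ^ j)"
    using Suc.IH[of i] Suc.IH[of "Suc i"] by blast+
  have "integrable sphere_measure (\<lambda>\<omega>. ?t \<omega> ^ i * (1 - ?t \<omega>) ^ Suc j)"
    unfolding split using I by (rule Bochner_Integration.integrable_diff)
  moreover have "(LINT \<omega>|sphere_measure. ?t \<omega> ^ i * (1 - ?t \<omega>) ^ Suc j) =
      4 * pi * fact i * fact j / fact (i + j + 1) - 4 * pi * fact (Suc i) * fact j / fact (Suc i + j + 1)"
    unfolding split Bochner_Integration.integral_diff[OF I] using Suc.IH[of i] Suc.IH[of "Suc i"] by presburger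
  moreover have "4 * pi * fact i * fact j / fact (i + j + 1) - 4 * pi * fact (Suc i) * fact j / fact (Suc i + j + 1)
      = 4 * pi * fact i * fact (Suc j) / fact (i + Suc j + 1)"
  proof -
    have "4 * pi * P * Q / F - 4 * pi * ((real i + 1) * P) * Q / ((real i + real j + 2) * F) =
        4 * pi * P * ((real j + 1) * Q) / ((real i + real j + 2) * F)" if "F \<noteq> 0" for P Q F :: real
      using that by (simp add: divide_simps) (simp add: algebra_simps)
    from this[of "fact (i + j + 1)" "fact i" "fact j"] show ?thesis
      by (simp add: add_ac)
  qed
  ultimately show ?case by metis
qed

text \<open>The common value \<open>4 * pi / (N + 1)\<close> is the weight in
  \<open>coherent_integral_ge_trace\<close>, so the trace there is exactly the integral of a
  Bernstein sum in the overlap.\<close>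

lemma overlap_Bernstein:
  assumes "(cmod z)\<^sup>2 + (cmod w)\<^sup>2 = 1" "i \<le> N"
  shows "integrable sphere_measure (\<lambda>\<omega>. Bernstein N i (overlap z w \<omega>))"
    and "(LINT \<omega>|sphere_measure. Bernstein N i (overlap z w \<omega>)) = 4 * pi / real (N + 1)"
proof -
  note b = overlap_beta[OF assms(1), of i "N - i"]
  show "integrable sphere_measure (\<lambda>\<omega>. Bernstein N i (overlap z w \<omega>))"
    unfolding Bernstein_def mult.assoc using b by (intro integrable_mult_right) blast
  have "(LINT \<omega>|sphere_measure. Bernstein N i (overlap z w \<omega>)) =
      real (N choose i) * (4 * pi * fact i * fact (N - i) / fact (N + 1))"
    unfolding Bernstein_def mult.assoc using b assms(2) by (simp del: fact_Suc)
  also have "\<dots> = 4 * pi / real (N + 1)"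
    unfolding Suc_eq_plus1[symmetric] fact_Suc binomial_fact[OF assms(2)] by simp
  finally show "(LINT \<omega>|sphere_measure. Bernstein N i (overlap z w \<omega>)) = 4 * pi / real (N + 1)" .
qed

lemma overlap_measurable [measurable]: "overlap z w \<in> borel_measurable sphere_measure"
proof -
  have "(\<lambda>\<omega>. (cmod (coherent_eval 1 (spinor_up \<omega>) (spinor_down \<omega>) ([:z, w:] ^ 1)))\<^sup>2) \<in> borel_measurable sphere_measure"
    by measurable
  then show ?thesis unfolding overlap_power[symmetric] by simp
qed

section \<open>Integrability and the limit of the traces\<close>

lemma finite_sphere_measure: "finite_measure sphere_measure"
  by (rule finite_measureI) (simp add: emeasure_sphere_measure)

lemma integrable_concave_unit:
  fixes f :: "real \<Rightarrow> real"
  assumes f: "concave_on {0..1} f" and g: "g \<in> borel_measurable sphere_measure"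
    and g01: "\<And>\<omega>. \<omega> \<in> sphere 0 1 \<Longrightarrow> g \<omega> \<in> {0..1}"
  shows "integrable sphere_measure (\<lambda>\<omega>. f (g \<omega>))"
proof -
  obtain M where M: "\<And>x. x \<in> {0..1} \<Longrightarrow> \<bar>f x\<bar> \<le> M"
    using concave_on_unit_bounded[OF f] by blast
  show ?thesis
    by (rule finite_measure.integrable_const_bound[OF finite_sphere_measure, of _ M])
      (use M g01 in \<open>auto intro!: AE_I2 borel_measurable_concave_unit[OF f g]\<close>)
qed

text \<open>Dominated convergence: the Bernstein weights form a probability vector, so a bound
  \<open>M\<close> for \<open>f\<close> bounds every sum \<open>?s N\<close>.\<close>

lemma overlap_integral_limit:
  assumes f: "concave_on {0..1} f" and zw: "(cmod z)\<^sup>2 + (cmod w)\<^sup>2 = 1"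
  shows "(\<lambda>N. 4 * pi / real (N + 1) * (\<Sum>i\<le>N. f (real (i choose n) / real (N choose n))))
    \<longlonglongrightarrow> (LINT \<omega>|sphere_measure. f (overlap z w \<omega> ^ n))"
proof -
  let ?h = "\<lambda>N i. f (real (i choose n) / real (N choose n))"
  let ?s = "\<lambda>N \<omega>. \<Sum>i\<le>N. ?h N i * Bernstein N i (overlap z w \<omega>)"
  obtain M where M: "\<And>x. x \<in> {0..1} \<Longrightarrow> \<bar>f x\<bar> \<le> M"
    using concave_on_unit_bounded[OF f] by blast
  have t: "overlap z w \<omega> \<in> {0..1}" if "\<omega> \<in> sphere 0 1" for \<omega> by (rule overlap_bounds[OF zw that])
  have pw: "overlap z w \<omega> ^ n \<in> {0..1}" if "\<omega> \<in> sphere 0 1" for \<omega>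
    using t[OF that] by (auto simp: power_le_one)
  have int: "integrable sphere_measure (?s N)" for N
    by (intro Bochner_Integration.integrable_sum integrable_mult_right overlap_Bernstein zw) auto
  have val: "(LINT \<omega>|sphere_measure. ?s N \<omega>) = 4 * pi / real (N + 1) * (\<Sum>i\<le>N. ?h N i)" for N
    using overlap_Bernstein[OF zw] by (simp add: sum_distrib_left mult.commute)
  have "(\<lambda>N. LINT \<omega>|sphere_measure. ?s N \<omega>) \<longlonglongrightarrow> (LINT \<omega>|sphere_measure. f (overlap z w \<omega> ^ n))"
  proof (rule integral_dominated_convergence)
    show "(\<lambda>\<omega>. f (overlap z w \<omega> ^ n)) \<in> borel_measurable sphere_measure"
      by (rule borel_measurable_integrable, rule integrable_concave_unit[OF f]) (use pw in auto)
    show "?s N \<in> borel_measurable sphere_measure" for N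
      using int by (rule borel_measurable_integrable)
    show "integrable sphere_measure (\<lambda>_. M)"
      by (rule finite_measure.integrable_const[OF finite_sphere_measure])
    show "AE \<omega> in sphere_measure. (\<lambda>N. ?s N \<omega>) \<longlonglongrightarrow> f (overlap z w \<omega> ^ n)"
      by (intro AE_I2 Bernstein_binomial_tendsto f t) simp
    show "AE \<omega> in sphere_measure. norm (?s N \<omega>) \<le> M" for N
    proof (intro AE_I2)
      fix \<omega> assume "\<omega> \<in> space sphere_measure"
      then have B: "0 \<le> Bernstein N i (overlap z w \<omega>)" for i
        using t[of \<omega>] by (simp add: Bernstein_nonneg)
      have "norm (?s N \<omega>) \<le> (\<Sum>i\<le>N. \<bar>?h N i\<bar> * Bernstein N i (overlap z w \<omega>))"
        using sum_abs[of "\<lambda>i. ?h N i * Bernstein N i (overlap z w \<omega>)" "{..N}"] B by (simp add: abs_mult)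
      also have "\<dots> \<le> (\<Sum>i\<le>N. M * Bernstein N i (overlap z w \<omega>))"
        by (intro sum_mono mult_right_mono M B) (auto simp: divide_le_eq_1 binomial_right_mono)
      also have "\<dots> = M" by (simp flip: sum_distrib_left)
      finally show "norm (?s N \<omega>) \<le> M" .
    qed
  qed
  then show ?thesis unfolding val .
qed

theorem theorem2p1:
  fixes n :: nat and J :: real and f :: "real \<Rightarrow> real" and \<rho> :: "complex mat"
    and \<psi> :: "real ^ 3 \<Rightarrow> complex Matrix.vec"
  assumes J: "J = real n / 2"
    and f: "concave_on {0..1} f"
    and \<rho>: "density_matrix (n + 1) \<rho>"
    and \<psi>: "\<And>\<omega>. \<omega> \<in> sphere 0 1 \<Longrightarrow> bloch_coherent_state n \<omega> (\<psi> \<omega>)"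
  shows "(2 * J + 1) / (4 * pi) * (LINT \<omega>|sphere_measure. f (Re ((\<rho> *\<^sub>v \<psi> \<omega>) \<bullet>c \<psi> \<omega>)))
       \<ge> (2 * J + 1) / (4 * pi) * (LINT \<omega>|sphere_measure. f ((cmod (\<psi> north_pole \<bullet>c \<psi> \<omega>))\<^sup>2))
     \<and> (\<forall>\<omega>\<^sub>0 \<in> sphere 0 1.
         (2 * J + 1) / (4 * pi) * (LINT \<omega>|sphere_measure. f (Re ((\<rho> *\<^sub>v \<psi> \<omega>) \<bullet>c \<psi> \<omega>)))
       \<ge> (2 * J + 1) / (4 * pi) * (LINT \<omega>|sphere_measure. f ((cmod (\<psi> \<omega>\<^sub>0 \<bullet>c \<psi> \<omega>))\<^sup>2)))"
proof -
  let ?I = "LINT \<omega>|sphere_measure. f (Re ((\<rho> *\<^sub>v \<psi> \<omega>) \<bullet>c \<psi> \<omega>))"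
  obtain c p where c: "\<forall>k\<le>n. 0 \<le> c k" "(\<Sum>k\<le>n. c k) = 1" and p: "\<forall>k\<le>n. degree (p k) \<le> n" "\<forall>k\<le>n. bombieri_nsq n (p k) = 1"
    and dec: "\<forall>v\<in>carrier_vec (n + 1).
      (\<rho> *\<^sub>v v) \<bullet>c v = complex_of_real (\<Sum>k\<le>n. c k * (cmod (bombieri_ip n (coord_poly n (($) v)) (p k)))\<^sup>2)"
    using density_matrix_decomposition[OF \<rho>] by blast
  define F where "F \<omega> = (\<Sum>k\<le>n. c k * (fact n * (cmod (coherent_eval n (spinor_up \<omega>) (spinor_down \<omega>) (p k)))\<^sup>2))" for \<omega>
  have \<psi>c: "\<psi> \<omega> \<in> carrier_vec (n + 1)" "\<psi> \<omega> \<bullet>c \<psi> \<omega> = 1" if "\<omega> \<in> sphere 0 1" for \<omega>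
    using \<psi>[OF that] by (auto simp: bloch_coherent_state_def)
  have F: "Re ((\<rho> *\<^sub>v \<psi> \<omega>) \<bullet>c \<psi> \<omega>) = F \<omega>" if "\<omega> \<in> sphere 0 1" for \<omega>
    using dec \<psi>c(1)[OF that]
    by (simp only: F_def bloch_coherent_state_bombieri_ip[OF spinor_up_down[OF that] \<psi>[OF that]] Re_complex_of_real)
  have F01: "F \<omega> \<in> {0..1}" if "\<omega> \<in> sphere 0 1" for \<omega>
  proof -
    have b: "fact n * (cmod (coherent_eval n (spinor_up \<omega>) (spinor_down \<omega>) (p k)))\<^sup>2 \<le> 1" if "k \<le> n" for k
    proof -
      have "bombieri_ip n (coord_poly n (($) (\<psi> \<omega>))) (coord_poly n (($) (\<psi> \<omega>))) = 1"
        using \<psi>c[OF \<open>\<omega> \<in> sphere 0 1\<close>] by (simp flip: scalar_prod_coord_poly)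
      then have "bombieri_orthonormal n 1 (\<lambda>_. coord_poly n (($) (\<psi> \<omega>)))" by (simp add: bombieri_orthonormal_def)
      from bessel[OF this, of "p k"] show ?thesis
        using p(2) that
        by (simp add: bloch_coherent_state_bombieri_ip[OF spinor_up_down \<psi>, OF \<open>\<omega> \<in> sphere 0 1\<close> \<open>\<omega> \<in> sphere 0 1\<close>])
    qed
    have "F \<omega> \<le> (\<Sum>k\<le>n. c k * 1)"
      unfolding F_def using c(1) b by (intro sum_mono mult_left_mono) auto
    moreover have "0 \<le> F \<omega>"
      unfolding F_def using c(1) by (intro sum_nonneg mult_nonneg_nonneg) auto
    ultimately show ?thesis using c(2) by simp
  qed
  \<comment> \<open>\<psi> need not be measurable, but its phases cancel: \<open>F\<close> depends
    only on the measurable spinors.\<close>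
  have IF: "?I = (LINT \<omega>|sphere_measure. f (F \<omega>))"
    by (rule Bochner_Integration.integral_cong) (use F in auto)
  have int: "integrable sphere_measure (\<lambda>\<omega>. f (F \<omega>))"
  proof (rule integrable_concave_unit[OF f _ F01])
    show "F \<in> borel_measurable sphere_measure" unfolding F_def by measurable
  qed
  \<comment> \<open>Taking \<open>k = N - n\<close> gives the trace bound the shape of the sequence
    in \<open>overlap_integral_limit\<close>, whose limit does not depend on \<rho>.\<close>
  have ge: "4 * pi / real (N + 1) * (\<Sum>i\<le>N. f (real (i choose n) / real (N choose n))) \<le> ?I" if "n \<le> N" for N
    using coherent_integral_ge_trace[of f "{..n}" c p n "N - n", OF f] c p int that
    unfolding IF F_def by simp
  have main: "(LINT \<omega>|sphere_measure. f ((cmod (\<psi> \<omega>\<^sub>0 \<bullet>c \<psi> \<omega>))\<^sup>2)) \<le> ?I" if \<omega>\<^sub>0: "\<omega>\<^sub>0 \<in> sphere 0 1" for \<omega>\<^sub>0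
  proof -
    let ?z = "spinor_up \<omega>\<^sub>0" and ?w = "spinor_down \<omega>\<^sub>0"
    have sp: "spinor \<omega>\<^sub>0 ?z ?w" using spinor_up_down[OF \<omega>\<^sub>0] .
    then have zw: "(cmod ?z)\<^sup>2 + (cmod ?w)\<^sup>2 = 1" by (simp add: spinor_def)
    obtain d where d: "coord_poly n (($) (\<psi> \<omega>\<^sub>0)) = smult d ([:?z, ?w:] ^ n)" "(cmod d)\<^sup>2 * fact n = 1"
      using bloch_coherent_state_coord_poly[OF sp \<psi>[OF \<omega>\<^sub>0]] by blast
    have "(cmod (\<psi> \<omega>\<^sub>0 \<bullet>c \<psi> \<omega>))\<^sup>2 = overlap ?z ?w \<omega> ^ n" if "\<omega> \<in> sphere 0 1" for \<omega>
    proof -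
      have "(cmod (\<psi> \<omega>\<^sub>0 \<bullet>c \<psi> \<omega>))\<^sup>2 = (cmod d)\<^sup>2 * (cmod (bombieri_ip n (coord_poly n (($) (\<psi> \<omega>))) ([:?z, ?w:] ^ n)))\<^sup>2"
        unfolding scalar_prod_coord_poly[OF \<psi>c(1)[OF \<omega>\<^sub>0] \<psi>c(1)[OF that]] d(1) bombieri_ip_smult_right
        by (simp add: norm_mult power_mult_distrib)
      also have "\<dots> = ((cmod d)\<^sup>2 * fact n) * overlap ?z ?w \<omega> ^ n"
        unfolding bloch_coherent_state_bombieri_ip[OF spinor_up_down[OF that] \<psi>[OF that]] overlap_power by simp
      finally show ?thesis using d(2) by simp
    qed
    then have "(LINT \<omega>|sphere_measure. f ((cmod (\<psi> \<omega>\<^sub>0 \<bullet>c \<psi> \<omega>))\<^sup>2)) = (LINT \<omega>|sphere_measure. f (overlap ?z ?w \<omega> ^ n))"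
      by (intro Bochner_Integration.integral_cong) auto
    also have "\<dots> \<le> ?I"
      by (rule LIMSEQ_le_const2[OF overlap_integral_limit[OF f zw]]) (use ge in blast)
    finally show ?thesis .
  qed
  have "0 \<le> (2 * J + 1) / (4 * pi)" by (simp add: J)
  moreover have "north_pole \<in> sphere 0 1"
    by (simp add: north_pole_def norm_vec_def L2_set_def sum_3 vector_3)
  ultimately show ?thesis using main by (intro conjI ballI mult_left_mono) auto
qed

end
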